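(* Let $D\subset\mathbb C$ be a bounded simply connected domain with an analytic corner at $0$, let $h\colon\partial D\to\mathbb R$ be a continuous function which is a corner function at $0$, and let $u$ be the Dirichlet solution for $h$. Let $r>0$ be such that $D\cap B(0,r)$ is embeddable and let $D'\subset\mathbf L$ be an embedding of $D\cap B(0,r)$. Then there exist a function $f$ holomorphic on $D'$ and continuous on $\overline{D'}$ (closure in $\mathbf L$) with $\operatorname{Re}f=u\circ e$ on $D'$, and a series $g=\sum_{\alpha\ge0}a_\alpha P_\alpha(\log z)z^\alpha\in\mathbb C[[z^*]]_{\log}$, such that for every $R>0$ $$f(z)-\sum_{\alpha\le R}a_\alpha P_\alpha(\log z)z^\alpha=o(|z|^R)\quad\text{as }|z|\to0\text{ on }\overline{D'}.$$ If $\sphericalangle D/\pi\in\mathbb R\setminus\mathbb Q$, then $g\in\mathbb C[[z^*]]$.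
   Context: $\mathbf L=\mathbb R_{>0}\times\mathbb R$ is the Riemann surface of the logarithm (complex structure via $\log(r,\varphi)=\log r+i\varphi$); $|(r,\varphi)|=r$, $z^\alpha=\exp(\alpha\log z)$. $e\colon\mathbf L\to\mathbb C^*$, $e(r,\varphi)=re^{i\varphi}$. A set $A\subset\mathbb C^*$ is embeddable if there is $B\subset\mathbf L$ with $e|_B$ injective and $e(B)=A$ ($B$ is an embedding of $A$). A domain $D\subset\mathbb C$ with $0\in\partial D$ has an analytic corner at $0$ if there are holomorphic $\psi,\chi$ on $B(0,1)$ with $\psi(0)=\chi(0)=0$, $\psi'(0)\chi'(0)\ne0$, such that with $\Gamma=\psi([0,1))$, $\Gamma'=\chi([0,1))$ one has $\partial D\cap B(0,r_0)=(\Gamma\cup\Gamma')\cap B(0,r_0)$ for some $r_0>0$, and the interior angle $\sphericalangle D\in[0,2\pi]$ of $\partial D$ at $0$ (the angle between the tangent directions of $\Gamma$ and $\Gamma'$ at $0$ measured through $D$) is greater than $0$. A continuous $h\colon\partial D\to\mathbb R$ is a corner function at $0$ if there are $0<\varepsilon\le1$ and real convergent Puiseux series $g_0,g_1$ on $(0,\varepsilon)$ (i.e. $g_i(t)=\sum_n c_nt^{n/d}$ convergent) with $h(\psi(t))=g_0(t)$ and $h(\chi(t))=g_1(t)$ for $0<t<\varepsilon$. The Dirichlet solution for $h$ is the function continuous on $\overline D$, harmonic in $D$, equal to $h$ on $\partial D$. $\mathbb C[[z^*]]_{\log}$ is the set of formal series $\sum_{\alpha\in\mathbb R_{\ge0}}a_\alpha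 P_\alpha(\log z)z^\alpha$ with $a_\alpha\in\mathbb C$, $P_\alpha$ monic polynomials, $P_0=1$, and $\{\alpha:a_\alpha\ne0\}\cap[0,R]$ finite for each $R>0$; $\mathbb C[[z^*]]$ is the subset with all $P_\alpha=1$.
   Formalization: Continuity of f on the closure of D' is claimed only for |z|<ρ, with ρ>0 depending on the data (for large r it can fail); D' is assumed open in L; and near 0 the domain D is assumed to be the single region between Γ and Γ', so that the angle through D is defined. *)

theory Defs
  imports "HOL-Complex_Analysis.Complex_Analysis" "HOL-Library.Landau_Symbols"
begin

subsection \<open>The Riemann surface of the logarithm\<close>

text \<open>Points are pairs \<open>(r, \<phi>)\<close> with \<open>r > 0\<close>; the topology is that of \<open>real \<times> real\<close>.\<close>

type_synonym logpt = "real \<times> real"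

definition log_surface :: "logpt set" where
  "log_surface = {0<..} \<times> UNIV"

definition lmod :: "logpt \<Rightarrow> real" where
  "lmod z = fst z"

definition llog :: "logpt \<Rightarrow> complex" where
  "llog z = Complex (ln (fst z)) (snd z)"

definition lexp :: "complex \<Rightarrow> logpt" where
  "lexp w = (exp (Re w), Im w)"

definition lpow :: "logpt \<Rightarrow> real \<Rightarrow> complex" where
  "lpow z \<alpha> = exp (of_real \<alpha> * llog z)"

definition lproj :: "logpt \<Rightarrow> complex" where
  "lproj z = of_real (fst z) * cis (snd z)"

text \<open>\<open>llog\<close> is the global chart of the surface, with inverse \<open>lexp\<close>.\<close>

definition lholomorphic_on :: "(logpt \<Rightarrow> complex) \<Rightarrow> logpt set \<Rightarrow> bool" where
  "lholomorphic_on f B \<longleftrightarrow> (f \<circ> lexp) holomorphic_on (llog ` B)"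

definition lclosure :: "logpt set \<Rightarrow> logpt set" where
  "lclosure B = closure B \<inter> log_surface"

text \<open>The filter of points of \<open>B\<close> whose modulus tends to \<open>0\<close>.\<close>

definition lmod_to_0 :: "logpt set \<Rightarrow> logpt filter" where
  "lmod_to_0 B = inf (filtercomap lmod (at_right 0)) (principal B)"

definition log_embedding :: "logpt set \<Rightarrow> complex set \<Rightarrow> bool" where
  "log_embedding B A \<longleftrightarrow> B \<subseteq> log_surface \<and> inj_on lproj B \<and> lproj ` B = A"


subsection \<open>Analytic corners and corner functions\<close>

text \<open>
  The interior angle at \<open>0\<close> between the tangent directions \<open>cis \<alpha>\<close>, \<open>cis \<beta>\<close> of the arcs
  \<open>\<psi>([0,1))\<close> and \<open>\<eta>([0,1))\<close>, measured through \<open>D\<close>, counterclockwise from the first arc to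
  the second: near \<open>0\<close> the first arc consists of the points \<open>s e\<^sup>i\<^sup>a\<^sup>(\<^sup>s\<^sup>)\<close>, the second one of the
  points \<open>s e\<^sup>i\<^sup>b\<^sup>(\<^sup>s\<^sup>)\<close>, and \<open>D\<close> is the region swept out in between. A slit (both arcs equal,
  \<open>b = a + 2\<pi>\<close>) and tangential arcs are included. Only the germs of the arcs at \<open>0\<close> enter,
  so \<open>\<psi>\<close>, \<open>\<eta>\<close> need not be injective on all of \<open>[0,1)\<close>.
\<close>

definition ccw_angle_through ::
  "complex set \<Rightarrow> (complex \<Rightarrow> complex) \<Rightarrow> (complex \<Rightarrow> complex) \<Rightarrow> real \<Rightarrow> bool" where
  "ccw_angle_through D \<psi> \<eta> \<theta> \<longleftrightarrow>
     (\<exists>\<alpha> \<beta> a b \<rho> \<delta> \<delta>'.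
        sgn (deriv \<psi> 0) = cis \<alpha> \<and> sgn (deriv \<eta> 0) = cis \<beta> \<and> \<theta> = \<beta> - \<alpha> \<and>
        (a \<longlongrightarrow> \<alpha>) (at_right 0) \<and> (b \<longlongrightarrow> \<beta>) (at_right 0) \<and>
        0 < \<rho> \<and> \<delta> \<in> {0<..1} \<and> \<delta>' \<in> {0<..1} \<and>
        (\<lambda>t. \<psi> (of_real t)) ` {0<..<\<delta>} = {rcis s (a s) | s. 0 < s \<and> s < \<rho>} \<and>
        (\<lambda>t. \<eta> (of_real t)) ` {0<..<\<delta>'} = {rcis s (b s) | s. 0 < s \<and> s < \<rho>} \<and>
        (\<forall>s\<in>{0<..<\<rho>}. a s < b s \<and> b s \<le> a s + 2 * pi) \<and>
        D \<inter> ball 0 \<rho> = {rcis s \<phi> | s \<phi>. 0 < s \<and> s < \<rho> \<and> a s < \<phi> \<and> \<phi> < b s})"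

definition interior_angle ::
  "complex set \<Rightarrow> (complex \<Rightarrow> complex) \<Rightarrow> (complex \<Rightarrow> complex) \<Rightarrow> real \<Rightarrow> bool" where
  "interior_angle D \<psi> \<eta> \<theta> \<longleftrightarrow> ccw_angle_through D \<psi> \<eta> \<theta> \<or> ccw_angle_through D \<eta> \<psi> \<theta>"

definition analytic_corner ::
  "complex set \<Rightarrow> (complex \<Rightarrow> complex) \<Rightarrow> (complex \<Rightarrow> complex) \<Rightarrow> real \<Rightarrow> bool" where
  "analytic_corner D \<psi> \<eta> \<theta> \<longleftrightarrow>
     0 \<in> frontier D \<and>
     \<psi> holomorphic_on ball 0 1 \<and> \<eta> holomorphic_on ball 0 1 \<and>
     \<psi> 0 = 0 \<and> \<eta> 0 = 0 \<and> deriv \<psi> 0 * deriv \<eta> 0 \<noteq> 0 \<and>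
     (\<exists>r0>0. frontier D \<inter> ball 0 r0 =
        ((\<lambda>t. \<psi> (of_real t)) ` {0..<1} \<union> (\<lambda>t. \<eta> (of_real t)) ` {0..<1}) \<inter> ball 0 r0) \<and>
     interior_angle D \<psi> \<eta> \<theta> \<and> 0 < \<theta>"

definition convergent_puiseux :: "real \<Rightarrow> (real \<Rightarrow> real) \<Rightarrow> bool" where
  "convergent_puiseux \<epsilon> g \<longleftrightarrow>
     (\<exists>(c :: nat \<Rightarrow> real) (d :: nat). d > 0 \<and>
        (\<forall>t\<in>{0<..<\<epsilon>}. (\<lambda>n. c n * t powr (real n / real d)) sums g t))"

definition corner_function ::
  "(complex \<Rightarrow> real) \<Rightarrow> (complex \<Rightarrow> complex) \<Rightarrow> (complex \<Rightarrow> complex) \<Rightarrow> bool" where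
  "corner_function h \<psi> \<eta> \<longleftrightarrow>
     (\<exists>\<epsilon> g0 g1. 0 < \<epsilon> \<and> \<epsilon> \<le> 1 \<and> convergent_puiseux \<epsilon> g0 \<and> convergent_puiseux \<epsilon> g1 \<and>
        (\<forall>t\<in>{0<..<\<epsilon>}. h (\<psi> (of_real t)) = g0 t \<and> h (\<eta> (of_real t)) = g1 t))"


subsection \<open>The Dirichlet problem\<close>

text \<open>Twice continuously differentiable with vanishing Laplacian; \<open>p\<close>, \<open>q\<close> are the first
  partial derivatives of \<open>u\<close>, and the \<open>p\<^sub>x\<close>, \<open>p\<^sub>y\<close>, \<open>q\<^sub>x\<close>, \<open>q\<^sub>y\<close> the second ones.\<close>

definition harmonic_on :: "(complex \<Rightarrow> real) \<Rightarrow> complex set \<Rightarrow> bool" where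
  "harmonic_on u D \<longleftrightarrow>
     (\<exists>p q px py qx qy :: complex \<Rightarrow> real.
        continuous_on D px \<and> continuous_on D py \<and> continuous_on D qx \<and> continuous_on D qy \<and>
        (\<forall>z\<in>D.
           (u has_derivative (\<lambda>v. p z * Re v + q z * Im v)) (at z) \<and>
           (p has_derivative (\<lambda>v. px z * Re v + py z * Im v)) (at z) \<and>
           (q has_derivative (\<lambda>v. qx z * Re v + qy z * Im v)) (at z) \<and>
           px z + qy z = 0))"

definition dirichlet_solution ::
  "complex set \<Rightarrow> (complex \<Rightarrow> real) \<Rightarrow> (complex \<Rightarrow> real) \<Rightarrow> bool" where
  "dirichlet_solution D h u \<longleftrightarrow>
     continuous_on (closure D) u \<and> harmonic_on u D \<and> (\<forall>z\<in>frontier D. u z = h z)"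


subsection \<open>Generalized power series with logarithms\<close>

text \<open>
  A pair \<open>(a, P)\<close> stands for the formal series of the \<open>a \<alpha> * P \<alpha> (log z) * z\<^sup>\<alpha>\<close>, \<open>\<alpha> \<ge> 0\<close>;
  values at negative arguments are irrelevant.
\<close>

type_synonym gen_series = "(real \<Rightarrow> complex) \<times> (real \<Rightarrow> complex poly)"

definition log_series :: "gen_series set" where
  "log_series = {(a, P).
     (\<forall>\<alpha>\<ge>0. lead_coeff (P \<alpha>) = 1) \<and> P 0 = 1 \<and>
     (\<forall>R>0. finite ({\<alpha>. 0 \<le> \<alpha> \<and> a \<alpha> \<noteq> 0} \<inter> {0..R}))}"

definition power_series_real_exp :: "gen_series set" where
  "power_series_real_exp = {(a, P) \<in> log_series. \<forall>\<alpha>\<ge>0. P \<alpha> = 1}"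

definition partial_series :: "gen_series \<Rightarrow> real \<Rightarrow> logpt \<Rightarrow> complex" where
  "partial_series g R z =
     (\<Sum>\<alpha> | 0 \<le> \<alpha> \<and> \<alpha> \<le> R \<and> fst g \<alpha> \<noteq> 0. fst g \<alpha> * poly (snd g \<alpha>) (llog z) * lpow z \<alpha>)"

end

theory Submission
  imports Defs
begin

text \<open>
  In the coordinate \<open>w = log z\<close> the corner becomes a half strip of height \<open>\<theta>\<close>, bounded by two
  analytic curves that approach horizontal lines exponentially fast. Write \<open>u\<close> as the real part of
  a holomorphic \<open>F\<close>. On each curve the real part of \<open>F\<close> is a convergent series in \<open>exp (s / d)\<close>, so
  \<open>F\<close> extends across both curves by reflection. Composing the two reflections and straightening
  the first curve turns the boundary conditions into one functional equation
  \<open>F (B\<^sub>1 s) - F (B\<^sub>2 s) = K (exp (s / d))\<close>, where \<open>B\<^sub>1\<close> and \<open>B\<^sub>2\<close> are exponentially close to the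
  translations by \<open>c \<plusminus> \<i> \<theta>\<close>.

  If \<open>F(w + \<i> \<theta>) - F(w - \<i> \<theta>)\<close> decays faster than \<open>F\<close> does, a Cauchy integral with a
  \<open>2 \<i> \<theta>\<close>-periodic kernel shows that \<open>F\<close> itself has the better decay up to a multiple of one
  exponential \<open>exp (k \<pi> w / \<theta>)\<close>. Subtracting explicit solutions of the translation equation and
  iterating yields expansions to every order, with exponents \<open>n / d + k \<pi> / \<theta>\<close>. Logarithms arise
  only when such an exponent with \<open>n \<ge> 1\<close> is an integer multiple of \<open>\<pi> / \<theta>\<close>, which is impossible
  for irrational \<open>\<theta> / \<pi>\<close>.
  Uniqueness of expansions makes those of different orders fit into a single series.
\<close>

section \<open>Asymptotic order and exponential polynomials in a left half strip\<close>

text \<open>A conformal change that straightens one arc leaves the other curved in general, and for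
  irrational \<open>\<theta> / pi\<close> no root substitution unfolds the corner. This is why the
  shifts in the functional equation are only asymptotically translations, and why its solution has
  to be bootstrapped. The bootstrap works because replacing \<open>B1\<close> or \<open>B2\<close>
  by its limiting translation costs the derivative of the remainder times a factor
  \<open>exp s\<close>: the error is better than the remainder by one full order. The limiting
  translations differ by \<open>2 * \<i> * \<theta>\<close>, so the homogeneous exponents are the
  real solutions \<alpha> of \<open>exp (2 * \<i> * \<theta> * \<alpha>) = 1\<close>, the multiples
  of \<open>pi / \<theta>\<close>. The starting information is weak: \<open>u\<close> is bounded,
  hence \<open>F\<close> grows more slowly than every \<open>exp (- \<epsilon> * w)\<close>.
  Together with short steps this excludes negative multiples of \<open>pi / \<theta>\<close>. All
  estimates hold on strips slightly wider than the image of the corner. The expansion is therefore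
  uniform up to both edges, and the closure of the embedded domain needs no separate
  argument.\<close>

definition strip_bot :: "real \<Rightarrow> complex filter" where
  "strip_bot y = inf (filtercomap Re at_bot) (principal {w. \<bar>Im w\<bar> \<le> y})"

lemma eventually_strip_bot:
  "eventually P (strip_bot y) \<longleftrightarrow> (\<exists>M. \<forall>w. Re w \<le> M \<longrightarrow> \<bar>Im w\<bar> \<le> y \<longrightarrow> P w)"
  unfolding strip_bot_def eventually_inf_principal eventually_filtercomap_at_bot_linorder
  by auto

lemma eventually_Re_at_bot:
  "eventually P (filtercomap Re at_bot) \<longleftrightarrow> (\<exists>M. \<forall>w. Re w \<le> M \<longrightarrow> P w)"
  unfolding eventually_filtercomap_at_bot_linorder by auto

text \<open>For \<open>w = log z\<close> this is \<open>O(|z|\<^sup>\<rho>)\<close>, uniformly on every closed subsector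
  of the sector \<open>|arg z| < Y\<close>.\<close>

definition exp_order :: "real \<Rightarrow> real \<Rightarrow> (complex \<Rightarrow> complex) \<Rightarrow> bool" where
  "exp_order Y \<rho> G \<longleftrightarrow> (\<forall>y<Y. G \<in> O[strip_bot y](\<lambda>w. exp (of_real \<rho> * w)))"

lemma exp_orderI:
  assumes "\<And>y. y < Y \<Longrightarrow> \<exists>C M. \<forall>w. Re w \<le> M \<longrightarrow> \<bar>Im w\<bar> \<le> y \<longrightarrow> norm (G w) \<le> C * exp (\<rho> * Re w)"
  shows "exp_order Y \<rho> G"
  unfolding exp_order_def
proof safe
  fix y assume "y < Y"
  then obtain C M where "\<forall>w. Re w \<le> M \<longrightarrow> \<bar>Im w\<bar> \<le> y \<longrightarrow> norm (G w) \<le> C * exp (\<rho> * Re w)"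
    using assms by blast
  then show "G \<in> O[strip_bot y](\<lambda>w. exp (of_real \<rho> * w))"
    by (intro bigoI[of _ C]) (auto simp: eventually_strip_bot)
qed

lemma exp_orderD:
  assumes "exp_order Y \<rho> G" "y < Y"
  obtains C M where "C > 0" "\<And>w. Re w \<le> M \<Longrightarrow> \<bar>Im w\<bar> \<le> y \<Longrightarrow> norm (G w) \<le> C * exp (\<rho> * Re w)"
proof -
  have "G \<in> O[strip_bot y](\<lambda>w. exp (of_real \<rho> * w))"
    using assms by (auto simp: exp_order_def)
  then obtain C where C: "C > 0" "eventually (\<lambda>w. norm (G w) \<le> C * norm (exp (of_real \<rho> * w))) (strip_bot y)"
    by (elim landau_o.bigE)
  then show thesis
    using that unfolding eventually_strip_bot by auto
qed

section \<open>Algebra of orders of growth\<close>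

lemma exp_order_add: "exp_order Y \<rho> f \<Longrightarrow> exp_order Y \<rho> g \<Longrightarrow> exp_order Y \<rho> (\<lambda>w. f w + g w)"
  unfolding exp_order_def by (auto intro: sum_in_bigo)

lemma exp_order_diff: "exp_order Y \<rho> f \<Longrightarrow> exp_order Y \<rho> g \<Longrightarrow> exp_order Y \<rho> (\<lambda>w. f w - g w)"
  unfolding exp_order_def by (auto intro: sum_in_bigo)

lemma exp_order_cmult: "exp_order Y \<rho> f \<Longrightarrow> exp_order Y \<rho> (\<lambda>w. c * f w)"
  unfolding exp_order_def by auto

lemma exp_order_zero: "exp_order Y \<rho> (\<lambda>_. 0)"
  unfolding exp_order_def by auto

lemma exp_order_sum:
  "(\<And>i. i \<in> I \<Longrightarrow> exp_order Y \<rho> (f i)) \<Longrightarrow> exp_order Y \<rho> (\<lambda>w. \<Sum>i\<in>I. f i w)"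
  unfolding exp_order_def by (auto intro: big_sum_in_bigo)

lemma exp_order_mult:
  assumes "exp_order Y a f" "exp_order Y b g"
  shows "exp_order Y (a + b) (\<lambda>w. f w * g w)"
  unfolding exp_order_def
proof safe
  fix y assume "y < Y"
  then have "(\<lambda>w. f w * g w) \<in> O[strip_bot y](\<lambda>w. exp (of_real a * w) * exp (of_real b * w))"
    using assms by (auto simp: exp_order_def intro: landau_o.big.mult)
  then show "(\<lambda>w. f w * g w) \<in> O[strip_bot y](\<lambda>w. exp (of_real (a + b) * w))"
    by (simp add: exp_add ring_distribs)
qed

lemma exp_order_power:
  "exp_order Y a f \<Longrightarrow> exp_order Y (real j * a) (\<lambda>w. f w ^ j)"
proof (induction j)
  case 0
  show ?case by (auto simp: exp_order_def)
next
  case (Suc j)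
  then have "exp_order Y (a + real j * a) (\<lambda>w. f w * f w ^ j)"
    by (intro exp_order_mult) auto
  then show ?case by (simp add: algebra_simps)
qed

lemma exp_order_mono:
  assumes "exp_order Y \<rho> G" "\<rho>' \<le> \<rho>"
  shows "exp_order Y \<rho>' G"
proof (rule exp_orderI)
  fix y assume "y < Y"
  from exp_orderD[OF assms(1) this] obtain C M where CM: "C > 0"
    "\<And>w. Re w \<le> M \<Longrightarrow> \<bar>Im w\<bar> \<le> y \<Longrightarrow> norm (G w) \<le> C * exp (\<rho> * Re w)"
    by blast
  have "norm (G w) \<le> C * exp (\<rho>' * Re w)" if "Re w \<le> min M 0" "\<bar>Im w\<bar> \<le> y" for w
  proof -
    have "norm (G w) \<le> C * exp (\<rho> * Re w)" using CM that by auto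
    also have "\<dots> \<le> C * exp (\<rho>' * Re w)"
      using CM(1) that assms(2) by (auto intro: mult_right_mono_neg)
    finally show ?thesis .
  qed
  then show "\<exists>C M. \<forall>w. Re w \<le> M \<longrightarrow> \<bar>Im w\<bar> \<le> y \<longrightarrow> norm (G w) \<le> C * exp (\<rho>' * Re w)"
    by blast
qed

lemma exp_order_mono_strip: "exp_order Y \<rho> G \<Longrightarrow> Y' \<le> Y \<Longrightarrow> exp_order Y' \<rho> G"
  unfolding exp_order_def by auto

lemma exp_order_exp: "exp_order Y \<rho> (\<lambda>w. exp (of_real \<rho> * w))"
  unfolding exp_order_def by auto

text \<open>In terms of z, a logarithm is smaller than every negative power of |z|. The constant
  comes from \<open>1 + x \<le> exp x\<close> with \<open>x = - \<epsilon> * Re w\<close>.\<close>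

lemma exp_order_ident:
  assumes "\<epsilon> > 0"
  shows "exp_order Y (-\<epsilon>) (\<lambda>w. w)"
proof (rule exp_orderI)
  fix y
  have "norm w \<le> (1 / \<epsilon> + \<bar>y\<bar>) * exp (- \<epsilon> * Re w)" if "Re w \<le> 0" "\<bar>Im w\<bar> \<le> y" for w
  proof -
    have "norm w \<le> \<bar>Re w\<bar> + \<bar>Im w\<bar>" by (rule cmod_le)
    also have "\<dots> \<le> - Re w + \<bar>y\<bar>" using that by auto
    also have "- Re w \<le> (1 / \<epsilon>) * exp (- \<epsilon> * Re w)"
      using exp_ge_add_one_self[of "- \<epsilon> * Re w"] assms by (simp add: field_simps)
    also have "\<bar>y\<bar> \<le> \<bar>y\<bar> * exp (- \<epsilon> * Re w)"
      using that assms mult_left_mono[of 1 "exp (- \<epsilon> * Re w)" "\<bar>y\<bar>"] by (auto simp: mult_nonneg_nonpos)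
    finally show ?thesis by (simp add: algebra_simps)
  qed
  then show "\<exists>C M. \<forall>w. Re w \<le> M \<longrightarrow> \<bar>Im w\<bar> \<le> y \<longrightarrow> norm w \<le> C * exp (- \<epsilon> * Re w)"
    by blast
qed

lemma exp_order_term:
  assumes "\<sigma> < \<alpha>"
  shows "exp_order Y \<sigma> (\<lambda>w. (w + c) ^ j * exp (of_real \<alpha> * w))"
proof -
  \<comment> \<open>Each of the \<open>j\<close> factors \<open>w + c\<close> loses \<epsilon>; the
    total loss \<open>j * \<epsilon>\<close> must not exceed \<open>\<alpha> - \<sigma>\<close>, and
    the added 1 covers \<open>j = 0\<close>.\<close>
  define \<epsilon> where "\<epsilon> = (\<alpha> - \<sigma>) / (real j + 1)"
  have e: "\<epsilon> > 0" using assms by (simp add: \<epsilon>_def)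
  have c: "exp_order Y (-\<epsilon>) (\<lambda>w. c)"
    using exp_order_mono[of Y 0 "\<lambda>w. c" "-\<epsilon>"] e by (auto simp: exp_order_def)
  have "exp_order Y (real j * (-\<epsilon>) + \<alpha>) (\<lambda>w. (w + c) ^ j * exp (of_real \<alpha> * w))"
    by (intro exp_order_mult exp_order_power exp_order_exp exp_order_add exp_order_ident e c)
  moreover have "\<sigma> \<le> real j * (-\<epsilon>) + \<alpha>"
    using assms by (simp add: \<epsilon>_def field_simps)
  ultimately show ?thesis by (rule exp_order_mono)
qed

text \<open>With \<open>w = log z\<close>, a pair \<open>(\<alpha>, j)\<close> stands for the term \<open>z\<^sup>\<alpha> (log z)\<^sup>j\<close>.\<close>

inductive_set explog :: "(real \<times> nat) set \<Rightarrow> (complex \<Rightarrow> complex) set" for V where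
  zero: "(\<lambda>_. 0) \<in> explog V"
| add: "f \<in> explog V \<Longrightarrow> (\<alpha>, j) \<in> V \<Longrightarrow> (\<lambda>w. f w + c * (w ^ j * exp (of_real \<alpha> * w))) \<in> explog V"

section \<open>Closure properties of finite exponential-polynomial sums\<close>

lemma explog_term: "(\<alpha>, j) \<in> V \<Longrightarrow> (\<lambda>w. c * (w ^ j * exp (of_real \<alpha> * w))) \<in> explog V"
  using explog.add[OF explog.zero] by fastforce

lemma explog_mono: "f \<in> explog V \<Longrightarrow> V \<subseteq> W \<Longrightarrow> f \<in> explog W"
  by (induction rule: explog.induct) (auto intro: explog.intros)

lemma explog_add:
  assumes "g \<in> explog V" "f \<in> explog V"
  shows "(\<lambda>w. f w + g w) \<in> explog V"
  using assms(1)
proof (induction rule: explog.induct)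
  case zero
  then show ?case using assms by simp
next
  case (add g \<alpha> j c)
  from explog.add[OF add.IH add.hyps(2)] show ?case by (simp add: add.assoc)
qed

lemma explog_cmult: "f \<in> explog V \<Longrightarrow> (\<lambda>w. k * f w) \<in> explog V"
proof (induction rule: explog.induct)
  case zero
  then show ?case using explog.zero by simp
next
  case (add f \<alpha> j c)
  from explog.add[OF add.IH add.hyps(2), of "k * c"] show ?case by (simp add: algebra_simps)
qed

lemma explog_diff: "f \<in> explog V \<Longrightarrow> g \<in> explog V \<Longrightarrow> (\<lambda>w. f w - g w) \<in> explog V"
  using explog_add[OF explog_cmult[of g V "-1"], of f] by simp

lemma explog_sum: "(\<And>i. i \<in> I \<Longrightarrow> f i \<in> explog V) \<Longrightarrow> (\<lambda>w. \<Sum>i\<in>I. f i w) \<in> explog V"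
  by (induction I rule: infinite_finite_induct) (auto intro: explog.zero explog_add)

lemma exp_poly_shift:
  fixes w c :: complex
  shows "(w + c) ^ m * exp (of_real \<alpha> * (w + c)) =
    (\<Sum>k\<le>m. (of_nat (m choose k) * c ^ (m - k) * exp (of_real \<alpha> * c)) * (w ^ k * exp (of_real \<alpha> * w)))"
  by (auto simp: binomial_ring exp_add ring_distribs sum_distrib_left sum_distrib_right mult_ac intro!: sum.cong)

lemma explog_shift_term:
  "(\<lambda>w. (w + c) ^ m * exp (of_real \<alpha> * (w + c))) \<in> explog ({\<alpha>} \<times> {..m})"
proof -
  have "(\<lambda>w. \<Sum>k\<le>m. (of_nat (m choose k) * c ^ (m - k) * exp (of_real \<alpha> * c)) *
        (w ^ k * exp (of_real \<alpha> * w))) \<in> explog ({\<alpha>} \<times> {..m})"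
    by (intro explog_sum explog_term) auto
  then show ?thesis by (simp only: exp_poly_shift)
qed

lemma explog_mult_exp:
  "f \<in> explog V \<Longrightarrow> (\<lambda>w. f w * exp (of_real \<kappa> * w)) \<in> explog ((\<lambda>(\<alpha>, j). (\<alpha> + \<kappa>, j)) ` V)"
proof (induction rule: explog.induct)
  case zero
  then show ?case using explog.zero by simp
next
  case (add f \<alpha> j c)
  have "(\<alpha> + \<kappa>, j) \<in> (\<lambda>(\<alpha>, j). (\<alpha> + \<kappa>, j)) ` V" using add by force
  from explog.add[OF add.IH this, of c] show ?case
    by (simp add: algebra_simps exp_add)
qed

text \<open>Expanding \<open>(w + c) ^ j\<close> produces all lower powers of \<open>w\<close>,
  hence the closure condition on \<open>V\<close>.\<close>

lemma explog_shift:
  assumes "f \<in> explog V" "\<And>\<alpha> j i. (\<alpha>, j) \<in> V \<Longrightarrow> i \<le> j \<Longrightarrow> (\<alpha>, i) \<in> V"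
  shows "(\<lambda>w. f (w + c)) \<in> explog V"
  using assms(1)
proof (induction rule: explog.induct)
  case zero
  then show ?case using explog.zero by simp
next
  case (add f \<alpha> j k)
  have "{\<alpha>} \<times> {..j} \<subseteq> V" using assms(2) add by auto
  from explog_add[OF explog_cmult[OF explog_mono[OF explog_shift_term this], of k] add.IH, of c]
  show ?case by (simp add: algebra_simps)
qed

lemma explog_holomorphic: "f \<in> explog V \<Longrightarrow> f holomorphic_on S"
  by (induction rule: explog.induct) (auto intro!: holomorphic_intros)

lemma exp_order_explog:
  assumes "f \<in> explog V" "\<And>\<alpha> j. (\<alpha>, j) \<in> V \<Longrightarrow> \<sigma> < \<alpha>"
  shows "exp_order Y \<sigma> f"
  using assms(1)
proof (induction rule: explog.induct)
  case zero
  then show ?case by (rule exp_order_zero)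
next
  case (add f \<alpha> j k)
  then show ?case
    using exp_order_term[of \<sigma> \<alpha> Y 0 j] assms(2)
    by (intro exp_order_add add.IH exp_order_cmult) auto
qed

text \<open>The difference of the two translates acts on \<open>w ^ m * exp (\<alpha> * w)\<close>
  as a triangular operator in the powers of \<open>w\<close>. Its diagonal entry is a multiple of
  \<open>exp (\<alpha> * c1) - exp (\<alpha> * c2)\<close>. At a resonance this entry vanishes and
  the next one, which contains \<open>c1 - c2\<close>, takes over, so the solution needs one power
  more than the right-hand side. This is where logarithms are created.\<close>

lemma explog_solve_term:
  fixes \<alpha> :: real and j :: nat and c1 c2 :: complex
  assumes "c1 - c2 \<noteq> 0"
  defines "W \<equiv> (if exp (of_real \<alpha> * c1) = exp (of_real \<alpha> * c2) then {\<alpha>} \<times> UNIV else {\<alpha>} \<times> {..j})"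
  shows "\<exists>X \<in> explog W. \<forall>w. X (w + c1) - X (w + c2) = w ^ j * exp (of_real \<alpha> * w)"
  unfolding W_def
proof (induction j rule: less_induct)
  case (less j)
  define e1 where "e1 = exp (of_real \<alpha> * c1)"
  define e2 where "e2 = exp (of_real \<alpha> * c2)"
  \<comment> \<open>The degree of the ansatz: one higher at a resonance, because the leading power
    then cancels.\<close>
  define m where "m = (if e1 = e2 then Suc j else j)"
  define W where "W j = (if e1 = e2 then {\<alpha>} \<times> UNIV else {\<alpha>} \<times> {..j::nat})" for j
  have nz: "e1 \<noteq> 0" by (simp add: e1_def)
  define co where "co k = of_nat (m choose k) * (c1 ^ (m - k) * e1 - c2 ^ (m - k) * e2)" for k
  define l where "l = co j"
  have l: "l \<noteq> 0"
  proof (cases "e1 = e2")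
    case True
    then have "l = of_nat (Suc j) * ((c1 - c2) * e1)"
      by (simp add: l_def co_def m_def algebra_simps)
    moreover have "of_nat (Suc j) \<noteq> (0::complex)" by (rule of_nat_neq_0)
    ultimately show ?thesis using nz assms(1) by (metis mult_eq_0_iff)
  qed (auto simp: l_def co_def m_def)
  have top: "co m * x = (if e1 = e2 then 0 else l * x)" for x
    by (auto simp: co_def l_def m_def)
  have expand: "(w + c1) ^ m * exp (of_real \<alpha> * (w + c1)) - (w + c2) ^ m * exp (of_real \<alpha> * (w + c2))
     = l * (w ^ j * exp (of_real \<alpha> * w)) + (\<Sum>k<j. co k * (w ^ k * exp (of_real \<alpha> * w)))" for w
  proof -
    have "(w + c1) ^ m * exp (of_real \<alpha> * (w + c1)) - (w + c2) ^ m * exp (of_real \<alpha> * (w + c2))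
      = (\<Sum>k\<le>m. co k * (w ^ k * exp (of_real \<alpha> * w)))"
      by (simp only: exp_poly_shift[of w c1] exp_poly_shift[of w c2] co_def e1_def e2_def
          sum_subtractf [symmetric] left_diff_distrib right_diff_distrib mult.assoc)
    also have "\<dots> = (\<Sum>k\<le>j. co k * (w ^ k * exp (of_real \<alpha> * w)))"
      using top by (auto simp: m_def)
    also have "\<dots> = l * (w ^ j * exp (of_real \<alpha> * w)) + (\<Sum>k<j. co k * (w ^ k * exp (of_real \<alpha> * w)))"
      by (simp add: l_def lessThan_Suc_atMost [symmetric])
    finally show ?thesis .
  qed
  have "\<forall>k. \<exists>X. k < j \<longrightarrow> X \<in> explog (W k) \<and> (\<forall>w. X (w + c1) - X (w + c2) = w ^ k * exp (of_real \<alpha> * w))"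
    using less unfolding W_def e1_def e2_def by blast
  then obtain X where X: "\<And>k. k < j \<Longrightarrow> X k \<in> explog (W k)"
    "\<And>k w. k < j \<Longrightarrow> X k (w + c1) - X k (w + c2) = w ^ k * exp (of_real \<alpha> * w)"
    by metis
  \<comment> \<open>The ansatz reproduces the wanted term with factor \<open>l\<close>, plus lower
    powers of \<open>w\<close>; these are removed by the solutions that the induction
    supplies.\<close>
  define Z where "Z w = (1 / l) * (w ^ m * exp (of_real \<alpha> * w) - (\<Sum>k<j. co k * X k w))" for w
  have "Z \<in> explog (W j)"
    unfolding Z_def [abs_def]
  proof (intro explog_cmult explog_diff explog_sum)
    have "(\<alpha>, m) \<in> W j" by (auto simp: W_def m_def)
    then show "(\<lambda>w. w ^ m * exp (of_real \<alpha> * w)) \<in> explog (W j)"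
      using explog_term[of \<alpha> m "W j" 1] by simp
    show "X k \<in> explog (W j)" if "k \<in> {..<j}" for k
      using that by (intro explog_mono[OF X(1)]) (auto simp: W_def)
  qed
  moreover have "Z (w + c1) - Z (w + c2) = w ^ j * exp (of_real \<alpha> * w)" for w
  proof -
    have "Z (w + c1) - Z (w + c2) = (1 / l) * (((w + c1) ^ m * exp (of_real \<alpha> * (w + c1)) - (w + c2) ^ m * exp (of_real \<alpha> * (w + c2)))
       - (\<Sum>k<j. co k * (X k (w + c1) - X k (w + c2))))"
      by (simp add: Z_def sum_subtractf ring_distribs)
    also have "(\<Sum>k<j. co k * (X k (w + c1) - X k (w + c2))) = (\<Sum>k<j. co k * (w ^ k * exp (of_real \<alpha> * w)))"
      using X(2) by (intro sum.cong) auto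
    also note expand
    finally show ?thesis using l by simp
  qed
  ultimately show ?case unfolding W_def e1_def e2_def by blast
qed

section \<open>Logarithms of analytic arcs\<close>
lemma holomorphic_quotient_at_0:
  assumes "K holomorphic_on ball 0 r" "r > 0"
  obtains K1 where "K1 holomorphic_on ball 0 r" "K1 0 = deriv K 0" "\<And>q. K q = K 0 + q * K1 q"
proof -
  define K1 where "K1 q = (if q = 0 then deriv K 0 else (K q - K 0) / (q - 0))" for q
  have "K1 holomorphic_on ball 0 r"
    unfolding K1_def [abs_def] by (rule pole_lemma) (use assms in auto)
  moreover have "K q = K 0 + q * K1 q" for q by (auto simp: K1_def)
  moreover have "K1 0 = deriv K 0" by (simp add: K1_def)
  ultimately show thesis using that by blast
qed

text \<open>Repeated division by \<open>q\<close>. Stating the remainder as \<open>q ^ N\<close>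
  times a holomorphic function makes its bound near 0 immediate; the clause on \<open>a 0\<close>
  lets a vanishing constant term be dropped from the list of exponents.\<close>

lemma holomorphic_taylor_remainder:
  assumes "K holomorphic_on ball 0 r" "r > 0"
  shows "\<exists>a K'. K' holomorphic_on ball 0 r \<and> (\<forall>q. K q = (\<Sum>k<N. a k * q ^ k) + q ^ N * K' q)
           \<and> (0 < N \<longrightarrow> a 0 = K 0)"
proof (induction N)
  case 0
  show ?case using assms by (intro exI[of _ "\<lambda>_. 0"] exI[of _ K]) auto
next
  case (Suc N)
  then obtain a K' where *: "K' holomorphic_on ball 0 r" "\<And>q. K q = (\<Sum>k<N. a k * q ^ k) + q ^ N * K' q"
    "0 < N \<Longrightarrow> a 0 = K 0" by blast
  obtain K1 where K1: "K1 holomorphic_on ball 0 r" "\<And>q. K' q = K' 0 + q * K1 q"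
    using holomorphic_quotient_at_0[OF *(1) assms(2)] by metis
  define a' where "a' = a(N := K' 0)"
  have "K q = (\<Sum>k<Suc N. a' k * q ^ k) + q ^ Suc N * K1 q" for q
  proof -
    have "K q = (\<Sum>k<N. a k * q ^ k) + q ^ N * (K' 0 + q * K1 q)" using *(2) K1(2) by metis
    also have "(\<Sum>k<N. a k * q ^ k) = (\<Sum>k<N. a' k * q ^ k)" by (auto simp: a'_def)
    finally show ?thesis by (simp add: a'_def algebra_simps)
  qed
  moreover have "a' 0 = K 0"
  proof (cases N)
    case 0
    then show ?thesis using *(2)[of 0] by (simp add: a'_def)
  qed (use *(3) in \<open>auto simp: a'_def\<close>)
  ultimately show ?case using K1(1) by blast
qed

lemma bounded_near_0:
  assumes "K holomorphic_on ball 0 r" "r > 0"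
  obtains C r' where "0 < r'" "r' < r" "0 < C" "\<And>q. norm q \<le> r' \<Longrightarrow> norm (K q) \<le> (C::real)"
proof -
  have "continuous_on (cball 0 (r/2)) K"
    using assms by (intro holomorphic_on_imp_continuous_on) (auto elim!: holomorphic_on_subset)
  then have "bounded (K ` cball 0 (r/2))"
    by (intro compact_imp_bounded compact_continuous_image) auto
  then obtain C where "C > 0" "\<forall>x \<in> K ` cball 0 (r/2). norm x \<le> C" using bounded_pos by blast
  then show thesis using assms by (intro that[of "r/2" C]) auto
qed

lemma Re_le_ln_imp:
  assumes "0 < r" "Re s \<le> ln r"
  shows "norm (exp s) \<le> r"
  using assms by (simp add: ln_ge_iff)

text \<open>With \<open>q = exp (s / d)\<close> the remainder factor \<open>q ^ N\<close> is exactly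
  \<open>exp (N / d * s)\<close>.\<close>

lemma exp_order_taylor:
  assumes "K holomorphic_on ball 0 r" "r > 0" "d > 0"
  shows "\<exists>a. (0 < N \<longrightarrow> a 0 = K 0) \<and> (\<forall>Y. exp_order Y (real N / d)
           (\<lambda>s. K (exp (s / of_real d)) - (\<Sum>k<N. a k * exp (of_real (real k / d) * s))))"
proof -
  obtain a K' where *: "K' holomorphic_on ball 0 r" "\<And>q. K q = (\<Sum>k<N. a k * q ^ k) + q ^ N * K' q"
    "0 < N \<longrightarrow> a 0 = K 0" using holomorphic_taylor_remainder[OF assms(1,2), of N] by auto
  obtain C r' where C: "0 < r'" "C > 0" "\<And>q. norm q \<le> r' \<Longrightarrow> norm (K' q) \<le> C"
    using bounded_near_0[OF *(1) assms(2)] by metis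
  have pow: "exp (s / of_real d) ^ k = exp (of_real (real k / d) * s)" for s :: complex and k
    by (simp add: exp_of_nat_mult [symmetric])
  have "exp_order Y (real N / d) (\<lambda>s. K (exp (s / of_real d)) - (\<Sum>k<N. a k * exp (of_real (real k / d) * s)))" for Y
  proof (rule exp_orderI, intro exI allI impI)
    fix y and s :: complex assume "Re s \<le> d * ln r'"
    then have "norm (exp (s / of_real d)) \<le> r'"
      using assms(3) C(1) by (intro Re_le_ln_imp) (auto simp: field_simps Re_divide_of_real)
    then have "norm (K' (exp (s / of_real d))) \<le> C" by (rule C)
    moreover have "K (exp (s / of_real d)) - (\<Sum>k<N. a k * exp (of_real (real k / d) * s)) = exp (s / of_real d) ^ N * K' (exp (s / of_real d))"
      by (subst *(2)) (simp only: pow, simp)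
    ultimately have "norm (K (exp (s / of_real d)) - (\<Sum>k<N. a k * exp (of_real (real k / d) * s))) \<le> norm (exp (s / of_real d) ^ N) * C"
      by (simp only: norm_mult) (intro mult_left_mono, auto)
    also have "norm (exp (s / of_real d) ^ N) = exp (real N / d * Re s)"
      by (simp only: pow) simp
    finally show "norm (K (exp (s / of_real d)) - (\<Sum>k<N. a k * exp (of_real (real k / d) * s))) \<le> C * exp (real N / d * Re s)"
      by (simp add: mult.commute)
  qed
  then show ?thesis using *(3) by blast
qed

text \<open>If \<open>\<psi>\<close> is holomorphic near \<open>0\<close> with \<open>\<psi> 0 = 0\<close> and \<open>\<psi>' 0 = exp c\<close>, then \<open>log (\<psi> (exp s))\<close>
  has this form.\<close>

definition near_trans :: "complex \<Rightarrow> (complex \<Rightarrow> complex) \<Rightarrow> bool" where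
  "near_trans c A \<longleftrightarrow> (\<exists>r>0. \<exists>b. b holomorphic_on ball 0 r \<and> b 0 = 0 \<and> A = (\<lambda>s. s + c + b (exp s)))"

lemma near_transE:
  assumes "near_trans c A"
  obtains r b where "r > 0" "b holomorphic_on ball 0 r" "b 0 = 0" "\<And>s. A s = s + c + b (exp s)"
  using assms unfolding near_trans_def by auto

text \<open>Since \<open>b\<close> vanishes at 0, it is \<open>q\<close> times a bounded function: a
  near translation differs from the translation by a full order.\<close>

lemma near_trans_bound:
  assumes "near_trans c A"
  obtains C M where "C > 0" "\<And>s. Re s \<le> M \<Longrightarrow> norm (A s - s - c) \<le> C * exp (Re s)"
proof -
  obtain r b where b: "r > 0" "b holomorphic_on ball 0 r" "b 0 = 0" "\<And>s. A s = s + c + b (exp s)"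
    using near_transE[OF assms] by blast
  obtain b1 where b1: "b1 holomorphic_on ball 0 r" "\<And>q. b q = b 0 + q * b1 q"
    using holomorphic_quotient_at_0[OF b(2,1)] by metis
  obtain C r' where C: "0 < r'" "C > 0" "\<And>q. norm q \<le> r' \<Longrightarrow> norm (b1 q) \<le> C"
    using bounded_near_0[OF b1(1) b(1)] by metis
  have "norm (A s - s - c) \<le> C * exp (Re s)" if "Re s \<le> ln r'" for s
  proof -
    have "A s - s - c = exp s * b1 (exp s)" using b b1(2)[of "exp s"] by simp
    moreover have "norm (b1 (exp s)) \<le> C" using that C by (intro C Re_le_ln_imp) auto
    ultimately show ?thesis by (simp add: norm_mult)
  qed
  then show thesis using that C by blast
qed

lemma near_trans_close:
  assumes "near_trans c A" "e > 0"
  obtains M where "\<And>s. Re s \<le> M \<Longrightarrow> norm (A s - s - c) \<le> e"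
proof -
  obtain C M where C: "C > 0" "\<And>s. Re s \<le> M \<Longrightarrow> norm (A s - s - c) \<le> C * exp (Re s)"
    using near_trans_bound[OF assms(1)] by blast
  have "norm (A s - s - c) \<le> e" if "Re s \<le> min M (ln (e / C))" for s
  proof -
    have "norm (A s - s - c) \<le> C * exp (Re s)" using C that by auto
    also have "exp (Re s) \<le> e / C" using that C assms Re_le_ln_imp[of "e/C" s] by simp
    finally show ?thesis using C by (simp add: field_simps)
  qed
  then show thesis using that by blast
qed

lemma near_trans_holomorphic:
  assumes "near_trans c A"
  obtains M where "A holomorphic_on {s. Re s < M}"
proof -
  obtain r b where b: "r > 0" "b holomorphic_on ball 0 r" "b 0 = 0" "\<And>s. A s = s + c + b (exp s)"
    using near_transE[OF assms] by blast
  have "(b \<circ> exp) holomorphic_on {s. Re s < ln r}"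
  proof (rule holomorphic_on_compose_gen[OF _ b(2)])
    show "exp ` {s. Re s < ln r} \<subseteq> ball (0::complex) r"
    proof safe
      fix s assume "Re s < ln r"
      then show "exp s \<in> ball 0 r" using b(1) by (simp add: dist_norm) (metis exp_less_mono exp_ln)
    qed
  qed (auto intro: holomorphic_intros)
  then have "(\<lambda>s. s + c + (b \<circ> exp) s) holomorphic_on {s. Re s < ln r}"
    by (intro holomorphic_intros)
  then show thesis using that[of "ln r"] b(4) by (simp add: o_def cong: holomorphic_cong)
qed

text \<open>The derivative of \<open>b (exp s)\<close> carries the factor \<open>exp s\<close>, so
  far to the left the displacement is a contraction. The factor one half is what later shows that a
  near translation preserves the two sides of the real line.\<close>

lemma near_trans_lipschitz:
  assumes "near_trans c A"
  obtains M where "\<And>s s'. Re s \<le> M \<Longrightarrow> Re s' \<le> M \<Longrightarrow> norm ((A s - s) - (A s' - s')) \<le> norm (s - s') / 2"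
proof -
  obtain r b where b: "r > 0" "b holomorphic_on ball 0 r" "b 0 = 0" "\<And>s. A s = s + c + b (exp s)"
    using near_transE[OF assms] by blast
  have "deriv b holomorphic_on ball 0 r" using b by (intro holomorphic_deriv) auto
  then obtain C r' where C: "0 < r'" "r' < r" "C > 0" "\<And>q. norm q \<le> r' \<Longrightarrow> norm (deriv b q) \<le> C"
    using bounded_near_0[OF _ b(1)] by metis
  define M where "M = ln (min r' (1 / (2 * C)))"
  have M: "norm (exp s) \<le> r'" "norm (exp s) \<le> 1 / (2 * C)" if "Re s \<le> M" for s
    using Re_le_ln_imp[of "min r' (1 / (2 * C))" s] that C unfolding M_def by auto
  have "norm (b (exp s) - b (exp s')) \<le> (1/2) * norm (s - s')" if "Re s \<le> M" "Re s' \<le> M" for s s'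
  proof (rule field_differentiable_bound[of "{s. Re s \<le> M}" "\<lambda>s. b (exp s)" "\<lambda>s. deriv b (exp s) * exp s"])
    show "convex {s. Re s \<le> M}" by (rule convex_halfspace_Re_le)
    fix z assume z: "z \<in> {s. Re s \<le> M}"
    have "exp z \<in> ball 0 r" using M[of z] z C by auto
    then have "(b has_field_derivative deriv b (exp z)) (at (exp z))"
      using b by (intro holomorphic_derivI[of b "ball 0 r"]) auto
    then show "((\<lambda>s. b (exp s)) has_field_derivative deriv b (exp z) * exp z) (at z within {s. Re s \<le> M})"
      by (intro DERIV_subset[OF DERIV_chain2[of b _ exp]]) (auto intro!: derivative_eq_intros)
    have "norm (deriv b (exp z)) * norm (exp z) \<le> C * (1 / (2 * C))"
      using M[of z] z C by (intro mult_mono C(4)) auto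
    then show "norm (deriv b (exp z) * exp z) \<le> 1/2" using C by (simp add: norm_mult)
  qed (use that in auto)
  then show thesis using that[of M] b(4) by simp
qed

text \<open>Write \<open>A s\<close> as \<open>s + c\<close> plus \<open>b (exp s)\<close>, expand
  the power by the binomial theorem and the remaining factors by Taylor in \<open>exp s\<close>.
  Every correction contains at least one factor \<open>exp s\<close>, so exponents rise by
  \<open>k \<ge> 1\<close>, while the power of \<open>s\<close> never rises.\<close>

lemma explog_near_trans_term:
  fixes \<alpha> :: real and j :: nat
  assumes "near_trans c A"
  defines "W \<equiv> {(\<alpha> + real k, i) | k i. 1 \<le> k \<and> i \<le> j}"
  shows "\<exists>Z\<in>explog W. \<forall>Y. exp_order Y R (\<lambda>s. A s ^ j * exp (of_real \<alpha> * A s) - (s + c) ^ j * exp (of_real \<alpha> * (s + c)) - Z s)"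
proof -
  obtain r b where b: "r > 0" "b holomorphic_on ball 0 r" "b 0 = 0" "\<And>s. A s = s + c + b (exp s)"
    using near_transE[OF assms(1)] by blast
  \<comment> \<open>The coefficient of the i-th binomial term with the unperturbed value subtracted.
    It vanishes at 0, which eliminates the Taylor term \<open>k = 0\<close>.\<close>
  define K where "K i q = b q ^ i * exp (of_real \<alpha> * b q) - (if i = 0 then 1 else 0)" for i q
  have K: "K i holomorphic_on ball 0 r" for i unfolding K_def [abs_def] by (intro holomorphic_intros b)
  have K0: "K i 0 = 0" for i by (auto simp: K_def b)
  \<comment> \<open>With \<open>R < \<alpha> + N\<close>, the factor of exponent \<alpha> has order
    at least \<open>R - N\<close>, which a Taylor remainder of order \<open>N\<close> brings up to
    \<open>R\<close>.\<close>
  define N where "N = Suc (nat \<lceil>R - \<alpha>\<rceil>)"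
  have N: "R < \<alpha> + real N" unfolding N_def by linarith
  have "\<forall>i. \<exists>a. a 0 = 0 \<and> (\<forall>Y. exp_order Y (real N / 1)
           (\<lambda>s. K i (exp (s / of_real 1)) - (\<Sum>k<N. a k * exp (of_real (real k / 1) * s))))"
    using exp_order_taylor[OF K b(1), of 1 N] K0 by (auto simp: N_def)
  then obtain a where a: "\<And>i. a i 0 = 0" "\<And>i Y. exp_order Y (real N)
           (\<lambda>s. K i (exp s) - (\<Sum>k<N. a i k * exp (of_real (real k) * s)))"
    by (simp only: choice_iff) auto
  define T where "T m s = (s + c) ^ m * exp (of_real \<alpha> * (s + c))" for m s
  define Z where "Z s = (\<Sum>i\<le>j. of_nat (j choose i) * (\<Sum>k<N. a i k * (T (j - i) s * exp (of_real (real k) * s))))" for s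
  have "Z \<in> explog W"
    unfolding Z_def [abs_def]
  proof (rule explog_sum, rule explog_cmult, rule explog_sum)
    fix i k assume "i \<in> {..j}" "k \<in> {..<N}"
    show "(\<lambda>s. a i k * (T (j - i) s * exp (of_real (real k) * s))) \<in> explog W"
    proof (cases "k = 0")
      case True
      then show ?thesis using explog.zero by (simp add: a)
    next
      case False
      have "(\<lambda>s. T (j - i) s * exp (of_real (real k) * s)) \<in> explog ((\<lambda>(\<alpha>, j). (\<alpha> + real k, j)) ` ({\<alpha>} \<times> {..j-i}))"
        unfolding T_def by (rule explog_mult_exp[OF explog_shift_term])
      then show ?thesis
        by (intro explog_cmult, elim explog_mono) (use False in \<open>auto simp: W_def\<close>)
    qed
  qed
  moreover have "exp_order Y R (\<lambda>s. A s ^ j * exp (of_real \<alpha> * A s) - (s + c) ^ j * exp (of_real \<alpha> * (s + c)) - Z s)" for Y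
  proof -
    have T: "exp_order Y (R - real N) (T m)" for m
      using exp_order_cmult[OF exp_order_term[of "R - real N" \<alpha> Y c m], of "exp (of_real \<alpha> * c)"] N
      unfolding T_def [abs_def] by (simp add: exp_add ring_distribs mult_ac)
    have "A s ^ j * exp (of_real \<alpha> * A s) - (s + c) ^ j * exp (of_real \<alpha> * (s + c)) - Z s =
       (\<Sum>i\<le>j. of_nat (j choose i) * (T (j - i) s * (K i (exp s) - (\<Sum>k<N. a i k * exp (of_real (real k) * s)))))" for s
    proof -
      have "A s ^ j * exp (of_real \<alpha> * A s) = (\<Sum>i\<le>j. of_nat (j choose i) * (T (j - i) s * (b (exp s) ^ i * exp (of_real \<alpha> * b (exp s)))))"
        unfolding b(4) T_def
        by (subst add.commute, subst binomial_ring) (simp add: exp_add ring_distribs sum_distrib_left mult_ac)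
      moreover have "(s + c) ^ j * exp (of_real \<alpha> * (s + c)) = (\<Sum>i\<le>j. of_nat (j choose i) * (T (j - i) s * (if i = 0 then 1 else 0)))"
        by (simp add: T_def if_distrib sum.delta cong: if_cong)
      ultimately show ?thesis
        unfolding Z_def K_def by (simp add: algebra_simps sum_subtractf sum_distrib_left sum.distrib)
    qed
    then have eq: "(\<lambda>s. A s ^ j * exp (of_real \<alpha> * A s) - (s + c) ^ j * exp (of_real \<alpha> * (s + c)) - Z s) =
       (\<lambda>s. \<Sum>i\<le>j. of_nat (j choose i) * (T (j - i) s * (K i (exp s) - (\<Sum>k<N. a i k * exp (of_real (real k) * s)))))" by auto
    have "exp_order Y ((R - real N) + real N) (\<lambda>s. T (j - i) s * (K i (exp s) - (\<Sum>k<N. a i k * exp (of_real (real k) * s))))" for i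
      by (intro exp_order_mult T a)
    then show ?thesis unfolding eq by (intro exp_order_sum exp_order_cmult) auto
  qed
  ultimately show ?thesis by blast
qed

lemma explog_near_trans:
  assumes "near_trans c A" "X \<in> explog V"
  shows "\<exists>Z\<in>explog {(\<alpha> + real k, i) | \<alpha> k i. 1 \<le> k \<and> (\<exists>j\<ge>i. (\<alpha>, j) \<in> V)}.
           \<forall>Y. exp_order Y R (\<lambda>s. X (A s) - X (s + c) - Z s)"
  using assms(2)
proof (induction rule: explog.induct)
  case zero
  show ?case by (rule bexI[OF _ explog.zero]) (auto intro: exp_order_zero)
next
  case (add X \<alpha> j x)
  let ?W = "{(\<alpha> + real k, i) | \<alpha> k i. 1 \<le> k \<and> (\<exists>j\<ge>i. (\<alpha>, j) \<in> V)}"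
  obtain Z where Z: "Z \<in> explog ?W" "\<And>Y. exp_order Y R (\<lambda>s. X (A s) - X (s + c) - Z s)"
    using add.IH by blast
  obtain Z' where Z': "Z' \<in> explog {(\<alpha> + real k, i) | k i. 1 \<le> k \<and> i \<le> j}"
     "\<And>Y. exp_order Y R (\<lambda>s. A s ^ j * exp (of_real \<alpha> * A s) - (s + c) ^ j * exp (of_real \<alpha> * (s + c)) - Z' s)"
    using explog_near_trans_term[OF assms(1)] by blast
  have "Z' \<in> explog ?W" using Z'(1) by (rule explog_mono) (use add.hyps in blast)
  then have "(\<lambda>s. Z s + x * Z' s) \<in> explog ?W" by (intro explog_add explog_cmult Z)
  moreover have "exp_order Y R (\<lambda>s. (X (A s) + x * (A s ^ j * exp (of_real \<alpha> * A s))) - (X (s + c) + x * ((s + c) ^ j * exp (of_real \<alpha> * (s + c)))) - (Z s + x * Z' s))" for Y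
    using exp_order_add[OF Z(2) exp_order_cmult[OF Z'(2), of _ x]] by (simp add: algebra_simps)
  ultimately show ?case by (intro bexI[of _ "\<lambda>w. Z w + x * Z' w"] allI)
qed

lemma near_trans_Re:
  assumes "near_trans c A"
  obtains M where "\<And>s. Re s \<le> M \<Longrightarrow> Re (A s) \<le> M'"
proof -
  obtain M where M: "\<And>s. Re s \<le> M \<Longrightarrow> norm (A s - s - c) \<le> 1"
    using near_trans_close[OF assms, of 1] by auto
  have "Re (A s) \<le> M'" if "Re s \<le> min M (M' - Re c - 1)" for s
  proof -
    have "Re (A s - s - c) \<le> 1" using complex_Re_le_cmod[of "A s - s - c"] M[of s] that by linarith
    then show ?thesis using that by simp
  qed
  then show thesis using that by blast
qed

text \<open>Dividing \<psi> by \<open>q * exp c\<close> leaves a function with value 1 at 0; its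
  principal logarithm near 0 is the perturbation \<open>b\<close>.\<close>

lemma near_trans_of_holomorphic:
  assumes "\<psi> holomorphic_on ball 0 r" "r > 0" "\<psi> 0 = 0" "deriv \<psi> 0 = exp c"
  obtains A M where "near_trans c A" "\<And>s. Re s \<le> M \<Longrightarrow> exp (A s) = \<psi> (exp s)"
proof -
  obtain K where K: "K holomorphic_on ball 0 r" "K 0 = exp c" "\<And>q. \<psi> q = q * K q"
    using holomorphic_quotient_at_0[OF assms(1,2)] assms(3,4) by (metis add_0)
  define k where "k q = K q * exp (- c)" for q
  have k: "k holomorphic_on ball 0 r" "k 0 = 1"
    unfolding k_def [abs_def] by (auto intro!: holomorphic_intros K simp: K(2) exp_minus)
  have "continuous (at 0) k"
    using holomorphic_on_imp_continuous_on[OF k(1)] assms(2) by (simp add: continuous_on_eq_continuous_at)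
  then obtain d where d: "d > 0" "\<And>q. dist q 0 < d \<Longrightarrow> dist (k q) 1 < 1"
    using k(2) unfolding continuous_at_eps_delta by (metis zero_less_one)
  define r' where "r' = min r d"
  have r': "r' > 0" "ball 0 r' \<subseteq> ball (0::complex) r" using d assms by (auto simp: r'_def)
  have kn: "k q \<notin> \<real>\<^sub>\<le>\<^sub>0" if "q \<in> ball 0 r'" for q
  proof
    assume "k q \<in> \<real>\<^sub>\<le>\<^sub>0"
    then have "Re (k q) \<le> 0" by (auto simp: complex_nonpos_Reals_iff)
    moreover have "norm (k q - 1) < 1" using d(2)[of q] that by (auto simp: r'_def dist_norm)
    ultimately show False using abs_Re_le_cmod[of "k q - 1"] by auto
  qed
  define b where "b q = Ln (k q)" for q
  have b: "b holomorphic_on ball 0 r'" "b 0 = 0"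
    unfolding b_def [abs_def]
    by (auto intro!: holomorphic_on_Ln' holomorphic_on_subset[OF k(1)] r' simp: kn k(2))
  define A where "A s = s + c + b (exp s)" for s
  have "near_trans c A" unfolding near_trans_def A_def [abs_def] using b r'(1) by blast
  moreover have "exp (A s) = \<psi> (exp s)" if "Re s \<le> ln (r' / 2)" for s
  proof -
    have "norm (exp s) \<le> r' / 2" using that r' by (intro Re_le_ln_imp) auto
    then have "k (exp s) \<noteq> 0" using kn[of "exp s"] r' by auto
    then show ?thesis by (simp add: A_def b_def exp_add K(3) k_def exp_minus)
  qed
  ultimately show thesis using that by blast
qed

text \<open>Equality of exponentials determines a point up to multiples of
  \<open>2 * pi * \<i>\<close>. Far to the left the composition moves points by at most 2, which
  leaves only the zero multiple.\<close>

lemma near_trans_inverse_aux: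
  assumes "near_trans c A" "near_trans (-c) A'"
  shows "\<exists>M. \<forall>s. Re s \<le> M \<longrightarrow> exp (A (A' s)) = exp s \<longrightarrow> A (A' s) = s"
proof -
  obtain M1 where M1: "\<And>s. Re s \<le> M1 \<Longrightarrow> norm (A s - s - c) \<le> 1"
    using near_trans_close[OF assms(1), of 1] by auto
  obtain M2 where M2: "\<And>s. Re s \<le> M2 \<Longrightarrow> norm (A' s - s - (-c)) \<le> 1"
    using near_trans_close[OF assms(2), of 1] by auto
  obtain M3 where M3: "\<And>s. Re s \<le> M3 \<Longrightarrow> Re (A' s) \<le> M1"
    using near_trans_Re[OF assms(2), of M1] by auto
  have "A (A' s) = s" if "Re s \<le> min M2 M3" "exp (A (A' s)) = exp s" for s
  proof (rule exp_complex_eqI)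
    have "norm ((A (A' s) - A' s - c) + (A' s - s - (-c))) \<le> 1 + 1"
      using M1 M2 M3 that by (intro order.trans[OF norm_triangle_ineq] add_mono) auto
    then have "\<bar>Im (A (A' s) - s)\<bar> \<le> 2" using abs_Im_le_cmod[of "A (A' s) - s"] by simp
    then show "\<bar>Im (A (A' s)) - Im s\<bar> < 2 * pi" using pi_gt3 by simp
  qed (use that in auto)
  then show ?thesis by blast
qed

text \<open>The inversion takes place downstairs: \<open>A\<close> covers a map of a disc that fixes
  0 and has nonzero derivative there. The logarithm of its local inverse is the inverse of
  \<open>A\<close>.\<close>

lemma near_trans_inverse:
  assumes "near_trans c A"
  obtains A' M where "near_trans (-c) A'" "\<And>s. Re s \<le> M \<Longrightarrow> A (A' s) = s" "\<And>s. Re s \<le> M \<Longrightarrow> A' (A s) = s"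
proof -
  obtain r b where b: "r > 0" "b holomorphic_on ball 0 r" "b 0 = 0" "\<And>s. A s = s + c + b (exp s)"
    using near_transE[OF assms] by blast
  \<comment> \<open>The map that \<open>A\<close> induces in the variable
    \<open>q = exp s\<close>.\<close>
  define \<psi> where "\<psi> q = q * exp (c + b q)" for q
  have expA: "exp (A s) = \<psi> (exp s)" for s by (simp add: b(4) \<psi>_def exp_add)
  have hol: "\<psi> holomorphic_on ball 0 r" unfolding \<psi>_def [abs_def] by (intro holomorphic_intros b)
  have "(b has_field_derivative deriv b 0) (at 0)" using b by (intro holomorphic_derivI[of b "ball 0 r"]) auto
  then have "(\<psi> has_field_derivative exp c) (at 0)"
    unfolding \<psi>_def [abs_def] by (auto intro!: derivative_eq_intros simp: b(3))
  then have d\<psi>: "deriv \<psi> 0 = exp c" by (rule DERIV_imp_deriv)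
  obtain r1 where r1: "r1 > 0" "ball 0 r1 \<subseteq> ball (0::complex) r" "open (\<psi> ` ball 0 r1)" "inj_on \<psi> (ball 0 r1)"
    by (rule has_complex_derivative_locally_invertible[OF hol, of 0])
       (use b(1) d\<psi> in \<open>simp_all del: image_subset_iff\<close>)
  have hol1: "\<psi> holomorphic_on ball 0 r1" using hol r1(2) by (rule holomorphic_on_subset)
  obtain g where g: "g holomorphic_on (\<psi> ` ball 0 r1)"
     "\<And>z. z \<in> ball 0 r1 \<Longrightarrow> deriv \<psi> z * deriv g (\<psi> z) = 1" "\<And>z. z \<in> ball 0 r1 \<Longrightarrow> g (\<psi> z) = z"
    using holomorphic_has_inverse[OF hol1 _ r1(4)] by auto
  have \<psi>0: "\<psi> 0 = 0" by (simp add: \<psi>_def)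
  have "0 \<in> \<psi> ` ball 0 r1" using r1(1) \<psi>0 by (intro image_eqI[of _ _ 0]) auto
  then obtain r2 where r2: "r2 > 0" "ball 0 r2 \<subseteq> \<psi> ` ball 0 r1" using r1(3) by (auto simp: open_contains_ball)
  have g0: "g 0 = 0" using g(3)[of 0] \<psi>0 r1 by simp
  have "deriv g 0 = exp (-c)" using g(2)[of 0] \<psi>0 r1 d\<psi> by (simp add: exp_minus field_simps)
  moreover have "g holomorphic_on ball 0 r2" using g(1) r2(2) by (rule holomorphic_on_subset)
  ultimately obtain A' M1 where A': "near_trans (-c) A'" "\<And>s. Re s \<le> M1 \<Longrightarrow> exp (A' s) = g (exp s)"
    using near_trans_of_holomorphic[of g r2 "-c"] r2(1) g0 by auto
  have 1: "exp (A (A' s)) = exp s" if "Re s \<le> min M1 (ln (r2/2))" for s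
  proof -
    have "norm (exp s) \<le> r2 / 2" using that r2 by (intro Re_le_ln_imp) auto
    then have "exp s \<in> ball 0 r2" using r2(1) by (simp only: mem_ball_0)
    then obtain z where z: "z \<in> ball 0 r1" "exp s = \<psi> z" using r2(2) by blast
    have "exp (A (A' s)) = \<psi> (g (exp s))" using expA A'(2) that by simp
    also have "\<dots> = exp s" using g(3) z by simp
    finally show ?thesis .
  qed
  obtain M2 where M2: "\<And>s. Re s \<le> M2 \<Longrightarrow> Re (A s) \<le> M1"
    using near_trans_Re[OF assms, of M1] by auto
  have 2: "exp (A' (A s)) = exp s" if "Re s \<le> min M2 (ln (r1/2))" for s
  proof -
    have "norm (exp s) \<le> r1 / 2" using that r1 by (intro Re_le_ln_imp) auto
    then have "exp s \<in> ball 0 r1" using r1(1) by (simp only: mem_ball_0)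
    then show ?thesis using A'(2)[OF M2, of s] that g(3) by (simp add: expA)
  qed
  obtain M3 where M3: "\<And>s. Re s \<le> M3 \<Longrightarrow> exp (A (A' s)) = exp s \<Longrightarrow> A (A' s) = s"
    using near_trans_inverse_aux[OF assms A'(1)] by blast
  obtain M4 where M4: "\<And>s. Re s \<le> M4 \<Longrightarrow> exp (A' (A s)) = exp s \<Longrightarrow> A' (A s) = s"
    using near_trans_inverse_aux[OF A'(1), of A] assms by auto
  define M where "M = min (min M3 M4) (min (min M1 (ln (r2/2))) (min M2 (ln (r1/2))))"
  show thesis
  proof (rule that[OF A'(1), of M])
    fix s assume "Re s \<le> M"
    then show "A (A' s) = s" "A' (A s) = s" using 1 2 M3 M4 by (auto simp: M_def)
  qed
qed

text \<open>Downstairs the inner map is \<open>q * exp (c2 + b2 q)\<close>; the perturbations add up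
  to \<open>b2\<close> plus \<open>b1\<close> composed with this map.\<close>

lemma near_trans_compose:
  assumes "near_trans c1 A1" "near_trans c2 A2"
  shows "near_trans (c1 + c2) (\<lambda>s. A1 (A2 s))"
proof -
  obtain r1 b1 where b1: "r1 > 0" "b1 holomorphic_on ball 0 r1" "b1 0 = 0" "\<And>s. A1 s = s + c1 + b1 (exp s)"
    using near_transE[OF assms(1)] by blast
  obtain r2 b2 where b2: "r2 > 0" "b2 holomorphic_on ball 0 r2" "b2 0 = 0" "\<And>s. A2 s = s + c2 + b2 (exp s)"
    using near_transE[OF assms(2)] by blast
  define \<psi> where "\<psi> q = q * exp (c2 + b2 q)" for q
  have hol: "\<psi> holomorphic_on ball 0 r2" unfolding \<psi>_def [abs_def] by (intro holomorphic_intros b2)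
  have "continuous (at 0) \<psi>"
    using holomorphic_on_imp_continuous_on[OF hol] b2(1) by (simp add: continuous_on_eq_continuous_at)
  then obtain d where d: "d > 0" "\<And>q. dist q 0 < d \<Longrightarrow> dist (\<psi> q) (\<psi> 0) < r1"
    using b1(1) unfolding continuous_at_eps_delta by metis
  define r where "r = min r2 d"
  define b where "b q = b2 q + (b1 \<circ> \<psi>) q" for q
  have "b holomorphic_on ball 0 r"
    unfolding b_def [abs_def]
  proof (intro holomorphic_on_add holomorphic_on_compose_gen[OF _ b1(2)])
    show "b2 holomorphic_on ball 0 r" "\<psi> holomorphic_on ball 0 r"
      using b2(2) hol by (auto elim!: holomorphic_on_subset simp: r_def)
    show "\<psi> ` ball 0 r \<subseteq> ball 0 r1" using d(2) by (auto simp: r_def \<psi>_def dist_norm)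
  qed
  moreover have "b 0 = 0" by (simp add: b_def \<psi>_def b1 b2)
  moreover have "(\<lambda>s. A1 (A2 s)) = (\<lambda>s. s + (c1 + c2) + b (exp s))"
    by (auto simp: b1(4) b2(4) b_def \<psi>_def exp_add algebra_simps)
  moreover have "r > 0" using d b2 by (simp add: r_def)
  ultimately show ?thesis unfolding near_trans_def by blast
qed

lemma near_trans_cnj:
  assumes "near_trans c A"
  shows "near_trans (cnj c) (\<lambda>s. cnj (A (cnj s)))"
proof -
  obtain r b where b: "r > 0" "b holomorphic_on ball 0 r" "b 0 = 0" "\<And>s. A s = s + c + b (exp s)"
    using near_transE[OF assms] by blast
  have "cnj ` ball 0 r = ball 0 r" by (auto simp: image_iff intro!: bexI[of _ "cnj _"])
  then have "(cnj \<circ> b \<circ> cnj) holomorphic_on ball 0 r"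
    using b(2) by (intro holomorphic_on_compose_cnj_cnj) auto
  then show ?thesis
    unfolding near_trans_def using b by (intro exI[of _ r] exI[of _ "cnj \<circ> b \<circ> cnj"] conjI) (auto simp: exp_cnj)
qed

section \<open>The periodic Cauchy kernel\<close>
lemma has_contour_integral_linepath_same_Im_iff:
  assumes "a < b"
  shows "(f has_contour_integral I) (linepath (Complex a y) (Complex b y)) \<longleftrightarrow>
         ((\<lambda>x. f (Complex x y)) has_integral I) {a..b}"
proof -
  have eq: "linepath (Complex a y) (Complex b y) x = linepath (of_real a) (of_real b) x + \<i> * of_real y" for x
    by (auto simp: linepath_def complex_eq_iff algebra_simps)
  have "(f has_contour_integral I) (linepath (Complex a y) (Complex b y)) \<longleftrightarrow>
        ((\<lambda>z. f (z + \<i> * of_real y)) has_contour_integral I) (linepath (of_real a) (of_real b))"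
    unfolding has_contour_integral_linepath eq
    by (auto simp: complex_eq_iff intro!: has_integral_cong arg_cong2[of _ _ _ _ "(*)"])
  also have "\<dots> \<longleftrightarrow> ((\<lambda>x. f (of_real x + \<i> * of_real y)) has_integral I) {a..b}"
    using assms by (subst has_contour_integral_linepath_Reals_iff) auto
  also have "(\<lambda>x. f (of_real x + \<i> * of_real y)) = (\<lambda>x. f (Complex x y))"
    by (simp add: Complex_eq)
  finally show ?thesis .
qed

lemma has_integral_exp_abs:
  assumes "m > 0" "x1 \<le> x" "x \<le> x0"
  shows "\<exists>J\<le>2 / m. ((\<lambda>\<xi>. exp (- m * \<bar>\<xi> - x\<bar>)) has_integral J) {x1..(x0::real)}"
proof -
  have 1: "((\<lambda>\<xi>. exp (m * (\<xi> - x))) has_integral (exp (m * (x - x)) / m - exp (m * (x1 - x)) / m)) {x1..x}"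
    using assms by (intro fundamental_theorem_of_calculus)
      (auto intro!: derivative_eq_intros simp: has_real_derivative_iff_has_vector_derivative [symmetric])
  have 2: "((\<lambda>\<xi>. exp (- m * (\<xi> - x))) has_integral (- exp (- m * (x0 - x)) / m - (- exp (- m * (x - x)) / m))) {x..x0}"
    using assms by (intro fundamental_theorem_of_calculus)
      (auto intro!: derivative_eq_intros simp: has_real_derivative_iff_has_vector_derivative [symmetric])
  have 1: "((\<lambda>\<xi>. exp (- m * \<bar>\<xi> - x\<bar>)) has_integral (exp (m * (x - x)) / m - exp (m * (x1 - x)) / m)) {x1..x}"
    by (rule has_integral_eq[OF _ 1]) (auto simp: algebra_simps)
  have 2: "((\<lambda>\<xi>. exp (- m * \<bar>\<xi> - x\<bar>)) has_integral (- exp (- m * (x0 - x)) / m - (- exp (- m * (x - x)) / m))) {x..x0}"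
    by (rule has_integral_eq[OF _ 2]) auto
  from has_integral_combine[OF assms(2,3) 1 2] show ?thesis
    using assms by (intro exI conjI) (auto simp: field_simps)
qed

text \<open>The decay away from \<open>x\<close> makes the bound independent of the length of the
  segment, so its left end may later be sent to infinity.\<close>

lemma horizontal_integral_bound:
  assumes I: "(f has_contour_integral I) (linepath (Complex x1 y) (Complex x0 y))"
    and x: "x1 \<le> x" "x \<le> x0" "x1 < x0" and m: "m > 0" and B: "B \<ge> 0"
    and le: "\<And>\<xi>. x1 \<le> \<xi> \<Longrightarrow> \<xi> \<le> x0 \<Longrightarrow> norm (f (Complex \<xi> y)) \<le> B * exp (- m * \<bar>\<xi> - x\<bar>)"
  shows "norm I \<le> 2 * B / m"
proof -
  obtain J where J: "J \<le> 2 / m" "((\<lambda>\<xi>. exp (- m * \<bar>\<xi> - x\<bar>)) has_integral J) {x1..x0}"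
    using has_integral_exp_abs[OF m x(1,2)] by blast
  have "((\<lambda>x. f (Complex x y)) has_integral I) {x1..x0}"
    using I x(3) by (simp add: has_contour_integral_linepath_same_Im_iff)
  moreover have "((\<lambda>\<xi>. B * exp (- m * \<bar>\<xi> - x\<bar>)) has_integral B * J) {x1..x0}"
    using J(2) by (rule has_integral_mult_right)
  ultimately have "norm I \<le> B * J"
    using integral_norm_bound_integral[of "\<lambda>x. f (Complex x y)" "{x1..x0}" "\<lambda>\<xi>. B * exp (- m * \<bar>\<xi> - x\<bar>)"] le
    by (auto simp: has_integral_integrable_integral)
  also have "\<dots> \<le> B * (2 / m)" using J(1) B by (rule mult_left_mono)
  finally show ?thesis by (simp add: mult.commute)
qed

text \<open>The Cauchy kernel \<open>1/v\<^sup>2\<close> made periodic with period \<open>2 \<pi> \<i> / l\<close>.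
  Integrated over the boundary of a strip whose height is this period, it sees \<open>G\<close> on the two
  horizontal sides only through their difference.\<close>

definition periodic_kernel :: "real \<Rightarrow> complex \<Rightarrow> complex" where
  "periodic_kernel l v = (of_real l)\<^sup>2 * exp (of_real l * v) / (exp (of_real l * v) - 1)\<^sup>2"

lemma periodic_kernel_periodic:
  assumes "l * p = 2 * pi"
  shows "periodic_kernel l (v + \<i> * of_real p) = periodic_kernel l v"
proof -
  have "of_real l * (v + \<i> * of_real p) = of_real l * v + \<i> * of_real (l * p)"
    by (simp add: algebra_simps)
  then have "exp (of_real l * (v + \<i> * of_real p)) = exp (of_real l * v)"
    unfolding assms by (simp add: exp_add mult.commute[of \<i>])
  then show ?thesis by (simp add: periodic_kernel_def)
qed

text \<open>Locates the pole of the kernel: within one period on either side of the real line, only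
  \<open>v = 0\<close>.\<close>

lemma exp_eq_1_strip:
  assumes "l > 0" "l * \<bar>Im v\<bar> < 2 * pi"
  shows "exp (of_real l * v) = 1 \<longleftrightarrow> v = 0"
proof
  assume "exp (of_real l * v) = 1"
  then have "exp (of_real l * v) = exp 0" by simp
  moreover have "\<bar>Im (of_real l * v) - Im 0\<bar> < 2 * pi" using assms by (simp add: abs_mult)
  ultimately have "of_real l * v = 0" by (rule exp_complex_eqI[rotated])
  then show "v = 0" using assms by simp
qed auto

text \<open>With \<open>X = l * Re v\<close> and \<open>Y = l * Im v\<close>, the norm of the kernel
  equals \<open>l\<^sup>2 / (exp X + exp (- X) - 2 * cos Y)\<close>. The hypothesis says that the
  cosine consumes at most the fraction \<open>c\<close> of the denominator.\<close>

lemma norm_periodic_kernel_le: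
  assumes "l > 0" "c < 1" "2 * cos (l * Im v) \<le> c * (exp (l * Re v) + exp (- (l * Re v)))"
  shows "norm (periodic_kernel l v) \<le> l\<^sup>2 / (1 - c) * exp (- (l * \<bar>Re v\<bar>))"
proof -
  define X Y where "X = l * Re v" and "Y = l * Im v"
  have "(norm (exp (of_real l * v) - 1))\<^sup>2 = (exp X * cos Y - 1)\<^sup>2 + (exp X * sin Y)\<^sup>2"
    by (simp add: cmod_power2 Re_exp Im_exp X_def Y_def)
  also have "\<dots> = (exp X)\<^sup>2 * ((cos Y)\<^sup>2 + (sin Y)\<^sup>2) - 2 * exp X * cos Y + 1"
    by (simp only: power2_diff power_mult_distrib ring_distribs) (simp add: mult.assoc)
  also have "\<dots> = (exp X)\<^sup>2 - 2 * exp X * cos Y + 1" by simp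
  also have "\<dots> = exp X * (exp X + exp (- X) - 2 * cos Y)"
    by (simp add: algebra_simps power2_eq_square exp_minus)
  finally have eq: "(norm (exp (of_real l * v) - 1))\<^sup>2 = exp X * (exp X + exp (- X) - 2 * cos Y)" .
  have "(1 - c) * exp \<bar>X\<bar> \<le> (1 - c) * (exp X + exp (- X))"
    using assms(2) by (intro mult_left_mono) (auto simp: abs_if)
  also have "\<dots> \<le> exp X + exp (- X) - 2 * cos Y"
    using assms(3) by (simp add: X_def Y_def algebra_simps)
  finally have ge: "(1 - c) * exp \<bar>X\<bar> \<le> exp X + exp (- X) - 2 * cos Y" .
  have "norm (periodic_kernel l v) = l\<^sup>2 * exp X / (norm (exp (of_real l * v) - 1))\<^sup>2"
    by (simp add: periodic_kernel_def norm_mult norm_divide norm_power X_def)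
  also have "\<dots> = l\<^sup>2 / (exp X + exp (- X) - 2 * cos Y)" unfolding eq by simp
  also have "\<dots> \<le> l\<^sup>2 / ((1 - c) * exp \<bar>X\<bar>)"
  proof (rule divide_left_mono[OF ge])
    have "0 < (1 - c) * exp \<bar>X\<bar>" using assms(2) by simp
    then show "0 < (exp X + exp (- X) - 2 * cos Y) * ((1 - c) * exp \<bar>X\<bar>)"
      using ge by (metis less_le_trans mult_pos_pos)
  qed simp
  also have "\<dots> = l\<^sup>2 / (1 - c) * exp (- (l * \<bar>Re v\<bar>))"
    using assms(1) by (simp add: X_def exp_minus abs_mult field_simps)
  finally show ?thesis .
qed

lemma exp_plus_exp_minus_ge_2: "2 \<le> exp x + exp (- x :: real)"
  using cosh_real_ge_1[of x] by (simp add: cosh_def)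

text \<open>On horizontal lines at distance at least \<mu> from the poles, the cosine stays below
  \<open>cos (l * \<mu>)\<close>, hence away from 1. This serves the long sides of the
  rectangle.\<close>

lemma periodic_kernel_bound_Im:
  assumes l: "l > 0" and \<mu>: "0 < l * \<mu>" "l * \<mu> \<le> pi"
  obtains C where "C > 0" "\<And>v. \<mu> \<le> \<bar>Im v\<bar> \<Longrightarrow> l * (\<bar>Im v\<bar> + \<mu>) \<le> 2 * pi \<Longrightarrow> norm (periodic_kernel l v) \<le> C * exp (- (l * \<bar>Re v\<bar>))"
proof -
  \<comment> \<open>The maximum with 0 allows multiplying \<open>2 \<le> exp x + exp (- x)\<close>
    by \<open>c\<close> when the cosine is negative.\<close>
  define c where "c = max 0 (cos (l * \<mu>))"
  have "cos (l * \<mu>) < cos 0" using \<mu> by (intro cos_monotone_0_pi) auto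
  then have c: "0 \<le> c" "c < 1" by (auto simp: c_def)
  have "norm (periodic_kernel l v) \<le> l\<^sup>2 / (1 - c) * exp (- (l * \<bar>Re v\<bar>))"
    if v: "\<mu> \<le> \<bar>Im v\<bar>" "l * (\<bar>Im v\<bar> + \<mu>) \<le> 2 * pi" for v
  proof (rule norm_periodic_kernel_le[OF l c(2)])
    define Y where "Y = l * \<bar>Im v\<bar>"
    have Y: "l * \<mu> \<le> Y" "Y \<le> 2 * pi - l * \<mu>" using v l by (auto simp: Y_def algebra_simps)
    have "cos Y \<le> cos (l * \<mu>)"
    proof (cases "Y \<le> pi")
      case True
      then show ?thesis using Y \<mu> by (intro cos_monotone_0_pi_le) auto
    next
      case False
      have "cos (2 * pi - Y) \<le> cos (l * \<mu>)" using Y \<mu> False by (intro cos_monotone_0_pi_le) auto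
      then show ?thesis by (simp add: cos_diff)
    qed
    moreover have "cos (l * Im v) = cos Y" by (simp add: Y_def abs_if)
    ultimately have "2 * cos (l * Im v) \<le> c * 2" by (simp add: c_def)
    also have "\<dots> \<le> c * (exp (l * Re v) + exp (- (l * Re v)))"
      using c exp_plus_exp_minus_ge_2 by (intro mult_left_mono) auto
    finally show "2 * cos (l * Im v) \<le> c * (exp (l * Re v) + exp (- (l * Re v)))" .
  qed
  moreover have "l\<^sup>2 / (1 - c) > 0" using l c by auto
  ultimately show thesis using that by blast
qed

text \<open>At horizontal distance at least 1 from the pole the hyperbolic cosine alone dominates,
  whatever the imaginary part. This serves the vertical sides.\<close>

lemma periodic_kernel_bound_Re:
  assumes l: "l > 0"
  obtains C where "C > 0" "\<And>v. 1 \<le> \<bar>Re v\<bar> \<Longrightarrow> norm (periodic_kernel l v) \<le> C * exp (- (l * \<bar>Re v\<bar>))"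
proof -
  define c where "c = 1 / cosh l"
  have "cosh l > 1" using l cosh_real_strict_mono[of 0 l] by simp
  then have c: "0 < c" "c < 1" by (auto simp: c_def)
  have "norm (periodic_kernel l v) \<le> l\<^sup>2 / (1 - c) * exp (- (l * \<bar>Re v\<bar>))" if v: "1 \<le> \<bar>Re v\<bar>" for v
  proof (rule norm_periodic_kernel_le[OF l c(2)])
    have "cosh l \<le> cosh (l * \<bar>Re v\<bar>)" using v l by (intro cosh_real_nonneg_le_iff[THEN iffD2]) auto
    also have "cosh (l * \<bar>Re v\<bar>) = cosh (l * Re v)" by (simp add: abs_if)
    finally have "1 \<le> c * cosh (l * Re v)" using \<open>cosh l > 1\<close> by (simp add: c_def field_simps)
    then have "2 \<le> c * (exp (l * Re v) + exp (- (l * Re v)))" by (simp add: cosh_def)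
    then show "2 * cos (l * Im v) \<le> c * (exp (l * Re v) + exp (- (l * Re v)))"
      using cos_le_one[of "l * Im v"] by linarith
  qed
  moreover have "l\<^sup>2 / (1 - c) > 0" using l c by auto
  ultimately show thesis using that by blast
qed

text \<open>Integration by parts. The kernel is minus the derivative of \<open>K\<close>, which has
  a simple pole with residue 1 at \<open>w\<close>. The integral of the derivative of
  \<open>G * K\<close> over the closed path vanishes, and the residue theorem evaluates the integral
  of \<open>deriv G * K\<close>.\<close>

lemma periodic_kernel_formula:
  assumes S: "open S" "convex S" and G: "G holomorphic_on S" and l: "l > 0"
    and Sw: "\<And>\<zeta>. \<zeta> \<in> S \<Longrightarrow> l * \<bar>Im (\<zeta> - w)\<bar> < 2 * pi"
    and ab: "cbox a b \<subseteq> S" "w \<in> box a b"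
  shows "((\<lambda>\<zeta>. G \<zeta> * periodic_kernel l (\<zeta> - w)) has_contour_integral 2 * pi * \<i> * deriv G w) (rectpath a b)"
proof -
  have le: "Re a \<le> Re b" "Im a \<le> Im b" using ab(2) by (auto simp: in_box_complex_iff)
  have pi: "path_image (rectpath a b) \<subseteq> S - {w}"
    using path_image_rectpath_subset_cbox[OF le] path_image_rectpath_inter_box[OF le] ab by blast
  have wS: "w \<in> S" using ab box_subset_cbox[of a b] by blast
  define K where "K \<zeta> = of_real l / (exp (of_real l * (\<zeta> - w)) - 1)" for \<zeta>
  have nz: "exp (of_real l * (\<zeta> - w)) \<noteq> 1" if "\<zeta> \<in> S - {w}" for \<zeta>
    using exp_eq_1_strip[OF l, of "\<zeta> - w"] Sw[of \<zeta>] that by auto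
  have dK: "(K has_field_derivative - periodic_kernel l (\<zeta> - w)) (at \<zeta>)" if "\<zeta> \<in> S - {w}" for \<zeta>
    unfolding K_def [abs_def] periodic_kernel_def using nz[OF that]
    by (auto intro!: derivative_eq_intros simp: field_simps power2_eq_square)
  have dG: "(G has_field_derivative deriv G \<zeta>) (at \<zeta>)" if "\<zeta> \<in> S" for \<zeta>
    using holomorphic_derivI[OF G S(1) that] .
  have dG': "deriv G holomorphic_on S" using G S(1) by (rule holomorphic_deriv)
  have holK: "K holomorphic_on S - {w}"
    using dK S(1) by (auto simp: holomorphic_on_open open_delete)
  have "((\<lambda>\<zeta>. deriv G \<zeta> * K \<zeta> - G \<zeta> * periodic_kernel l (\<zeta> - w)) has_contour_integral
      (G (pathfinish (rectpath a b)) * K (pathfinish (rectpath a b)) - G (pathstart (rectpath a b)) * K (pathstart (rectpath a b)))) (rectpath a b)"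
  proof (rule contour_integral_primitive[OF _ _ pi])
    fix \<zeta> assume \<zeta>: "\<zeta> \<in> S - {w}"
    then have "\<zeta> \<in> S" by simp
    from DERIV_mult[OF dG[OF this] dK[OF \<zeta>]]
    have "((\<lambda>\<zeta>. G \<zeta> * K \<zeta>) has_field_derivative deriv G \<zeta> * K \<zeta> - G \<zeta> * periodic_kernel l (\<zeta> - w)) (at \<zeta>)"
      by (simp add: mult.commute)
    then show "((\<lambda>\<zeta>. G \<zeta> * K \<zeta>) has_field_derivative deriv G \<zeta> * K \<zeta> - G \<zeta> * periodic_kernel l (\<zeta> - w)) (at \<zeta> within S - {w})"
      by (rule has_field_derivative_at_within)
  qed auto
  then have 1: "((\<lambda>\<zeta>. deriv G \<zeta> * K \<zeta> - G \<zeta> * periodic_kernel l (\<zeta> - w)) has_contour_integral 0) (rectpath a b)"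
    by simp
  have holGK: "(\<lambda>\<zeta>. deriv G \<zeta> * K \<zeta>) holomorphic_on S - {w}"
    by (intro holomorphic_intros holK holomorphic_on_subset[OF dG']) auto
  have lim: "((\<lambda>\<zeta>. deriv G \<zeta> * K \<zeta> * (\<zeta> - w)) \<longlongrightarrow> deriv G w) (at w)"
  proof -
    have "((\<lambda>\<zeta>. exp (of_real l * (\<zeta> - w))) has_field_derivative of_real l) (at w)"
      by (auto intro!: derivative_eq_intros)
    then have "((\<lambda>\<zeta>. (exp (of_real l * (\<zeta> - w)) - 1) / (\<zeta> - w)) \<longlongrightarrow> of_real l) (at w)"
      by (simp add: has_field_derivative_iff)
    then have "((\<lambda>\<zeta>. deriv G \<zeta> * (of_real l / ((exp (of_real l * (\<zeta> - w)) - 1) / (\<zeta> - w)))) \<longlongrightarrow> deriv G w * (of_real l / of_real l)) (at w)"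
      using l holomorphic_on_imp_continuous_on[OF dG'] S(1) wS
      by (intro tendsto_intros) (auto simp: continuous_on_eq_continuous_at isCont_def)
    then show ?thesis using l by (simp add: K_def mult_ac)
  qed
  have res: "residue (\<lambda>\<zeta>. deriv G \<zeta> * K \<zeta>) w = deriv G w"
    by (rule residue_simple'[OF S(1) wS holGK lim])
  have "contour_integral (rectpath a b) (\<lambda>\<zeta>. deriv G \<zeta> * K \<zeta>) = 2 * pi * \<i> * (\<Sum>p\<in>{w}. winding_number (rectpath a b) p * residue (\<lambda>\<zeta>. deriv G \<zeta> * K \<zeta>) p)"
  proof (rule Residue_theorem[OF S(1) _ _ holGK])
    show "\<forall>z. z \<notin> S \<longrightarrow> winding_number (rectpath a b) z = 0"
      using winding_number_rectpath_outside[OF le] ab(1) by blast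
  qed (use pi S convex_connected in auto)
  moreover have "(\<lambda>\<zeta>. deriv G \<zeta> * K \<zeta>) contour_integrable_on (rectpath a b)"
    using S(1) pi holGK by (intro contour_integrable_holomorphic_simple[of _ "S - {w}"]) (auto intro: open_delete)
  ultimately have 2: "((\<lambda>\<zeta>. deriv G \<zeta> * K \<zeta>) has_contour_integral 2 * pi * \<i> * deriv G w) (rectpath a b)"
    using winding_number_rectpath[OF ab(2)] res has_contour_integral_integral by fastforce
  from has_contour_integral_diff[OF 2 1] show ?thesis by simp
qed

text \<open>Letting \<open>x\<close> tend to minus infinity discards an exponentially small term,
  for instance the far side of a rectangle.\<close>

lemma exp_tail_limit_bound:
  assumes "m > 0" "\<And>x. x \<le> x0 \<Longrightarrow> a \<le> b + c * exp (m * x)"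
  shows "a \<le> (b::real)"
proof -
  have "((\<lambda>x. b + c * exp (m * x)) \<longlongrightarrow> b + c * 0) at_bot"
    using assms(1) by (intro tendsto_intros) real_asymp
  then have "((\<lambda>x. b + c * exp (m * x)) \<longlongrightarrow> b) at_bot" by simp
  moreover have "eventually (\<lambda>x. a \<le> b + c * exp (m * x)) at_bot"
    using assms(2) by (auto simp: eventually_at_bot_linorder)
  ultimately show ?thesis by (intro tendsto_lowerbound) auto
qed

text \<open>The Cauchy formula on a rectangle of height \<open>2 * \<theta>\<close>. By periodicity
  the horizontal sides combine into the difference of \<open>G\<close> integrated against the
  kernel; the kernel decays at rate \<open>l > \<bar>\<rho>'\<bar>\<close>, so the order
  \<open>\<rho>'\<close> survives. The right side contributes order \<open>l\<close>, which is
  better than \<open>\<rho>'\<close>, and the left side vanishes in the limit because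
  \<open>- l < \<rho>\<close>.\<close>

lemma exp_order_deriv_of_difference:
  assumes hol: "G holomorphic_on {w. Re w < M \<and> \<bar>Im w\<bar> < \<theta> + \<delta>}"
    and \<theta>: "\<theta> > 0" and \<delta>: "0 < \<delta>" "\<delta> \<le> \<theta>" and l: "l * \<theta> = pi"
    and \<rho>: "- l < \<rho>" and \<rho>': "- l < \<rho>'" "\<rho>' < l"
    and ord: "exp_order (\<theta> + \<delta>) \<rho> G"
    and diff: "exp_order \<delta> \<rho>' (\<lambda>w. G (w + \<i> * of_real \<theta>) - G (w - \<i> * of_real \<theta>))"
  shows "exp_order (\<theta> + \<delta>) \<rho>' (deriv G)"
proof (rule exp_orderI)
  fix y0 assume "y0 < \<theta> + \<delta>"
  define y where "y = max y0 0"
  have y: "y0 \<le> y" "0 \<le> y" "y < \<theta> + \<delta>" using \<open>y0 < \<theta> + \<delta>\<close> \<theta> \<delta> by (auto simp: y_def)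
  have l0: "l > 0" using l \<theta> by (metis pi_gt_zero zero_less_mult_pos2)
  \<comment> \<open>The margin kept between \<open>w\<close> and the horizontal sides, and between
    these sides and the edge of the strip.\<close>
  define \<mu> where "\<mu> = min ((\<theta> + \<delta> - y) / 2) \<delta>"
  have \<mu>: "0 < \<mu>" "\<mu> \<le> \<delta>" "y + 2 * \<mu> \<le> \<theta> + \<delta>" using y \<delta> by (auto simp: \<mu>_def min_def field_simps)
  define y1 where "y1 = \<theta> + \<delta> - \<mu>"
  have y1: "y1 < \<theta> + \<delta>" "\<theta> \<le> y1" using \<mu> \<delta> by (auto simp: y1_def)
  obtain C1 M1 where C1: "C1 > 0" "\<And>w. Re w \<le> M1 \<Longrightarrow> \<bar>Im w\<bar> \<le> y1 \<Longrightarrow> norm (G w) \<le> C1 * exp (\<rho> * Re w)"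
    using exp_orderD[OF ord y1(1)] by metis
  have "\<delta> - \<mu> < \<delta>" using \<mu> by simp
  then obtain C2 M2 where C2: "C2 > 0" "\<And>w. Re w \<le> M2 \<Longrightarrow> \<bar>Im w\<bar> \<le> \<delta> - \<mu> \<Longrightarrow>
      norm (G (w + \<i> * of_real \<theta>) - G (w - \<i> * of_real \<theta>)) \<le> C2 * exp (\<rho>' * Re w)"
    using exp_orderD[OF diff] by metis
  have "l * \<mu> \<le> l * \<theta>" using \<mu> \<delta> l0 by (intro mult_left_mono) auto
  then have l\<mu>: "0 < l * \<mu>" "l * \<mu> \<le> pi" using l0 \<mu> l by auto
  obtain K1 where K1: "K1 > 0" "\<And>v. \<mu> \<le> \<bar>Im v\<bar> \<Longrightarrow> l * (\<bar>Im v\<bar> + \<mu>) \<le> 2 * pi \<Longrightarrow> norm (periodic_kernel l v) \<le> K1 * exp (- (l * \<bar>Re v\<bar>))"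
    using periodic_kernel_bound_Im[OF l0 l\<mu>] by metis
  obtain K2 where K2: "K2 > 0" "\<And>v. 1 \<le> \<bar>Re v\<bar> \<Longrightarrow> norm (periodic_kernel l v) \<le> K2 * exp (- (l * \<bar>Re v\<bar>))"
    using periodic_kernel_bound_Re[OF l0] by metis
  define x0 where "x0 = min (min M1 M2) (M - 1)"
  have x0: "x0 \<le> M1" "x0 \<le> M2" "x0 < M" by (auto simp: x0_def)
  define m where "m = l - \<bar>\<rho>'\<bar>"
  have m: "m > 0" using \<rho>' by (auto simp: m_def)
  \<comment> \<open>The first summand bounds the horizontal sides, the second one the right
    side.\<close>
  define B where "B = 2 * (C2 * K1) / m + 2 * \<theta> * (C1 * K2) * exp ((\<rho> - l) * x0) * exp ((l - \<rho>') * x0)"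
  have main: "2 * pi * norm (deriv G w) \<le> B * exp (\<rho>' * Re w)"
    if w: "Re w \<le> x0 - 1" "\<bar>Im w\<bar> \<le> y" for w
  proof (rule exp_tail_limit_bound)
    show "\<rho> + l > 0" using \<rho> by simp
    fix x1 assume x1: "x1 \<le> Re w - 1"
    \<comment> \<open>The height of the centre line of the rectangle. It must stay within \<delta>
      of 0, where the difference is controlled; moving it towards \<open>w\<close> lets the
      rectangle reach points with \<open>\<bar>Im w\<bar>\<close> up to
      \<open>\<theta> + \<delta> - 2 * \<mu>\<close>.\<close>
    define t where "t = (if Im w \<ge> 0 then \<delta> - \<mu> else \<mu> - \<delta>)"
    have t: "\<bar>t\<bar> \<le> \<delta> - \<mu>" "Im w \<ge> t - \<theta> + \<mu>" "Im w \<le> t + \<theta> - \<mu>"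
      using \<mu> w \<delta> by (auto simp: t_def)
    define a b where "a = Complex x1 (t - \<theta>)" and "b = Complex x0 (t + \<theta>)"
    \<comment> \<open>Cutting the strip at vertical distance \<open>2 * \<theta>\<close> from
      \<open>w\<close> leaves \<open>w\<close> as the only pole of the kernel.\<close>
    define S where "S = {z. Re z < M \<and> \<bar>Im z\<bar> < \<theta> + \<delta>} \<inter> {z. \<bar>Im z - Im w\<bar> < 2 * \<theta>}"
    have S1: "S = {z. Re z < M} \<inter> {z. Im z < \<theta> + \<delta>} \<inter> {z. Im z > - (\<theta> + \<delta>)} \<inter> {z. Im z < Im w + 2 * \<theta>} \<inter> {z. Im z > Im w - 2 * \<theta>}"
      by (auto simp: S_def)
    have S: "open S" "convex S" unfolding S1
      by (intro open_Int convex_Int open_halfspace_Re_lt open_halfspace_Im_lt open_halfspace_Im_gt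
          convex_halfspace_Re_lt convex_halfspace_Im_lt convex_halfspace_Im_gt)+
    have cb: "cbox a b \<subseteq> S" "w \<in> box a b"
      using t \<mu> x0 x1 w \<theta> by (auto simp: S_def a_def b_def in_cbox_complex_iff in_box_complex_iff)
    have "((\<lambda>\<zeta>. G \<zeta> * periodic_kernel l (\<zeta> - w)) has_contour_integral 2 * pi * \<i> * deriv G w) (rectpath a b)"
    proof (rule periodic_kernel_formula[OF S _ l0 _ cb])
      show "G holomorphic_on S" using hol by (rule holomorphic_on_subset) (auto simp: S_def)
      fix \<zeta> assume "\<zeta> \<in> S"
      then have "l * \<bar>Im (\<zeta> - w)\<bar> < l * (2 * \<theta>)" using l0 by (intro mult_strict_left_mono) (auto simp: S_def)
      then show "l * \<bar>Im (\<zeta> - w)\<bar> < 2 * pi" using l by simp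
    qed
    define f where "f \<zeta> = G \<zeta> * periodic_kernel l (\<zeta> - w)" for \<zeta>
    define p1 p2 p3 p4 where "p1 = linepath (Complex x1 (t - \<theta>)) (Complex x0 (t - \<theta>))"
      and "p2 = linepath (Complex x0 (t - \<theta>)) (Complex x0 (t + \<theta>))"
      and "p3 = linepath (Complex x0 (t + \<theta>)) (Complex x1 (t + \<theta>))"
      and "p4 = linepath (Complex x1 (t + \<theta>)) (Complex x1 (t - \<theta>))"
    have rp: "rectpath a b = p1 +++ p2 +++ p3 +++ p4"
      by (simp add: rectpath_def Let_def a_def b_def p1_def p2_def p3_def p4_def)
    have I0: "(f has_contour_integral 2 * pi * \<i> * deriv G w) (p1 +++ p2 +++ p3 +++ p4)"
      using \<open>(_ has_contour_integral _) (rectpath a b)\<close> unfolding f_def [abs_def] rp .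
    have vp: "valid_path p1" "valid_path p2" "valid_path p3" "valid_path p4"
      by (simp_all add: p1_def p2_def p3_def p4_def)
    have int: "f contour_integrable_on p1" "f contour_integrable_on p2" "f contour_integrable_on p3" "f contour_integrable_on p4"
    proof -
      have i1: "f contour_integrable_on (p1 +++ p2 +++ p3 +++ p4)" using I0 by (auto simp: contour_integrable_on_def)
      have v34: "valid_path (p3 +++ p4)" and v234: "valid_path (p2 +++ p3 +++ p4)"
        by (auto intro!: valid_path_join simp: p1_def p2_def p3_def p4_def)
      have i2: "f contour_integrable_on (p2 +++ p3 +++ p4)" by (rule contour_integrable_joinD2[OF i1 v234])
      have i3: "f contour_integrable_on (p3 +++ p4)" by (rule contour_integrable_joinD2[OF i2 v34])
      show "f contour_integrable_on p1" by (rule contour_integrable_joinD1[OF i1 vp(1)])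
      show "f contour_integrable_on p2" by (rule contour_integrable_joinD1[OF i2 vp(2)])
      show "f contour_integrable_on p3" by (rule contour_integrable_joinD1[OF i3 vp(3)])
      show "f contour_integrable_on p4" by (rule contour_integrable_joinD2[OF i3 vp(4)])
    qed
    define J1 J2 J3 J4 where "J1 = contour_integral p1 f" and "J2 = contour_integral p2 f"
      and "J3 = contour_integral p3 f" and "J4 = contour_integral p4 f"
    have J: "(f has_contour_integral J1) p1" "(f has_contour_integral J2) p2" "(f has_contour_integral J3) p3" "(f has_contour_integral J4) p4"
      using int by (auto simp: J1_def J2_def J3_def J4_def has_contour_integral_integral)
    have "(f has_contour_integral (J1 + (J2 + (J3 + J4)))) (p1 +++ p2 +++ p3 +++ p4)"
      by (intro has_contour_integral_join J vp valid_path_join) (auto simp: p1_def p2_def p3_def p4_def)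
    then have sum: "2 * pi * \<i> * deriv G w = J1 + (J2 + (J3 + J4))"
      using I0 has_contour_integral_unique by blast
    have J3': "(f has_contour_integral (- J3)) (linepath (Complex x1 (t + \<theta>)) (Complex x0 (t + \<theta>)))"
      using has_contour_integral_reversepath[OF _ J(3)] by (simp add: p3_def)
    have x10: "x1 < x0" using x1 w by simp
    have "((\<lambda>\<xi>. f (Complex \<xi> (t - \<theta>)) - f (Complex \<xi> (t + \<theta>))) has_integral (J1 - (- J3))) {x1..x0}"
      using J(1) J3' x10 unfolding p1_def
      by (intro has_integral_diff) (simp_all add: has_contour_integral_linepath_same_Im_iff)
    then have "((\<lambda>\<zeta>. f \<zeta> - f (\<zeta> + \<i> * of_real (2 * \<theta>))) has_contour_integral (J1 + J3)) (linepath (Complex x1 (t - \<theta>)) (Complex x0 (t - \<theta>)))"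
    proof -
      have "Complex \<xi> (t - \<theta>) + \<i> * of_real (2 * \<theta>) = Complex \<xi> (t + \<theta>)" for \<xi> by (simp add: complex_eq_iff)
      then show ?thesis
        using \<open>(_ has_integral (J1 - (- J3))) _\<close> unfolding has_contour_integral_linepath_same_Im_iff[OF x10] by simp
    qed
    then have H: "norm (J1 + J3) \<le> 2 * (C2 * K1 * exp (\<rho>' * Re w)) / m"
    proof (rule horizontal_integral_bound)
      fix \<xi> assume \<xi>: "x1 \<le> \<xi>" "\<xi> \<le> x0"
      let ?z = "Complex \<xi> t"
      have e1: "Complex \<xi> (t - \<theta>) = ?z - \<i> * of_real \<theta>" and e2: "?z - \<i> * of_real \<theta> + \<i> * of_real (2 * \<theta>) = ?z + \<i> * of_real \<theta>"
        by (auto simp: complex_eq_iff)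
      let ?k = "periodic_kernel l (?z - \<i> * of_real \<theta> - w)"
      have "periodic_kernel l (?z + \<i> * of_real \<theta> - w) = periodic_kernel l (?z - \<i> * of_real \<theta> - w + \<i> * of_real (2 * \<theta>))"
        by (rule arg_cong) (auto simp: complex_eq_iff)
      also have "\<dots> = ?k" by (rule periodic_kernel_periodic) (use l in simp)
      finally have "f (Complex \<xi> (t - \<theta>)) - f (Complex \<xi> (t - \<theta>) + \<i> * of_real (2 * \<theta>))
          = - (G (?z + \<i> * of_real \<theta>) - G (?z - \<i> * of_real \<theta>)) * ?k"
        unfolding e1 e2 f_def by (simp add: algebra_simps)
      then have "norm (f (Complex \<xi> (t - \<theta>)) - f (Complex \<xi> (t - \<theta>) + \<i> * of_real (2 * \<theta>)))
          = norm (G (?z + \<i> * of_real \<theta>) - G (?z - \<i> * of_real \<theta>)) * norm ?k"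
        by (simp only: norm_mult norm_minus_cancel)
      also have "\<dots> \<le> (C2 * exp (\<rho>' * \<xi>)) * (K1 * exp (- (l * \<bar>\<xi> - Re w\<bar>)))"
      proof (rule mult_mono)
        show "norm (G (?z + \<i> * of_real \<theta>) - G (?z - \<i> * of_real \<theta>)) \<le> C2 * exp (\<rho>' * \<xi>)"
          using C2(2)[of ?z] \<xi> x0 t by simp
        have "l * (\<bar>Im (?z - \<i> * of_real \<theta> - w)\<bar> + \<mu>) \<le> l * (2 * \<theta>)"
          using t l0 \<mu> by (intro mult_left_mono) auto
        then show "norm ?k \<le> K1 * exp (- (l * \<bar>\<xi> - Re w\<bar>))"
          using K1(2)[of "?z - \<i> * of_real \<theta> - w"] t l by auto
      qed (use C2 in auto)
      also have "\<dots> = C2 * K1 * exp (\<rho>' * \<xi> - l * \<bar>\<xi> - Re w\<bar>)" by (simp add: exp_diff exp_minus field_simps)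
      also have "\<dots> \<le> C2 * K1 * exp (\<rho>' * Re w - m * \<bar>\<xi> - Re w\<bar>)"
      proof -
        have "\<rho>' * (\<xi> - Re w) \<le> \<bar>\<rho>'\<bar> * \<bar>\<xi> - Re w\<bar>" by (metis abs_ge_self abs_mult)
        then have "\<rho>' * \<xi> - l * \<bar>\<xi> - Re w\<bar> \<le> \<rho>' * Re w - m * \<bar>\<xi> - Re w\<bar>" by (simp add: m_def algebra_simps)
        then show ?thesis using C2 K1 by (intro mult_left_mono) auto
      qed
      finally show "norm (f (Complex \<xi> (t - \<theta>)) - f (Complex \<xi> (t - \<theta>) + \<i> * of_real (2 * \<theta>)))
          \<le> C2 * K1 * exp (\<rho>' * Re w) * exp (- m * \<bar>\<xi> - Re w\<bar>)"
        by (simp add: exp_diff exp_minus field_simps)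
    qed (use x1 w m C2 K1 in auto)
    have vert: "norm (f (Complex x s)) \<le> C1 * exp (\<rho> * x) * (K2 * exp (- (l * \<bar>x - Re w\<bar>)))"
      if "x \<le> x0" "1 \<le> \<bar>x - Re w\<bar>" "\<bar>s\<bar> \<le> y1" for x s
      unfolding f_def norm_mult
      using C1(2)[of "Complex x s"] K2(2)[of "Complex x s - w"] C1(1) that x0 by (intro mult_mono) auto
    have ts: "\<bar>s\<bar> \<le> y1" if "t - \<theta> \<le> s" "s \<le> t + \<theta>" for s using that t by (auto simp: y1_def)
    have V2: "norm J2 \<le> C1 * exp (\<rho> * x0) * (K2 * exp (- (l * (x0 - Re w)))) * (2 * \<theta>)"
    proof -
      have "norm J2 \<le> (C1 * exp (\<rho> * x0) * (K2 * exp (- (l * (x0 - Re w))))) * norm (Complex x0 (t + \<theta>) - Complex x0 (t - \<theta>))"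
      proof (rule has_contour_integral_bound_linepath[OF J(2)[unfolded p2_def]])
        fix z assume "z \<in> closed_segment (Complex x0 (t - \<theta>)) (Complex x0 (t + \<theta>))"
        then obtain s where "z = Complex x0 s" "t - \<theta> \<le> s" "s \<le> t + \<theta>"
          using \<theta> by (auto simp: closed_segment_same_Re closed_segment_eq_real_ivl complex_eq_iff)
        then show "norm (f z) \<le> C1 * exp (\<rho> * x0) * (K2 * exp (- (l * (x0 - Re w))))"
          using vert[of x0 s] ts[of s] w by (auto simp: abs_if split: if_splits)
      qed (use C1 K2 in auto)
      also have "norm (Complex x0 (t + \<theta>) - Complex x0 (t - \<theta>)) = 2 * \<theta>" using \<theta> by (simp add: cmod_def real_sqrt_mult)
      finally show ?thesis .
    qed
    have V4: "norm J4 \<le> C1 * exp (\<rho> * x1) * (K2 * exp (- (l * (Re w - x1)))) * (2 * \<theta>)"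
    proof -
      have "norm J4 \<le> (C1 * exp (\<rho> * x1) * (K2 * exp (- (l * (Re w - x1))))) * norm (Complex x1 (t - \<theta>) - Complex x1 (t + \<theta>))"
      proof (rule has_contour_integral_bound_linepath[OF J(4)[unfolded p4_def]])
        fix z assume "z \<in> closed_segment (Complex x1 (t + \<theta>)) (Complex x1 (t - \<theta>))"
        then obtain s where "z = Complex x1 s" "t - \<theta> \<le> s" "s \<le> t + \<theta>"
          using \<theta> by (auto simp: closed_segment_same_Re closed_segment_eq_real_ivl complex_eq_iff)
        then show "norm (f z) \<le> C1 * exp (\<rho> * x1) * (K2 * exp (- (l * (Re w - x1))))"
          using vert[of x1 s] ts[of s] w x1 by (auto simp: abs_if split: if_splits)
      qed (use C1 K2 in auto)
      also have "norm (Complex x1 (t - \<theta>) - Complex x1 (t + \<theta>)) = 2 * \<theta>" using \<theta> by (simp add: cmod_def real_sqrt_mult)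
      finally show ?thesis .
    qed
    have "2 * pi * norm (deriv G w) = norm (2 * pi * \<i> * deriv G w)" by (simp add: norm_mult)
    also have "\<dots> = norm ((J1 + J3) + J2 + J4)" unfolding sum by (simp add: algebra_simps)
    also have "\<dots> \<le> norm (J1 + J3) + norm J2 + norm J4"
      using norm_triangle_ineq[of "J1 + J3 + J2" J4] norm_triangle_ineq[of "J1 + J3" J2] by linarith
    also have "norm J2 \<le> 2 * \<theta> * (C1 * K2) * exp ((\<rho> - l) * x0) * exp ((l - \<rho>') * x0) * exp (\<rho>' * Re w)"
    proof -
      have "C1 * exp (\<rho> * x0) * (K2 * exp (- (l * (x0 - Re w)))) * (2 * \<theta>)
        = 2 * \<theta> * (C1 * K2) * exp ((\<rho> - l) * x0) * exp ((l - \<rho>') * Re w) * exp (\<rho>' * Re w)"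
        by (simp add: exp_add [symmetric] algebra_simps)
      also have "\<dots> \<le> 2 * \<theta> * (C1 * K2) * exp ((\<rho> - l) * x0) * exp ((l - \<rho>') * x0) * exp (\<rho>' * Re w)"
        using w \<rho>' \<theta> C1 K2 by (intro mult_right_mono mult_left_mono) auto
      finally show ?thesis using V2 by linarith
    qed
    also have "norm J4 \<le> (2 * \<theta> * (C1 * K2) * exp (- l * Re w)) * exp ((\<rho> + l) * x1)"
      using V4 by (simp add: exp_add [symmetric] algebra_simps)
    finally have "2 * pi * norm (deriv G w) \<le> norm (J1 + J3) + 2 * \<theta> * (C1 * K2) * exp ((\<rho> - l) * x0) * exp ((l - \<rho>') * x0) * exp (\<rho>' * Re w) + (2 * \<theta> * (C1 * K2) * exp (- l * Re w)) * exp ((\<rho> + l) * x1)" by simp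
    then show "2 * pi * norm (deriv G w) \<le> B * exp (\<rho>' * Re w) + (2 * \<theta> * (C1 * K2) * exp (- l * Re w)) * exp ((\<rho> + l) * x1)"
      using H by (simp add: B_def algebra_simps)
  qed
  show "\<exists>C M. \<forall>w. Re w \<le> M \<longrightarrow> \<bar>Im w\<bar> \<le> y0 \<longrightarrow> norm (deriv G w) \<le> C * exp (\<rho>' * Re w)"
  proof (rule exI[of _ "B / (2 * pi)"], rule exI[of _ "x0 - 1"], intro allI impI)
    fix w assume "Re w \<le> x0 - 1" "\<bar>Im w\<bar> \<le> y0"
    then show "norm (deriv G w) \<le> B / (2 * pi) * exp (\<rho>' * Re w)"
      using main[of w] y by (simp add: field_simps)
  qed
qed

section \<open>Orders of derivatives, primitives and perturbed arguments\<close>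

lemma exp_order_cong_ev:
  assumes "exp_order Y \<rho> f" "\<And>w. Re w \<le> M \<Longrightarrow> \<bar>Im w\<bar> < Y \<Longrightarrow> f w = g w"
  shows "exp_order Y \<rho> g"
proof (rule exp_orderI)
  fix y assume y: "y < Y"
  from exp_orderD[OF assms(1) this] obtain C M1 where CM: "C > 0"
    "\<And>w. Re w \<le> M1 \<Longrightarrow> \<bar>Im w\<bar> \<le> y \<Longrightarrow> norm (f w) \<le> C * exp (\<rho> * Re w)"
    by blast
  show "\<exists>C M. \<forall>w. Re w \<le> M \<longrightarrow> \<bar>Im w\<bar> \<le> y \<longrightarrow> norm (g w) \<le> C * exp (\<rho> * Re w)"
  proof (rule exI[of _ C], rule exI[of _ "min M M1"], intro allI impI)
    fix w assume "Re w \<le> min M M1" "\<bar>Im w\<bar> \<le> y"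
    then show "norm (g w) \<le> C * exp (\<rho> * Re w)" using CM(2)[of w] assms(2)[of w] y by simp
  qed
qed

lemma exp_order_shift_real:
  assumes "exp_order Y \<rho> f"
  shows "exp_order Y \<rho> (\<lambda>w. f (w + of_real c))"
proof (rule exp_orderI)
  fix y assume y: "y < Y"
  from exp_orderD[OF assms(1) this] obtain C M where CM: "C > 0"
    "\<And>w. Re w \<le> M \<Longrightarrow> \<bar>Im w\<bar> \<le> y \<Longrightarrow> norm (f w) \<le> C * exp (\<rho> * Re w)"
    by blast
  show "\<exists>C M. \<forall>w. Re w \<le> M \<longrightarrow> \<bar>Im w\<bar> \<le> y \<longrightarrow> norm (f (w + of_real c)) \<le> C * exp (\<rho> * Re w)"
  proof (rule exI[of _ "C * exp (\<rho> * c)"], rule exI[of _ "M - c"], intro allI impI)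
    fix w assume "Re w \<le> M - c" "\<bar>Im w\<bar> \<le> y"
    then show "norm (f (w + of_real c)) \<le> C * exp (\<rho> * c) * exp (\<rho> * Re w)"
      using CM(2)[of "w + of_real c"] by (simp add: exp_add algebra_simps)
  qed
qed

lemma exp_order_deriv:
  assumes hol: "G holomorphic_on {w. Re w < M \<and> \<bar>Im w\<bar> < Y}" and ord: "exp_order Y \<rho> G"
  shows "exp_order Y \<rho> (deriv G)"
proof (rule exp_orderI)
  fix y assume y: "y < Y"
  define r where "r = (Y - y) / 2"
  have r: "r > 0" "y + r < Y" using y by (auto simp: r_def field_simps)
  obtain C M1 where C: "C > 0" "\<And>w. Re w \<le> M1 \<Longrightarrow> \<bar>Im w\<bar> \<le> y + r \<Longrightarrow> norm (G w) \<le> C * exp (\<rho> * Re w)"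
    using exp_orderD[OF ord r(2)] by blast
  show "\<exists>C M. \<forall>w. Re w \<le> M \<longrightarrow> \<bar>Im w\<bar> \<le> y \<longrightarrow> norm (deriv G w) \<le> C * exp (\<rho> * Re w)"
  proof (rule exI[of _ "C * exp (\<bar>\<rho>\<bar> * r) / r"], rule exI[of _ "min M M1 - r - 1"], intro allI impI)
    fix w assume w: "Re w \<le> min M M1 - r - 1" "\<bar>Im w\<bar> \<le> y"
    have near: "\<bar>Re z - Re w\<bar> \<le> r" "\<bar>Im z\<bar> \<le> y + r" if "norm (w - z) \<le> r" for z
      using abs_Re_le_cmod[of "w - z"] abs_Im_le_cmod[of "w - z"] that w by auto
    have sub: "cball w r \<subseteq> {w. Re w < M \<and> \<bar>Im w\<bar> < Y}"
    proof
      fix z assume "z \<in> cball w r"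
      then show "z \<in> {w. Re w < M \<and> \<bar>Im w\<bar> < Y}" using near[of z] w r by (auto simp: dist_norm)
    qed
    have "norm ((deriv ^^ 1) G w) \<le> fact 1 * (C * exp (\<rho> * Re w + \<bar>\<rho>\<bar> * r)) / r ^ 1"
    proof (rule Cauchy_inequality)
      show "G holomorphic_on ball w r" using hol sub by (meson ball_subset_cball holomorphic_on_subset subset_trans)
      show "continuous_on (cball w r) G" using hol sub by (meson holomorphic_on_imp_continuous_on holomorphic_on_subset)
      fix z assume z: "norm (w - z) = r"
      have "norm (G z) \<le> C * exp (\<rho> * Re z)" using C(2)[of z] near[of z] z w by auto
      also have "\<rho> * (Re z - Re w) \<le> \<bar>\<rho>\<bar> * \<bar>Re z - Re w\<bar>" by (metis abs_ge_self abs_mult)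
      then have "\<rho> * Re z \<le> \<rho> * Re w + \<bar>\<rho>\<bar> * r"
        using mult_left_mono[OF near(1)[of z], of "\<bar>\<rho>\<bar>"] z by (simp add: algebra_simps)
      then have "C * exp (\<rho> * Re z) \<le> C * exp (\<rho> * Re w + \<bar>\<rho>\<bar> * r)" using C by simp
      finally show "norm (G z) \<le> C * exp (\<rho> * Re w + \<bar>\<rho>\<bar> * r)" .
    qed (use r in auto)
    then show "norm (deriv G w) \<le> C * exp (\<bar>\<rho>\<bar> * r) / r * exp (\<rho> * Re w)"
      by (simp add: exp_add mult_ac)
  qed
qed

lemma open_left_strip: "open {w. Re w < M \<and> \<bar>Im w\<bar> < Y}"
proof -
  have "{w. Re w < M \<and> \<bar>Im w\<bar> < Y} = {z. Re z < M} \<inter> {z. Im z < Y} \<inter> {z. Im z > - Y}" by auto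
  then show ?thesis by (auto intro: open_halfspace_Re_lt open_halfspace_Im_lt open_halfspace_Im_gt)
qed

text \<open>Integrate along the real axis, then vertically over a bounded distance. At
  \<open>\<rho> = 0\<close> integration would produce linear growth, hence the exclusion of this
  value.\<close>

lemma exp_order_antiderivative:
  assumes hol: "G holomorphic_on {w. Re w < M \<and> \<bar>Im w\<bar> < Y}" and Y: "Y > 0"
    and ord: "exp_order Y \<rho> (deriv G)" and \<rho>: "\<rho> \<noteq> 0"
  obtains a where "exp_order Y \<rho> (\<lambda>w. G w - a)"
proof -
  have dG: "(G has_field_derivative deriv G z) (at z)" if "Re z < M" "\<bar>Im z\<bar> < Y" for z
    using holomorphic_derivI[OF hol open_left_strip, of z] that by auto
  obtain C M1 where C: "C > 0" "\<And>w. Re w \<le> M1 \<Longrightarrow> \<bar>Im w\<bar> \<le> 0 \<Longrightarrow> norm (deriv G w) \<le> C * exp (\<rho> * Re w)"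
    using exp_orderD[OF ord Y] by metis
  define x0 where "x0 = min M1 (M - 1)"
  have real_bound: "norm (G (of_real b) - G (of_real a)) \<le> C / \<rho> * exp (\<rho> * b) - C / \<rho> * exp (\<rho> * a)"
    if ab: "a < b" "b \<le> x0" for a b
  proof (rule differentiable_bound_general[OF ab(1), where f = "\<lambda>t. G (of_real t)" and \<phi> = "\<lambda>t. C / \<rho> * exp (\<rho> * t)" and
        f' = "\<lambda>t. deriv G (of_real t)" and \<phi>' = "\<lambda>t. C * exp (\<rho> * t)"])
    have d: "((\<lambda>t. G (of_real t)) has_vector_derivative deriv G (of_real t)) (at t)" if "t \<le> b" for t
      using has_vector_derivative_real_field[OF dG[of "of_real t"]] that ab Y by (auto simp: x0_def)
    then show "continuous_on {a..b} (\<lambda>t. G (of_real t))"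
      by (auto intro!: continuous_at_imp_continuous_on has_vector_derivative_continuous)
    show "continuous_on {a..b} (\<lambda>t. C / \<rho> * exp (\<rho> * t))" by (intro continuous_intros)
    fix x assume "a < x" "x < b"
    then show "((\<lambda>t. G (of_real t)) has_vector_derivative deriv G (of_real x)) (at x)" using d by simp
    show "((\<lambda>t. C / \<rho> * exp (\<rho> * t)) has_vector_derivative C * exp (\<rho> * x)) (at x)"
      using \<rho> by (auto intro!: derivative_eq_intros simp: has_real_derivative_iff_has_vector_derivative [symmetric])
    show "norm (deriv G (of_real x)) \<le> C * exp (\<rho> * x)" using C(2)[of "of_real x"] \<open>x < b\<close> ab by (auto simp: x0_def)
  qed
  obtain a K where aK: "K \<ge> 0" "\<And>x. x < x0 \<Longrightarrow> norm (G (of_real x) - a) \<le> K * exp (\<rho> * x)"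
  proof (cases "\<rho> > 0")
    case True
    define X where "X n = G (of_real (x0 - real n))" for n
    have Xb: "norm (X m - X n) \<le> C / \<rho> * exp (\<rho> * (x0 - real m))" if "m < n" for m n
    proof -
      have "norm (X m - X n) \<le> C / \<rho> * exp (\<rho> * (x0 - real m)) - C / \<rho> * exp (\<rho> * (x0 - real n))"
        unfolding X_def using that by (intro real_bound) auto
      also have "\<dots> \<le> C / \<rho> * exp (\<rho> * (x0 - real m))" using C True by simp
      finally show ?thesis .
    qed
    have lim0: "(\<lambda>m. C / \<rho> * exp (\<rho> * (x0 - real m))) \<longlonglongrightarrow> 0" using True by real_asymp
    have "Cauchy X"
    proof (rule CauchyI')
      fix e :: real assume "e > 0"
      then have "eventually (\<lambda>m. C / \<rho> * exp (\<rho> * (x0 - real m)) < e) sequentially"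
        using lim0 by (rule order_tendstoD(2)[rotated])
      then obtain N where "\<And>m. m \<ge> N \<Longrightarrow> C / \<rho> * exp (\<rho> * (x0 - real m)) < e" by (auto simp: eventually_sequentially)
      then show "\<exists>N. \<forall>m\<ge>N. \<forall>n>m. dist (X m) (X n) < e"
        using Xb by (intro exI[of _ N] allI impI) (auto simp: dist_norm intro: le_less_trans)
    qed
    then obtain a where a: "X \<longlonglongrightarrow> a" using Cauchy_convergent_iff convergent_def by blast
    have "norm (G (of_real x) - a) \<le> (C / \<rho>) * exp (\<rho> * x)" if x: "x < x0" for x
    proof (rule tendsto_upperbound)
      show "(\<lambda>n. norm (G (of_real x) - X n)) \<longlonglongrightarrow> norm (G (of_real x) - a)" by (intro tendsto_intros a)
      have "eventually (\<lambda>n::nat. real n > x0 - x) sequentially"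
        by (intro filterlim_at_top_dense[THEN iffD1, rule_format] filterlim_real_sequentially)
      then show "eventually (\<lambda>n. norm (G (of_real x) - X n) \<le> (C / \<rho>) * exp (\<rho> * x)) sequentially"
      proof eventually_elim
        case (elim n)
        have "norm (G (of_real x) - X n) \<le> C / \<rho> * exp (\<rho> * x) - C / \<rho> * exp (\<rho> * (x0 - real n))"
          unfolding X_def using elim x by (intro real_bound) auto
        also have "\<dots> \<le> C / \<rho> * exp (\<rho> * x)" using C True by simp
        finally show ?case .
      qed
    qed simp
    then show thesis using that[of "C / \<rho>" a] C True by auto
  next
    \<comment> \<open>For negative \<rho> the comparison function grows to the left and absorbs
      every constant, so \<open>a = 0\<close> serves.\<close>
    case False
    then have neg: "\<rho> < 0" using \<rho> by simp
    define g where "g = norm (G (of_real x0))"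
    have "norm (G (of_real x) - 0) \<le> (g * exp (- \<rho> * x0) - C / \<rho>) * exp (\<rho> * x)" if x: "x < x0" for x
    proof -
      have "norm (G (of_real x)) \<le> g + norm (G (of_real x0) - G (of_real x))"
        unfolding g_def by (metis norm_minus_commute norm_triangle_sub)
      also have "norm (G (of_real x0) - G (of_real x)) \<le> C / \<rho> * exp (\<rho> * x0) - C / \<rho> * exp (\<rho> * x)"
        using x by (intro real_bound) auto
      also have "\<dots> \<le> - (C / \<rho>) * exp (\<rho> * x)" using neg C by (simp add: divide_nonneg_neg mult_nonpos_nonneg)
      also have "g \<le> g * exp (- \<rho> * x0) * exp (\<rho> * x)"
      proof -
        have "0 \<le> \<rho> * (x - x0)" using neg x by (simp add: mult_nonpos_nonpos)
        then have "1 \<le> exp (- \<rho> * x0) * exp (\<rho> * x)" by (simp add: exp_add [symmetric] algebra_simps)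
        then show ?thesis using mult_left_mono[of 1 "exp (- \<rho> * x0) * exp (\<rho> * x)" g] by (simp add: g_def mult.assoc)
      qed
      finally show ?thesis by (simp add: algebra_simps)
    qed
    moreover have "g * exp (- \<rho> * x0) - C / \<rho> \<ge> 0" using neg C by (simp add: g_def divide_pos_neg less_imp_le order.trans[of _ 0])
    ultimately show thesis using that[of "g * exp (- \<rho> * x0) - C / \<rho>" 0] by blast
  qed
  have "exp_order Y \<rho> (\<lambda>w. G w - a)"
  proof (rule exp_orderI)
    fix y' assume "y' < Y"
    define y where "y = max y' 0"
    have y: "y < Y" "y \<ge> 0" "y' \<le> y" using \<open>y' < Y\<close> Y by (auto simp: y_def)
    obtain C M2 where C: "C > 0" "\<And>w. Re w \<le> M2 \<Longrightarrow> \<bar>Im w\<bar> \<le> y \<Longrightarrow> norm (deriv G w) \<le> C * exp (\<rho> * Re w)"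
      using exp_orderD[OF ord y(1)] by metis
    show "\<exists>C M. \<forall>w. Re w \<le> M \<longrightarrow> \<bar>Im w\<bar> \<le> y' \<longrightarrow> norm (G w - a) \<le> C * exp (\<rho> * Re w)"
    proof (rule exI[of _ "C * y + K"], rule exI[of _ "min M2 (x0 - 1)"], intro allI impI)
      fix w assume w: "Re w \<le> min M2 (x0 - 1)" "\<bar>Im w\<bar> \<le> y'"
      have seg: "Re z = Re w \<and> \<bar>Im z\<bar> \<le> y" if "z \<in> closed_segment (of_real (Re w)) w" for z
        using that w y by (auto simp: closed_segment_same_Re closed_segment_eq_real_ivl split: if_splits)
      have "norm (G w - G (of_real (Re w))) \<le> C * exp (\<rho> * Re w) * norm (w - of_real (Re w))"
      proof (rule field_differentiable_bound[of "closed_segment (of_real (Re w)) w" G "deriv G"])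
        fix z assume z: "z \<in> closed_segment (complex_of_real (Re w)) w"
        show "(G has_field_derivative deriv G z) (at z within closed_segment (of_real (Re w)) w)"
          using seg[OF z] w y by (rule_tac has_field_derivative_at_within[OF dG]) (auto simp: x0_def)
        show "norm (deriv G z) \<le> C * exp (\<rho> * Re w)" using C(2)[of z] seg[OF z] w by auto
      qed auto
      also have "norm (w - of_real (Re w)) = \<bar>Im w\<bar>" by (simp add: cmod_def)
      also have "C * exp (\<rho> * Re w) * \<bar>Im w\<bar> \<le> C * exp (\<rho> * Re w) * y" using w y C by (intro mult_left_mono) auto
      finally have 1: "norm (G w - G (of_real (Re w))) \<le> C * exp (\<rho> * Re w) * y" .
      have "norm (G w - a) \<le> norm (G w - G (of_real (Re w))) + norm (G (of_real (Re w)) - a)"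
        using norm_triangle_ineq[of "G w - G (of_real (Re w))" "G (of_real (Re w)) - a"] by simp
      also have "norm (G (of_real (Re w)) - a) \<le> K * exp (\<rho> * Re w)" using w by (intro aK) auto
      finally show "norm (G w - a) \<le> (C * y + K) * exp (\<rho> * Re w)" using 1 by (simp add: algebra_simps)
    qed
  qed
  then show thesis by (rule that)
qed

text \<open>The mean value inequality on the segment from \<open>s + c\<close> to
  \<open>B s\<close>: its length is of order 1, and the derivative of \<open>E\<close> has the same
  order as \<open>E\<close> on slightly smaller strips. This is the gain of one order that drives
  the bootstrap.\<close>

lemma exp_order_near_trans_diff:
  assumes hol: "E holomorphic_on {w. Re w < M \<and> \<bar>Im w\<bar> < Y}" and ord: "exp_order Y \<sigma> E"
    and B: "near_trans c B" and Y': "Y' + \<bar>Im c\<bar> \<le> Y"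
  shows "exp_order Y' (\<sigma> + 1) (\<lambda>s. E (B s) - E (s + c))"
proof (rule exp_orderI)
  fix y assume y: "y < Y'"
  define e where "e = min 1 ((Y' - y) / 2)"
  have e: "e > 0" "e \<le> 1" "y + e < Y'" using y by (auto simp: e_def min_def field_simps)
  define y1 where "y1 = y + \<bar>Im c\<bar> + e"
  have y1: "y1 < Y" using e Y' by (simp add: y1_def)
  obtain C M1 where C: "C > 0" "\<And>w. Re w \<le> M1 \<Longrightarrow> \<bar>Im w\<bar> \<le> y1 \<Longrightarrow> norm (deriv E w) \<le> C * exp (\<sigma> * Re w)"
    using exp_orderD[OF exp_order_deriv[OF hol ord] y1] by metis
  obtain C' M2 where C': "C' > 0" "\<And>s. Re s \<le> M2 \<Longrightarrow> norm (B s - s - c) \<le> C' * exp (Re s)"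
    using near_trans_bound[OF B] by metis
  obtain M3 where M3: "\<And>s. Re s \<le> M3 \<Longrightarrow> norm (B s - s - c) \<le> e"
    using near_trans_close[OF B e(1)] by metis
  \<comment> \<open>Bounds the variation of \<open>\<sigma> * Re z\<close> along the segment, whose
    points have real part within \<open>\<bar>Re c\<bar> + 1\<close> of \<open>Re s\<close>.\<close>
  define a where "a = \<bar>\<sigma>\<bar> * (\<bar>Re c\<bar> + 1)"
  show "\<exists>C M. \<forall>w. Re w \<le> M \<longrightarrow> \<bar>Im w\<bar> \<le> y \<longrightarrow> norm (E (B w) - E (w + c)) \<le> C * exp ((\<sigma> + 1) * Re w)"
  proof (rule exI[of _ "C * exp a * C'"], rule exI[of _ "min (min M2 M3) (min M M1 - \<bar>Re c\<bar> - 2)"], intro allI impI)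
    fix s assume s: "Re s \<le> min (min M2 M3) (min M M1 - \<bar>Re c\<bar> - 2)" "\<bar>Im s\<bar> \<le> y"
    have seg: "\<bar>Re z - Re s\<bar> \<le> \<bar>Re c\<bar> + 1 \<and> \<bar>Im z\<bar> \<le> y1" if "z \<in> closed_segment (s + c) (B s)" for z
    proof -
      have "norm (z - (s + c)) \<le> norm (B s - (s + c))" using that by (metis dist_commute dist_in_closed_segment dist_norm)
      also have "\<dots> \<le> e" using M3[of s] s by (simp add: diff_diff_eq)
      finally show ?thesis
        using abs_Re_le_cmod[of "z - (s + c)"] abs_Im_le_cmod[of "z - (s + c)"] s e by (auto simp: y1_def)
    qed
    have "norm (E (B s) - E (s + c)) \<le> C * exp (\<sigma> * Re s + a) * norm (B s - (s + c))"
    proof (rule field_differentiable_bound[of "closed_segment (s + c) (B s)" E "deriv E"])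
      fix z assume z: "z \<in> closed_segment (s + c) (B s)"
      show "(E has_field_derivative deriv E z) (at z within closed_segment (s + c) (B s))"
        using seg[OF z] s y1 by (rule_tac has_field_derivative_at_within[OF holomorphic_derivI[OF hol open_left_strip]]) auto
      have "norm (deriv E z) \<le> C * exp (\<sigma> * Re z)" using seg[OF z] s by (intro C) auto
      also have "\<sigma> * (Re z - Re s) \<le> \<bar>\<sigma>\<bar> * \<bar>Re z - Re s\<bar>" by (metis abs_ge_self abs_mult)
      then have "\<sigma> * Re z \<le> \<sigma> * Re s + a"
        using mult_left_mono[of "\<bar>Re z - Re s\<bar>" "\<bar>Re c\<bar> + 1" "\<bar>\<sigma>\<bar>"] seg[OF z] by (simp add: a_def algebra_simps)
      then have "C * exp (\<sigma> * Re z) \<le> C * exp (\<sigma> * Re s + a)" using C by simp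
      finally show "norm (deriv E z) \<le> C * exp (\<sigma> * Re s + a)" .
    qed auto
    also have "\<dots> \<le> C * exp (\<sigma> * Re s + a) * (C' * exp (Re s))"
      using C'(2)[of s] s C by (intro mult_left_mono) (auto simp: diff_diff_eq)
    also have "\<dots> = C * exp a * C' * exp ((\<sigma> + 1) * Re s)" by (simp add: exp_add algebra_simps)
    finally show "norm (E (B s) - E (s + c)) \<le> C * exp a * C' * exp ((\<sigma> + 1) * Re s)" .
  qed
qed

lemma exp_order_exp_imp_zero:
  assumes "exp_order Y \<rho> (\<lambda>w. a * exp (of_real \<kappa> * w))" "\<kappa> < \<rho>" "Y > 0"
  shows "a = 0"
proof -
  obtain C M where C: "\<And>w. Re w \<le> M \<Longrightarrow> \<bar>Im w\<bar> \<le> 0 \<Longrightarrow> norm (a * exp (of_real \<kappa> * w)) \<le> C * exp (\<rho> * Re w)"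
    using exp_orderD[OF assms(1,3)] by metis
  have "norm a \<le> 0"
  proof (rule exp_tail_limit_bound[of "\<rho> - \<kappa>" M _ _ C])
    fix x assume "x \<le> M"
    then have "norm a * exp (\<kappa> * x) \<le> C * exp (\<rho> * x)" using C[of "of_real x"] by (simp add: norm_mult)
    then show "norm a \<le> 0 + C * exp ((\<rho> - \<kappa>) * x)"
      by (simp add: exp_diff left_diff_distrib field_simps)
  qed (use assms in auto)
  then show ?thesis by simp
qed

text \<open>Multiplication by \<open>exp (- k l w)\<close>, which leaves the difference equation intact up to sign because
  \<open>l \<theta> = \<pi>\<close>, brings the orders into the range \<open>(-l, l)\<close> in which the kernel converges; the
  constant of integration then gives the exponential term.\<close>

lemma exp_order_gain:
  assumes hol: "G holomorphic_on {w. Re w < M \<and> \<bar>Im w\<bar> < \<theta> + \<delta>}"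
    and \<theta>: "\<theta> > 0" and \<delta>: "0 < \<delta>" "\<delta> \<le> \<theta>" and l: "l * \<theta> = pi"
    and \<rho>: "\<rho> \<le> \<rho>'" "\<rho>' - \<rho> < l / 2" and crit: "\<And>k::int. \<rho>' \<noteq> of_int k * l"
    and ord: "exp_order (\<theta> + \<delta>) \<rho> G"
    and diff: "exp_order \<delta> \<rho>' (\<lambda>w. G (w + \<i> * of_real \<theta>) - G (w - \<i> * of_real \<theta>))"
  shows "\<exists>a. \<exists>k::int. (a \<noteq> 0 \<longrightarrow> \<rho> \<le> of_int k * l) \<and>
           exp_order (\<theta> + \<delta>) \<rho>' (\<lambda>w. G w - a * exp (of_real (of_int k * l) * w))"
proof -
  have l0: "l > 0" using l \<theta> by (metis pi_gt_zero zero_less_mult_pos2)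
  \<comment> \<open>The multiple of \<open>l\<close> nearest to \<rho>. After the twist the old
    order lies in \<open>[- l / 2, l / 2]\<close>, and the new one below \<open>l\<close>, since the
    gain is less than \<open>l / 2\<close>.\<close>
  define k where "k = round (\<rho> / l)"
  define \<kappa> where "\<kappa> = of_int k * l"
  have "\<bar>of_int k - \<rho> / l\<bar> \<le> 1 / 2" unfolding k_def by (rule of_int_round_abs_le)
  then have "l * \<bar>of_int k - \<rho> / l\<bar> \<le> l * (1 / 2)" using l0 by (intro mult_left_mono) auto
  also have "l * \<bar>of_int k - \<rho> / l\<bar> = \<bar>\<kappa> - \<rho>\<bar>" using l0 by (simp add: \<kappa>_def abs_mult_pos' [symmetric] abs_mult [symmetric] field_simps)
  finally have \<kappa>: "\<bar>\<kappa> - \<rho>\<bar> \<le> l / 2" by simp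
  define T where "T w = G w * exp (of_real (- \<kappa>) * w)" for w
  have holT: "T holomorphic_on {w. Re w < M \<and> \<bar>Im w\<bar> < \<theta> + \<delta>}"
    unfolding T_def [abs_def] by (intro holomorphic_intros hol)
  have ordT: "exp_order (\<theta> + \<delta>) (\<rho> + (- \<kappa>)) T"
    unfolding T_def [abs_def] by (intro exp_order_mult ord exp_order_exp)
  define \<zeta> where "\<zeta> = exp (of_real (- \<kappa>) * (\<i> * of_real \<theta>))"
  have \<kappa>\<theta>: "\<kappa> * \<theta> = of_int k * pi" using l by (simp add: \<kappa>_def)
  \<comment> \<open>Because \<open>\<kappa> * \<theta> = k * pi\<close>, both translations multiply
    the twisting exponential by the same sign \<zeta>, the k-th power of -1.\<close>
  have "of_real (- \<kappa>) * (\<i> * of_real \<theta>) = \<i> * of_real (- (\<kappa> * \<theta>))" by simp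
  then have \<zeta>: "\<zeta> = cis (- (of_int k * pi))" by (simp only: \<zeta>_def cis_conv_exp \<kappa>\<theta>)
  have \<zeta>': "exp (of_real (- \<kappa>) * (- (\<i> * of_real \<theta>))) = \<zeta>"
  proof -
    have "of_real (- \<kappa>) * (- (\<i> * of_real \<theta>)) = \<i> * of_real (\<kappa> * \<theta>)" by simp
    then have "exp (of_real (- \<kappa>) * (- (\<i> * of_real \<theta>))) = cis (of_int k * pi)" by (simp only: cis_conv_exp \<kappa>\<theta>)
    then show ?thesis unfolding \<zeta> by (auto simp: complex_eq_iff sin_int_times_real mult.commute[of _ pi])
  qed
  have "T (w + \<i> * of_real \<theta>) - T (w - \<i> * of_real \<theta>) =
     \<zeta> * ((G (w + \<i> * of_real \<theta>) - G (w - \<i> * of_real \<theta>)) * exp (of_real (- \<kappa>) * w))" for w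
  proof -
    have "exp (of_real (- \<kappa>) * (w + \<i> * of_real \<theta>)) = exp (of_real (- \<kappa>) * w) * \<zeta>"
      by (simp only: distrib_left exp_add \<zeta>_def)
    moreover have "exp (of_real (- \<kappa>) * (w - \<i> * of_real \<theta>)) = exp (of_real (- \<kappa>) * w) * \<zeta>"
      by (simp only: \<zeta>' [symmetric] diff_conv_add_uminus distrib_left exp_add)
    ultimately show ?thesis by (simp add: T_def algebra_simps)
  qed
  then have diffT: "exp_order \<delta> (\<rho>' + (- \<kappa>)) (\<lambda>w. T (w + \<i> * of_real \<theta>) - T (w - \<i> * of_real \<theta>))"
    by (simp only:) (intro exp_order_cmult exp_order_mult diff exp_order_exp)
  have "exp_order (\<theta> + \<delta>) (\<rho>' + (- \<kappa>)) (deriv T)"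
    by (rule exp_order_deriv_of_difference[OF holT \<theta> \<delta> l _ _ _ ordT diffT]) (use \<kappa> \<rho> l0 in \<open>unfold abs_le_iff, linarith+\<close>)
  moreover have "\<rho>' + (- \<kappa>) \<noteq> 0" using crit[of k] by (simp add: \<kappa>_def)
  ultimately obtain a where a: "exp_order (\<theta> + \<delta>) (\<rho>' + (- \<kappa>)) (\<lambda>w. T w - a)"
    using exp_order_antiderivative[OF holT] \<theta> \<delta> by (metis add_pos_pos)
  have "exp_order (\<theta> + \<delta>) (\<rho>' + (- \<kappa>) + \<kappa>) (\<lambda>w. (T w - a) * exp (of_real \<kappa> * w))"
    by (intro exp_order_mult a exp_order_exp)
  moreover have "(T w - a) * exp (of_real \<kappa> * w) = G w - a * exp (of_real \<kappa> * w)" for w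
    by (simp add: T_def exp_minus field_simps)
  ultimately have fin: "exp_order (\<theta> + \<delta>) \<rho>' (\<lambda>w. G w - a * exp (of_real \<kappa> * w))" by simp
  \<comment> \<open>A term whose exponent is below \<rho> would contradict the known order of
    \<open>G\<close>.\<close>
  have "\<rho> \<le> \<kappa>" if "a \<noteq> 0"
  proof (rule ccontr)
    assume "\<not> \<rho> \<le> \<kappa>"
    then have "\<kappa> < \<rho>" by simp
    have "exp_order (\<theta> + \<delta>) \<rho> (\<lambda>w. G w - (G w - a * exp (of_real \<kappa> * w)))"
      by (intro exp_order_diff ord exp_order_mono[OF fin \<rho>(1)])
    then have "exp_order (\<theta> + \<delta>) \<rho> (\<lambda>w. a * exp (of_real \<kappa> * w))" by simp
    from exp_order_exp_imp_zero[OF this \<open>\<kappa> < \<rho>\<close>] \<theta> \<delta> that show False by simp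
  qed
  then show ?thesis using fin unfolding \<kappa>_def by blast
qed

section \<open>Expansion of solutions of the difference equation\<close>
text \<open>Inhomogeneous exponents have \<open>n \<ge> 1\<close>; those with \<open>n = 0\<close> come from the homogeneous
  equation and carry no logarithms.\<close>

definition lattice_exps :: "real \<Rightarrow> nat \<Rightarrow> real set" where
  "lattice_exps \<theta> d = {real n / real d + real k * (pi / \<theta>) | n k. 1 \<le> n}"

text \<open>The terms that may remain in the defect from order \<rho> on. The power \<open>j\<close>
  is unbounded for rational \<open>\<theta> / pi\<close>, since every resonance raises it.\<close>

definition tail_exps :: "real \<Rightarrow> nat \<Rightarrow> real \<Rightarrow> (real \<times> nat) set" where
  "tail_exps \<theta> d \<rho> = {(\<alpha>, j). \<alpha> \<in> lattice_exps \<theta> d \<and> \<rho> \<le> \<alpha> \<and> (\<theta> / pi \<notin> \<rat> \<longrightarrow> j = 0)}"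

definition corner_exps :: "real \<Rightarrow> nat \<Rightarrow> (real \<times> nat) set" where
  "corner_exps \<theta> d = {(\<alpha>, j). (\<alpha> \<in> lattice_exps \<theta> d \<and> (\<theta> / pi \<notin> \<rat> \<longrightarrow> j = 0)) \<or>
     (\<exists>k::nat. \<alpha> = real k * (pi / \<theta>) \<and> j = 0)}"

section \<open>Arithmetic of the exponents and resonance\<close>

lemma lattice_exps_shift:
  assumes "\<alpha> \<in> lattice_exps \<theta> d" "d > 0"
  shows "\<alpha> + real m \<in> lattice_exps \<theta> d"
proof -
  obtain n k where "\<alpha> = real n / real d + real k * (pi / \<theta>)" "1 \<le> n" using assms by (auto simp: lattice_exps_def)
  then have "\<alpha> + real m = real (n + m * d) / real d + real k * (pi / \<theta>)" "1 \<le> n + m * d"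
    using assms(2) by (auto simp: field_simps)
  then show ?thesis unfolding lattice_exps_def by blast
qed

text \<open>A homogeneous term, inserted into the true equation, leaves a defect with exponents
  raised by \<open>m \<ge> 1\<close>. Writing \<open>m = m * d / d\<close> shows these to be
  inhomogeneous exponents.\<close>

lemma lattice_exps_critical_shift:
  assumes "1 \<le> m" "d > 0"
  shows "real k * (pi / \<theta>) + real m \<in> lattice_exps \<theta> d"
proof -
  have "real k * (pi / \<theta>) + real m = real (m * d) / real d + real k * (pi / \<theta>)" "1 \<le> m * d"
    using assms by (auto simp: field_simps)
  then show ?thesis unfolding lattice_exps_def by blast
qed

text \<open>A resonance means \<open>\<alpha> * \<theta> = m * pi\<close>; with
  \<open>\<alpha> = n / d + k * pi / \<theta>\<close> it reads
  \<open>n / d * \<theta> = (m - k) * pi\<close>, and \<open>n \<ge> 1\<close> permits solving for a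
  rational value of \<open>\<theta> / pi\<close>.\<close>

lemma lattice_exps_nonresonant:
  assumes "\<alpha> \<in> lattice_exps \<theta> d" "d > 0" "\<theta> > 0" "\<theta> / pi \<notin> \<rat>" "c1 - c2 = 2 * \<i> * of_real \<theta>"
  shows "exp (of_real \<alpha> * c1) \<noteq> exp (of_real \<alpha> * c2)"
proof
  assume "exp (of_real \<alpha> * c1) = exp (of_real \<alpha> * c2)"
  then obtain m :: int where "of_real \<alpha> * c1 = of_real \<alpha> * c2 + (of_int (2 * m) * pi) * \<i>"
    unfolding exp_eq by blast
  then have "of_real \<alpha> * (c1 - c2) = (of_int (2 * m) * pi) * \<i>" by (simp add: algebra_simps)
  then have "Im (of_real \<alpha> * (c1 - c2)) = Im ((of_int (2 * m) * pi) * \<i>)" by (rule arg_cong)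
  then have 1: "\<alpha> * \<theta> = of_int m * pi" unfolding assms(5) by simp
  obtain n k where a: "\<alpha> = real n / real d + real k * (pi / \<theta>)" "1 \<le> n" using assms by (auto simp: lattice_exps_def)
  have "\<alpha> = of_int m * (pi / \<theta>)" using 1 assms(3) by (simp add: field_simps)
  then have "real n / real d = of_int m * (pi / \<theta>) - real k * (pi / \<theta>)" using a(1) by linarith
  then have "real n / real d = (of_int m - real k) * (pi / \<theta>)" by (simp only: left_diff_distrib)
  then have "real n / real d * \<theta> = (of_int m - real k) * pi" using assms(3) by simp
  then have "\<theta> / pi = (of_int m - real k) * real d / real n"
    using a(2) assms(2) by (simp add: field_simps)
  also have "\<dots> \<in> \<rat>" by (intro Rats_divide Rats_mult Rats_diff) auto
  finally show False using assms(4) by simp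
qed

lemma explog_solve:
  assumes "L \<in> explog (tail_exps \<theta> d \<rho>)" "d > 0" "\<theta> > 0" "c1 - c2 = 2 * \<i> * of_real \<theta>"
  shows "\<exists>X \<in> explog (tail_exps \<theta> d \<rho>). \<forall>w. X (w + c1) - X (w + c2) = L w"
  using assms(1)
proof (induction rule: explog.induct)
  case zero
  then show ?case using explog.zero by (intro bexI[of _ "\<lambda>_. 0"]) auto
next
  case (add L \<alpha> j c)
  then obtain X where X: "X \<in> explog (tail_exps \<theta> d \<rho>)" "\<And>w. X (w + c1) - X (w + c2) = L w" by blast
  have "c1 - c2 \<noteq> 0" using assms(3,4) by simp
  from explog_solve_term[OF this, of \<alpha> j] obtain Z where
    Z: "Z \<in> explog (if exp (of_real \<alpha> * c1) = exp (of_real \<alpha> * c2) then {\<alpha>} \<times> UNIV else {\<alpha>} \<times> {..j})"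
      "\<And>w. Z (w + c1) - Z (w + c2) = w ^ j * exp (of_real \<alpha> * w)" by blast
  have "Z \<in> explog (tail_exps \<theta> d \<rho>)"
    using Z(1) by (rule explog_mono)
      (use add.hyps(2) lattice_exps_nonresonant[of \<alpha> \<theta> d c1 c2] assms in \<open>auto simp: tail_exps_def\<close>)
  then have "(\<lambda>w. X w + c * Z w) \<in> explog (tail_exps \<theta> d \<rho>)" by (intro explog_add explog_cmult X)
  moreover have "X (w + c1) + c * Z (w + c1) - (X (w + c2) + c * Z (w + c2)) = L w + c * (w ^ j * exp (of_real \<alpha> * w))" for w
    using X(2)[of w, symmetric] Z(2)[of w, symmetric] by (simp only:) (simp add: algebra_simps)
  ultimately show ?case by (intro bexI[of _ "\<lambda>w. X w + c * Z w"]) auto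
qed

text \<open>The strip of \<open>F\<close> exceeds \<open>\<bar>Im w\<bar> \<le> \<theta>\<close> by
  \<delta>, because \<open>B1\<close> and \<open>B2\<close> carry the thin strip
  \<open>\<bar>Im s\<bar> < \<delta>\<close> to neighbourhoods of its two edges. The real shift
  \<open>c0\<close> is common to both; \<open>growth\<close> is the only estimate known in
  advance.\<close>

locale corner_difference_equation =
  fixes F :: "complex \<Rightarrow> complex" and M \<theta> \<delta> c0 r :: real and d :: nat
    and B1 B2 K :: "complex \<Rightarrow> complex"
  assumes hol: "F holomorphic_on {w. Re w < M \<and> \<bar>Im w\<bar> < \<theta> + \<delta>}"
    and \<theta>: "\<theta> > 0" and \<delta>: "0 < \<delta>" "\<delta> \<le> \<theta>" and d: "d > 0"
    and B1: "near_trans (of_real c0 + \<i> * of_real \<theta>) B1" and B2: "near_trans (of_real c0 - \<i> * of_real \<theta>) B2"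
    and K: "K holomorphic_on ball 0 r" "r > 0" "K 0 = 0"
    and eq: "\<exists>M'. \<forall>s. Re s \<le> M' \<longrightarrow> \<bar>Im s\<bar> < \<delta> \<longrightarrow> F (B1 s) - F (B2 s) = K (exp (s / of_nat d))"
    and growth: "\<And>\<epsilon>. \<epsilon> > 0 \<Longrightarrow> exp_order (\<theta> + \<delta>) (- \<epsilon>) F"
begin

text \<open>\<open>P\<close> approximates \<open>F\<close> below order \<open>\<rho>\<close>, and \<open>L\<close> is the explicit part of the defect of \<open>P\<close> in the
  equation, known up to order \<open>R\<close>.\<close>

definition partial_solution :: "real \<Rightarrow> real \<Rightarrow> (complex \<Rightarrow> complex) \<Rightarrow> (complex \<Rightarrow> complex) \<Rightarrow> bool" where
  "partial_solution R \<rho> P L \<longleftrightarrow> P \<in> explog (corner_exps \<theta> d) \<and> L \<in> explog (tail_exps \<theta> d \<rho>) \<and>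
     (\<forall>\<sigma><\<rho>. exp_order (\<theta> + \<delta>) \<sigma> (\<lambda>w. F w - P w)) \<and>
     exp_order \<delta> R (\<lambda>s. K (exp (s / of_nat d)) - (P (B1 s) - P (B2 s)) - L s)"

text \<open>Start with \<open>P = 0\<close>, so that the defect is \<open>K\<close> itself. Since
  \<open>K 0 = 0\<close>, its Taylor polynomial has only exponents \<open>n / d\<close> with
  \<open>n \<ge> 1\<close>, as the lattice requires.\<close>

lemma partial_solution_0:
  assumes "R \<ge> 0"
  shows "\<exists>P L. partial_solution R 0 P L"
proof -
  define N where "N = Suc (nat \<lceil>R * d\<rceil>)"
  have N: "R \<le> real N / d"
  proof -
    have "R * d \<le> real N" unfolding N_def by linarith
    then show ?thesis using d by (simp add: field_simps)
  qed
  obtain a where a: "a 0 = 0" "\<And>Y. exp_order Y (real N / real d)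
           (\<lambda>s. K (exp (s / of_real (real d))) - (\<Sum>k<N. a k * exp (of_real (real k / real d) * s)))"
    using exp_order_taylor[OF K(1,2), of "real d" N] K(3) d by (auto simp: N_def)
  define L where "L s = (\<Sum>k<N. a k * (s ^ 0 * exp (of_real (real k / real d) * s)))" for s :: complex
  have "L \<in> explog (tail_exps \<theta> d 0)"
    unfolding L_def [abs_def]
  proof (rule explog_sum)
    fix k assume "k \<in> {..<N}"
    show "(\<lambda>s. a k * (s ^ 0 * exp (of_real (real k / real d) * s))) \<in> explog (tail_exps \<theta> d 0)"
    proof (cases "k = 0")
      case True
      then show ?thesis using a(1) explog.zero by simp
    next
      case False
      then have "real k / real d \<in> lattice_exps \<theta> d"
        unfolding lattice_exps_def by (intro CollectI exI[of _ k] exI[of _ 0]) auto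
      then show ?thesis by (intro explog_term) (auto simp: tail_exps_def)
    qed
  qed
  moreover have "exp_order \<delta> R (\<lambda>s. K (exp (s / of_nat d)) - L s)"
    using exp_order_mono[OF a(2) N] by (simp add: L_def)
  ultimately have "partial_solution R 0 (\<lambda>_. 0) L"
    unfolding partial_solution_def using growth[of "- _"] explog.zero by auto
  then show ?thesis by blast
qed

text \<open>Solve the translation equation for the explicit defect \<open>L\<close> and add the
  solution \<open>X\<close> to \<open>P\<close>. What then remains of \<open>L\<close> is the
  discrepancy between near translation and translation, whose exponents are higher by at least one.
  The order of \<open>F - P\<close> is not yet improved.\<close>

lemma partial_solution_correction:
  assumes "partial_solution R \<rho> P L"
  shows "\<exists>P' L'. P' \<in> explog (corner_exps \<theta> d) \<and> L' \<in> explog (tail_exps \<theta> d (\<rho> + 1)) \<and>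
     (\<forall>\<sigma><\<rho>. exp_order (\<theta> + \<delta>) \<sigma> (\<lambda>w. F w - P' w)) \<and>
     exp_order \<delta> R (\<lambda>s. K (exp (s / of_nat d)) - (P' (B1 s) - P' (B2 s)) - L' s)"
proof -
  from assms have S: "P \<in> explog (corner_exps \<theta> d)" "L \<in> explog (tail_exps \<theta> d \<rho>)"
    "\<And>\<sigma>. \<sigma> < \<rho> \<Longrightarrow> exp_order (\<theta> + \<delta>) \<sigma> (\<lambda>w. F w - P w)"
    "exp_order \<delta> R (\<lambda>s. K (exp (s / of_nat d)) - (P (B1 s) - P (B2 s)) - L s)"
    unfolding partial_solution_def by auto
  define c1 where "c1 = of_real c0 + \<i> * of_real \<theta>"
  define c2 where "c2 = of_real c0 - \<i> * of_real \<theta>"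
  have "c1 - c2 = 2 * \<i> * of_real \<theta>" by (simp add: c1_def c2_def)
  then obtain X where X: "X \<in> explog (tail_exps \<theta> d \<rho>)" "\<And>w. X (w + c1) - X (w + c2) = L w"
    using explog_solve[of L \<theta> d \<rho> c1 c2] S d \<theta> by blast
  let ?V = "{(\<alpha> + real k, i) | \<alpha> k i. 1 \<le> k \<and> (\<exists>j\<ge>i. (\<alpha>, j) \<in> tail_exps \<theta> d \<rho>)}"
  obtain Z1 where Z1: "Z1 \<in> explog ?V" "\<And>Y. exp_order Y R (\<lambda>s. X (B1 s) - X (s + c1) - Z1 s)"
    using explog_near_trans[OF B1 X(1), of R] unfolding c1_def by blast
  obtain Z2 where Z2: "Z2 \<in> explog ?V" "\<And>Y. exp_order Y R (\<lambda>s. X (B2 s) - X (s + c2) - Z2 s)"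
    using explog_near_trans[OF B2 X(1), of R] unfolding c2_def by blast
  have V: "?V \<subseteq> tail_exps \<theta> d (\<rho> + 1)"
    using d lattice_exps_shift by (auto simp: tail_exps_def)
  define L' where "L' s = - (1::complex) * (Z1 s - Z2 s)" for s
  have L': "L' \<in> explog (tail_exps \<theta> d (\<rho> + 1))"
    unfolding L'_def [abs_def]
    by (rule explog_cmult, rule explog_diff) (rule explog_mono[OF _ V], rule Z1 Z2)+
  have sub: "tail_exps \<theta> d \<rho> \<subseteq> corner_exps \<theta> d" by (auto simp: tail_exps_def corner_exps_def)
  have 1: "(\<lambda>w. P w + X w) \<in> explog (corner_exps \<theta> d)"
    using S by (intro explog_add explog_mono[OF X(1) sub]) auto
  have 2: "exp_order (\<theta> + \<delta>) \<sigma> (\<lambda>w. F w - (P w + X w))" if "\<sigma> < \<rho>" for \<sigma>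
  proof -
    have "exp_order (\<theta> + \<delta>) \<sigma> (\<lambda>w. (F w - P w) - X w)"
      by (rule exp_order_diff[OF S(3)[OF that] exp_order_explog[OF X(1)]]) (use that in \<open>auto simp: tail_exps_def\<close>)
    then show ?thesis by (simp add: diff_diff_eq)
  qed
  have "exp_order \<delta> R (\<lambda>s. (K (exp (s / of_nat d)) - (P (B1 s) - P (B2 s)) - L s) -
      ((X (B1 s) - X (s + c1) - Z1 s) - (X (B2 s) - X (s + c2) - Z2 s)))"
    by (rule exp_order_diff[OF S(4) exp_order_diff[OF Z1(2) Z2(2)]])
  moreover have "(K (exp (s / of_nat d)) - (P (B1 s) - P (B2 s)) - L s) -
      ((X (B1 s) - X (s + c1) - Z1 s) - (X (B2 s) - X (s + c2) - Z2 s)) =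
      K (exp (s / of_nat d)) - ((P (B1 s) + X (B1 s)) - (P (B2 s) + X (B2 s))) - L' s" for s
    using X(2)[of s, symmetric] by (simp only:) (simp add: L'_def algebra_simps)
  ultimately have 3: "exp_order \<delta> R (\<lambda>s. K (exp (s / of_nat d)) - ((P (B1 s) + X (B1 s)) - (P (B2 s) + X (B2 s))) - L' s)"
    by simp
  show ?thesis using 1 2 3 L' by (intro exI[of _ "\<lambda>w. P w + X w"] exI[of _ L'] conjI) auto
qed

text \<open>The remainder \<open>E = F - P\<close> satisfies the true equation up to order \<sigma>.
  Passing from \<open>B1\<close>, \<open>B2\<close> to translations changes each value of
  \<open>E\<close> by one order more than that of \<open>E\<close>, and a real shift by
  \<open>- c0\<close> centres the result.\<close>

lemma translation_difference_order:
  assumes P: "P \<in> explog V" and L: "L \<in> explog (tail_exps \<theta> d (\<rho> + 1))"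
    and ord: "\<forall>\<sigma><\<rho>. exp_order (\<theta> + \<delta>) \<sigma> (\<lambda>w. F w - P w)"
    and rem: "exp_order \<delta> R (\<lambda>s. K (exp (s / of_nat d)) - (P (B1 s) - P (B2 s)) - L s)"
    and \<sigma>: "\<sigma> < \<rho> + 1" "\<sigma> \<le> R"
  shows "exp_order \<delta> \<sigma> (\<lambda>w. (F (w + \<i> * of_real \<theta>) - P (w + \<i> * of_real \<theta>)) - (F (w - \<i> * of_real \<theta>) - P (w - \<i> * of_real \<theta>)))"
proof -
  define E where "E w = F w - P w" for w
  have holE: "E holomorphic_on {w. Re w < M \<and> \<bar>Im w\<bar> < \<theta> + \<delta>}"
    unfolding E_def [abs_def] by (intro holomorphic_intros hol explog_holomorphic[OF P])
  have ordE: "exp_order (\<theta> + \<delta>) (\<sigma> - 1) E" unfolding E_def [abs_def] using ord \<sigma> by auto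
  have e1: "exp_order \<delta> (\<sigma> - 1 + 1) (\<lambda>s. E (B1 s) - E (s + (of_real c0 + \<i> * of_real \<theta>)))"
    by (rule exp_order_near_trans_diff[OF holE ordE B1]) (use \<theta> in auto)
  have e2: "exp_order \<delta> (\<sigma> - 1 + 1) (\<lambda>s. E (B2 s) - E (s + (of_real c0 - \<i> * of_real \<theta>)))"
    by (rule exp_order_near_trans_diff[OF holE ordE B2]) (use \<theta> in auto)
  obtain M' where M': "\<And>s. Re s \<le> M' \<Longrightarrow> \<bar>Im s\<bar> < \<delta> \<Longrightarrow> F (B1 s) - F (B2 s) = K (exp (s / of_nat d))"
    using eq by blast
  have "exp_order \<delta> \<sigma> (\<lambda>s. (K (exp (s / of_nat d)) - (P (B1 s) - P (B2 s)) - L s) + L s)"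
    by (intro exp_order_add exp_order_mono[OF rem \<sigma>(2)] exp_order_explog[OF L]) (use \<sigma> in \<open>auto simp: tail_exps_def\<close>)
  then have e3: "exp_order \<delta> \<sigma> (\<lambda>s. E (B1 s) - E (B2 s))"
    by (rule exp_order_cong_ev[where M = M']) (use M' in \<open>auto simp: E_def algebra_simps\<close>)
  have "exp_order \<delta> \<sigma> (\<lambda>s. (E (B1 s) - E (B2 s)) - ((E (B1 s) - E (s + (of_real c0 + \<i> * of_real \<theta>))) - (E (B2 s) - E (s + (of_real c0 - \<i> * of_real \<theta>)))))"
    using exp_order_diff[OF e3 exp_order_diff[OF e1[simplified] e2[simplified]]] by simp
  then have "exp_order \<delta> \<sigma> (\<lambda>s. E (s + of_real c0 + \<i> * of_real \<theta>) - E (s + of_real c0 - \<i> * of_real \<theta>))"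
    by (simp add: algebra_simps)
  from exp_order_shift_real[OF this, of "- c0"] show ?thesis by (simp add: E_def)
qed

text \<open>The bounds on \<eta> serve two purposes. With
  \<open>\<eta> \<le> pi / \<theta> / 8\<close> the passage from order
  \<open>\<rho> - \<eta>\<close> to an order below \<open>\<rho> + 2 * \<eta>\<close> stays within
  the range \<open>l / 2\<close> of \<open>exp_order_gain\<close>. With
  \<open>\<eta> \<le> 1/4\<close> the terms produced by the new homogeneous summand, of exponent at
  least \<open>\<rho> - \<eta> + 1\<close>, do not fall below
  \<open>\<rho> + \<eta>\<close>.\<close>

lemma partial_solution_step:
  assumes S: "partial_solution R \<rho> P L" and \<rho>: "\<rho> \<ge> 0" and \<eta>: "0 < \<eta>" "\<eta> \<le> 1/4" "\<eta> \<le> pi / \<theta> / 8" "\<rho> + 2 * \<eta> \<le> R"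
  shows "\<exists>P L. partial_solution R (\<rho> + \<eta>) P L"
proof -
  define l where "l = pi / \<theta>"
  have l: "l > 0" "l * \<theta> = pi" using \<theta> by (auto simp: l_def)
  obtain P' L' where P': "P' \<in> explog (corner_exps \<theta> d)" "L' \<in> explog (tail_exps \<theta> d (\<rho> + 1))"
     "\<forall>\<sigma><\<rho>. exp_order (\<theta> + \<delta>) \<sigma> (\<lambda>w. F w - P' w)"
     "exp_order \<delta> R (\<lambda>s. K (exp (s / of_nat d)) - (P' (B1 s) - P' (B2 s)) - L' s)"
    using partial_solution_correction[OF S] by blast
  \<comment> \<open>The target order must avoid the countably many multiples of \<open>l\<close>, at
    which integration of the derivative fails.\<close>
  have "uncountable {\<rho> + \<eta><..<\<rho> + 2 * \<eta>}" using \<eta> by (simp add: uncountable_open_interval)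
  moreover have "countable (range (\<lambda>k::int. of_int k * l))" by simp
  ultimately have "\<not> {\<rho> + \<eta><..<\<rho> + 2 * \<eta>} \<subseteq> range (\<lambda>k::int. of_int k * l)"
    using countable_subset by blast
  then obtain \<rho>' where "\<rho>' \<in> {\<rho> + \<eta><..<\<rho> + 2 * \<eta>}" "\<rho>' \<notin> range (\<lambda>k::int. of_int k * l)" by blast
  then have \<rho>': "\<rho> + \<eta> < \<rho>'" "\<rho>' < \<rho> + 2 * \<eta>" "\<And>k::int. \<rho>' \<noteq> of_int k * l" by auto
  define E where "E w = F w - P' w" for w
  have holE: "E holomorphic_on {w. Re w < M \<and> \<bar>Im w\<bar> < \<theta> + \<delta>}"
    unfolding E_def [abs_def] by (intro holomorphic_intros hol explog_holomorphic[OF P'(1)])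
  have ordE: "exp_order (\<theta> + \<delta>) (\<rho> - \<eta>) E" unfolding E_def [abs_def] using P'(3) \<eta> by auto
  have diffE: "exp_order \<delta> \<rho>' (\<lambda>w. E (w + \<i> * of_real \<theta>) - E (w - \<i> * of_real \<theta>))"
    unfolding E_def [abs_def] by (rule translation_difference_order[OF P'(1,2,3,4)]) (use \<rho>' \<eta> in auto)
  obtain a and k :: int where a: "a \<noteq> 0 \<Longrightarrow> \<rho> - \<eta> \<le> of_int k * l"
      "exp_order (\<theta> + \<delta>) \<rho>' (\<lambda>w. E w - a * exp (of_real (of_int k * l) * w))"
    using exp_order_gain[OF holE \<theta> \<delta> l(2) _ _ \<rho>'(3) ordE diffE] \<rho>' \<eta> l by (auto simp: l_def)
  \<comment> \<open>The homogeneous summand found by the gain. It solves the translation equation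
    exactly, but the equation with \<open>B1\<close> and \<open>B2\<close> only up to terms one
    order higher, which enter the new defect.\<close>
  define Q where "Q w = a * (w ^ 0 * exp (of_real (of_int k * l) * w))" for w :: complex
  have "\<exists>Z\<in>explog (tail_exps \<theta> d (\<rho> + \<eta>)). exp_order \<delta> R (\<lambda>s. (Q (B1 s) - Q (B2 s)) - Z s) \<and> Q \<in> explog (corner_exps \<theta> d)"
  proof (cases "a = 0")
    case True
    then have "Q = (\<lambda>_. 0)" by (auto simp: Q_def)
    then show ?thesis using explog.zero exp_order_zero by (intro bexI[of _ "\<lambda>_. 0"]) auto
  next
    case False
    \<comment> \<open>A negative \<open>k\<close> would give an exponent at most \<open>- l\<close>,
      below \<open>\<rho> - \<eta>\<close> because \<open>\<rho> \<ge> 0\<close> and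
      \<open>\<eta> \<le> l / 8\<close>.\<close>
    have "k \<ge> 0"
    proof (rule ccontr)
      assume "\<not> k \<ge> 0"
      then have "of_int k \<le> (-1::real)" by linarith
      then have "of_int k * l \<le> - 1 * l" using l by (intro mult_right_mono) auto
      moreover have "\<eta> \<le> l / 8" using \<eta> by (simp add: l_def)
      ultimately show False using a(1)[OF False] \<rho> l by linarith
    qed
    then obtain k' :: nat where k': "k = int k'" using nonneg_int_cases by blast
    let ?V = "{(real k' * l, 0::nat)}"
    have QV: "Q \<in> explog ?V" unfolding Q_def [abs_def] k' by (rule explog_term) simp
    let ?W = "{(\<alpha> + real k, i) | \<alpha> k i. 1 \<le> k \<and> (\<exists>j\<ge>i. (\<alpha>, j) \<in> ?V)}"
    have W: "?W \<subseteq> tail_exps \<theta> d (\<rho> + \<eta>)"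
      using lattice_exps_critical_shift[OF _ d, of _ k' \<theta>] a(1)[OF False] \<eta>
      by (auto simp: tail_exps_def l_def k')
    obtain Z1 where Z1: "Z1 \<in> explog ?W" "\<And>Y. exp_order Y R (\<lambda>s. Q (B1 s) - Q (s + (of_real c0 + \<i> * of_real \<theta>)) - Z1 s)"
      using explog_near_trans[OF B1 QV, of R] by blast
    obtain Z2 where Z2: "Z2 \<in> explog ?W" "\<And>Y. exp_order Y R (\<lambda>s. Q (B2 s) - Q (s + (of_real c0 - \<i> * of_real \<theta>)) - Z2 s)"
      using explog_near_trans[OF B2 QV, of R] by blast
    have per: "Q (s + (of_real c0 + \<i> * of_real \<theta>)) = Q (s + (of_real c0 - \<i> * of_real \<theta>))" for s
    proof -
      have "of_real (of_int k * l) * (s + (of_real c0 + \<i> * of_real \<theta>)) =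
        of_real (of_int k * l) * (s + (of_real c0 - \<i> * of_real \<theta>)) + of_int (2 * k) * (\<i> * of_real (l * \<theta>))"
        by (simp add: algebra_simps)
      also have "of_int (2 * k) * (\<i> * of_real (l * \<theta>)) = (of_int (2 * k) * pi) * \<i>" unfolding l(2) by simp
      finally have "exp (of_real (of_int k * l) * (s + (of_real c0 + \<i> * of_real \<theta>))) =
        exp (of_real (of_int k * l) * (s + (of_real c0 - \<i> * of_real \<theta>)))"
        unfolding exp_eq by blast
      then show ?thesis by (simp only: Q_def power_0)
    qed
    have "exp_order \<delta> R (\<lambda>s. (Q (B1 s) - Q (s + (of_real c0 + \<i> * of_real \<theta>)) - Z1 s) - (Q (B2 s) - Q (s + (of_real c0 - \<i> * of_real \<theta>)) - Z2 s))"
      by (intro exp_order_diff Z1 Z2)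
    then have "exp_order \<delta> R (\<lambda>s. (Q (B1 s) - Q (B2 s)) - (Z1 s - Z2 s))"
      by (simp add: per algebra_simps)
    moreover have "(\<lambda>s. Z1 s - Z2 s) \<in> explog (tail_exps \<theta> d (\<rho> + \<eta>))"
      by (intro explog_diff explog_mono[OF _ W] Z1 Z2)
    moreover have "Q \<in> explog (corner_exps \<theta> d)"
      by (rule explog_mono[OF QV]) (auto simp: corner_exps_def l_def)
    ultimately show ?thesis by (intro bexI[of _ "\<lambda>s. Z1 s - Z2 s"] conjI)
  qed
  then obtain Z where Z: "Z \<in> explog (tail_exps \<theta> d (\<rho> + \<eta>))" "exp_order \<delta> R (\<lambda>s. (Q (B1 s) - Q (B2 s)) - Z s)"
     "Q \<in> explog (corner_exps \<theta> d)" by blast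
  have sub: "tail_exps \<theta> d (\<rho> + 1) \<subseteq> tail_exps \<theta> d (\<rho> + \<eta>)" using \<eta> by (auto simp: tail_exps_def)
  have "partial_solution R (\<rho> + \<eta>) (\<lambda>w. P' w + Q w) (\<lambda>s. L' s - Z s)"
    unfolding partial_solution_def
  proof (intro conjI allI impI)
    show "(\<lambda>w. P' w + Q w) \<in> explog (corner_exps \<theta> d)" by (intro explog_add P' Z)
    show "(\<lambda>s. L' s - Z s) \<in> explog (tail_exps \<theta> d (\<rho> + \<eta>))" by (intro explog_diff Z explog_mono[OF P'(2) sub])
    fix \<sigma> assume "\<sigma> < \<rho> + \<eta>"
    then show "exp_order (\<theta> + \<delta>) \<sigma> (\<lambda>w. F w - (P' w + Q w))"
      using exp_order_mono[OF a(2), of \<sigma>] \<rho>' by (simp add: E_def Q_def diff_diff_eq)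
  next
    have "exp_order \<delta> R (\<lambda>s. (K (exp (s / of_nat d)) - (P' (B1 s) - P' (B2 s)) - L' s) - ((Q (B1 s) - Q (B2 s)) - Z s))"
      by (intro exp_order_diff P' Z)
    then show "exp_order \<delta> R (\<lambda>s. K (exp (s / of_nat d)) - (P' (B1 s) + Q (B1 s) - (P' (B2 s) + Q (B2 s))) - (L' s - Z s))"
      by (simp add: algebra_simps)
  qed
  then show ?thesis by blast
qed

text \<open>Finitely many steps of fixed length \<eta>, with the defect tracked up to one order
  \<open>R'\<close> chosen at the outset.\<close>

theorem expansion:
  "\<exists>P \<in> explog (corner_exps \<theta> d). exp_order (\<theta> + \<delta>) R (\<lambda>w. F w - P w)"
proof -
  define \<eta> where "\<eta> = min (1/4) (pi / \<theta> / 8)"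
  have \<eta>: "0 < \<eta>" "\<eta> \<le> 1/4" "\<eta> \<le> pi / \<theta> / 8" using \<theta> by (auto simp: \<eta>_def)
  obtain N :: nat where N: "R < real N * \<eta>" using reals_Archimedean3[OF \<eta>(1)] by blast
  \<comment> \<open>The summand 2 provides the room \<open>\<rho> + 2 * \<eta> \<le> R'\<close> that
    each step requires.\<close>
  define R' where "R' = (real N + 2) * \<eta>"
  have "R' \<ge> 0" using \<eta> by (simp add: R'_def)
  have "\<exists>P L. partial_solution R' (real n * \<eta>) P L" if "n \<le> N" for n
    using that
  proof (induction n)
    case 0
    then show ?case using partial_solution_0[OF \<open>R' \<ge> 0\<close>] by simp
  next
    case (Suc n)
    then obtain P L where "partial_solution R' (real n * \<eta>) P L" by auto
    moreover have "(real n + 2) * \<eta> \<le> R'" unfolding R'_def using Suc.prems \<eta> by (intro mult_right_mono) auto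
    ultimately have "\<exists>P L. partial_solution R' (real n * \<eta> + \<eta>) P L"
      using \<eta> by (intro partial_solution_step) (auto simp: algebra_simps)
    then show ?case by (simp add: algebra_simps)
  qed
  then obtain P L where "partial_solution R' (real N * \<eta>) P L" by blast
  then show ?thesis using N unfolding partial_solution_def by blast
qed

end

section \<open>Reflection of a holomorphic function with vanishing real part\<close>
text \<open>\<open>exp (f / B)\<close> has modulus between \<open>exp (- 1)\<close> and
  \<open>exp 1\<close>. Cauchy's inequality bounds its derivative from above, and the lower bound on
  the modulus transfers this to \<open>f\<close>.\<close>

lemma deriv_bound_of_Re_bounded:
  assumes hol: "f holomorphic_on ball z r" and r: "r > 0" and B: "B > 0" "\<And>w. w \<in> ball z r \<Longrightarrow> \<bar>Re (f w)\<bar> \<le> B"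
  shows "norm (deriv f z) \<le> 2 * exp 2 * B / r"
proof -
  define g where "g w = exp (f w / of_real B)" for w
  have holg: "g holomorphic_on ball z r" unfolding g_def [abs_def] by (intro holomorphic_intros hol) (use B in auto)
  have "norm ((deriv ^^ 1) g z) \<le> fact 1 * exp 1 / (r / 2) ^ 1"
  proof (rule Cauchy_inequality)
    show "g holomorphic_on ball z (r / 2)" using r by (intro holomorphic_on_subset[OF holg]) auto
    show "continuous_on (cball z (r / 2)) g"
      using r by (intro continuous_on_subset[OF holomorphic_on_imp_continuous_on[OF holg]]) auto
    fix x assume "norm (z - x) = r / 2"
    then have "Re (f x) \<le> B" using B(2)[of x] r by (auto simp: dist_norm)
    then show "norm (g x) \<le> exp 1" using B by (simp add: g_def Re_divide_of_real field_simps)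
  qed (use r in auto)
  then have 1: "norm (deriv g z) \<le> 2 * exp 1 / r" by (simp add: field_simps)
  have "(f has_field_derivative deriv f z) (at z)" using r by (intro holomorphic_derivI[OF hol]) auto
  then have "(g has_field_derivative g z * (deriv f z / of_real B)) (at z)"
    unfolding g_def [abs_def] using B by (auto intro!: derivative_eq_intros)
  then have 2: "deriv g z = g z * (deriv f z / of_real B)" by (rule DERIV_imp_deriv)
  have "- B \<le> Re (f z)" using B(2)[of z] r by (auto simp: abs_le_iff)
  then have 3: "exp (- 1) \<le> norm (g z)" using B by (simp add: g_def Re_divide_of_real field_simps)
  have "exp (- 1) * norm (deriv f z) / B \<le> norm (g z) * norm (deriv f z) / B"
    using B 3 by (intro divide_right_mono mult_right_mono) auto
  also have "\<dots> = norm (deriv g z)" using B by (simp add: 2 norm_mult norm_divide)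
  also note 1
  finally have "exp (- 1) * norm (deriv f z) / B \<le> 2 * exp 1 / r" .
  then have "exp 1 * (exp (- 1) * norm (deriv f z) / B) \<le> exp 1 * (2 * exp 1 / r)" by (rule mult_left_mono) simp
  then have "norm (deriv f z) / B \<le> 2 * (exp 1 * exp 1) / r" by (simp add: exp_minus field_simps)
  then show ?thesis using B r by (simp add: exp_add [symmetric] field_simps)
qed

text \<open>A derivative of size \<open>C / t\<close> gives logarithmic growth; enlarging it to a
  multiple of \<open>1 / (t * sqrt t)\<close> gives a bound by \<open>1 / sqrt y\<close> instead,
  still integrable at 0 and free of logarithms.\<close>

lemma vertical_growth_bound:
  assumes der: "\<And>t. 0 < t \<Longrightarrow> t \<le> y0 \<Longrightarrow> (G has_field_derivative G' t) (at (Complex x t))"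
    and C: "\<And>t. 0 < t \<Longrightarrow> t \<le> y0 \<Longrightarrow> norm (G' t) \<le> C / t" "C \<ge> 0"
    and y: "0 < y" "y \<le> y0"
  shows "norm (G (Complex x y)) \<le> (norm (G (Complex x y0)) + 2 * C) * sqrt y0 / sqrt y"
proof -
  have "norm (G (Complex x y0) - G (Complex x y)) \<le> 2 * C * sqrt y0 / sqrt y"
  proof (cases "y = y0")
    case True
    then show ?thesis using C y by simp
  next
    case False
    then have yy: "y < y0" using y by simp
    define \<phi> where "\<phi> t = - 2 * C * sqrt y0 / sqrt t" for t
    have gd: "((\<lambda>t. G (Complex x t)) has_vector_derivative \<i> * G' t) (at t)" if "0 < t" "t \<le> y0" for t
    proof -
      have "((\<lambda>t. Complex x t) has_vector_derivative \<i>) (at t)"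
        unfolding Complex_eq by (auto intro!: derivative_eq_intros)
      from field_vector_diff_chain_at[OF this der[OF that]] show ?thesis by (simp add: o_def mult.commute)
    qed
    have pd: "(\<phi> has_vector_derivative C * sqrt y0 / (t * sqrt t)) (at t)" if "0 < t" for t
      unfolding \<phi>_def using that
      by (auto intro!: derivative_eq_intros simp: has_real_derivative_iff_has_vector_derivative [symmetric] field_simps)
    have "norm (G (Complex x y0) - G (Complex x y)) \<le> \<phi> y0 - \<phi> y"
    proof (rule differentiable_bound_general[OF yy, of "\<lambda>t. G (Complex x t)" \<phi> "\<lambda>t. \<i> * G' t" "\<lambda>t. C * sqrt y0 / (t * sqrt t)"])
      show "continuous_on {y..y0} (\<lambda>t. G (Complex x t))"
        using y by (intro continuous_at_imp_continuous_on) (auto intro!: has_vector_derivative_continuous gd)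
      show "continuous_on {y..y0} \<phi>"
        using y by (intro continuous_at_imp_continuous_on) (auto intro!: has_vector_derivative_continuous pd)
      fix t assume t: "y < t" "t < y0"
      then show "((\<lambda>t. G (Complex x t)) has_vector_derivative \<i> * G' t) (at t)" "(\<phi> has_vector_derivative C * sqrt y0 / (t * sqrt t)) (at t)"
        using y gd pd by auto
      have "norm (\<i> * G' t) \<le> C / t * 1" using C(1)[of t] t y by (simp add: norm_mult)
      also have "\<dots> \<le> C / t * (sqrt y0 / sqrt t)" using t y C by (intro mult_left_mono) auto
      finally show "norm (\<i> * G' t) \<le> C * sqrt y0 / (t * sqrt t)" by simp
    qed
    also have "\<dots> \<le> 2 * C * sqrt y0 / sqrt y" using C y by (simp add: \<phi>_def)
    finally show ?thesis .
  qed
  then have "norm (G (Complex x y)) \<le> norm (G (Complex x y0)) * 1 + 2 * C * sqrt y0 / sqrt y"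
    using norm_triangle_sub[of "G (Complex x y)" "G (Complex x y0)"] by (simp add: norm_minus_commute)
  also have "norm (G (Complex x y0)) * 1 \<le> norm (G (Complex x y0)) * (sqrt y0 / sqrt y)"
    using y by (intro mult_left_mono) auto
  finally show ?thesis by (simp add: algebra_simps add_divide_distrib)
qed

text \<open>Since \<open>1 / sqrt t\<close> is integrable at 0, the primitive is Hoelder continuous
  up to the edge even if its derivative is unbounded there.\<close>

lemma vertical_primitive_bound:
  assumes der: "\<And>t. 0 < t \<Longrightarrow> t \<le> y0 \<Longrightarrow> (F has_field_derivative G t) (at (Complex x t))"
    and K: "\<And>t. 0 < t \<Longrightarrow> t \<le> y0 \<Longrightarrow> norm (G t) \<le> K / sqrt t" "K \<ge> 0"
    and y: "0 < y1" "y1 \<le> y2" "y2 \<le> y0"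
  shows "norm (F (Complex x y2) - F (Complex x y1)) \<le> 2 * K * (sqrt y2 - sqrt y1)"
proof (cases "y1 = y2")
  case False
  then have yy: "y1 < y2" using y by simp
  have gd: "((\<lambda>t. F (Complex x t)) has_vector_derivative \<i> * G t) (at t)" if "0 < t" "t \<le> y0" for t
  proof -
    have "((\<lambda>t. Complex x t) has_vector_derivative \<i>) (at t)"
      unfolding Complex_eq by (auto intro!: derivative_eq_intros)
    from field_vector_diff_chain_at[OF this der[OF that]] show ?thesis by (simp add: o_def mult.commute)
  qed
  have pd: "((\<lambda>t. 2 * K * sqrt t) has_vector_derivative K / sqrt t) (at t)" if "0 < t" for t
    using that by (auto intro!: derivative_eq_intros simp: has_real_derivative_iff_has_vector_derivative [symmetric] field_simps)
  have "norm (F (Complex x y2) - F (Complex x y1)) \<le> 2 * K * sqrt y2 - 2 * K * sqrt y1"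
  proof (rule differentiable_bound_general[OF yy, of "\<lambda>t. F (Complex x t)" "\<lambda>t. 2 * K * sqrt t" "\<lambda>t. \<i> * G t" "\<lambda>t. K / sqrt t"])
    show "continuous_on {y1..y2} (\<lambda>t. F (Complex x t))"
      using y by (intro continuous_at_imp_continuous_on) (auto intro!: has_vector_derivative_continuous gd)
    show "continuous_on {y1..y2} (\<lambda>t. 2 * K * sqrt t)" by (intro continuous_intros)
    fix t assume t: "y1 < t" "t < y2"
    then show "((\<lambda>t. F (Complex x t)) has_vector_derivative \<i> * G t) (at t)" "((\<lambda>t. 2 * K * sqrt t) has_vector_derivative K / sqrt t) (at t)"
      using y gd pd by auto
    show "norm (\<i> * G t) \<le> K / sqrt t" using K(1)[of t] t y by (simp add: norm_mult)
  qed
  then show ?thesis by (simp add: right_diff_distrib)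
qed auto

lemma upper_half_strip: "open {z. Re z < M \<and> 0 < Im z \<and> Im z < Y}" "convex {z. Re z < M \<and> 0 < Im z \<and> Im z < Y}"
proof -
  have eq: "{z. Re z < M \<and> 0 < Im z \<and> Im z < Y} = {z. Re z < M} \<inter> {z. Im z < Y} \<inter> {z. Im z > 0}" by auto
  show "open {z. Re z < M \<and> 0 < Im z \<and> Im z < Y}" unfolding eq
    by (intro open_Int open_halfspace_Re_lt open_halfspace_Im_lt open_halfspace_Im_gt)
  show "convex {z. Re z < M \<and> 0 < Im z \<and> Im z < Y}" unfolding eq
    by (intro convex_Int convex_halfspace_Re_lt convex_halfspace_Im_lt convex_halfspace_Im_gt)
qed

text \<open>The disc of radius \<open>t\<close> about \<open>Complex x t\<close> stays in the open
  half strip, where \<open>Re G = v\<close> is bounded on compact parts. This gives a derivative of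
  size \<open>C / t\<close>, which is integrated twice. The constant is uniform in \<open>x\<close>,
  as a continuous extension requires.\<close>

lemma primitive_boundary_bound:
  assumes hol: "G holomorphic_on {z. Re z < M \<and> 0 < Im z \<and> Im z < Y}"
    and cont: "continuous_on {z. Re z < M \<and> 0 \<le> Im z \<and> Im z < Y} v"
    and v: "\<And>z. Re z < M \<Longrightarrow> 0 < Im z \<Longrightarrow> Im z < Y \<Longrightarrow> v z = Re (G z)"
    and F: "\<And>z. Re z < M \<Longrightarrow> 0 < Im z \<Longrightarrow> Im z < Y \<Longrightarrow> (F has_field_derivative G z) (at z)"
    and b: "b < M" and y0: "0 < y0" "2 * y0 < Y" "b + y0 < M"
  obtains K where "K \<ge> 0" "\<And>x y1 y2. a \<le> x \<Longrightarrow> x \<le> b \<Longrightarrow> 0 < y1 \<Longrightarrow> y1 \<le> y2 \<Longrightarrow> y2 \<le> y0 \<Longrightarrow>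
      norm (F (Complex x y2) - F (Complex x y1)) \<le> K * (sqrt y2 - sqrt y1)"
proof -
  let ?S = "{z. Re z < M \<and> 0 < Im z \<and> Im z < Y}"
  \<comment> \<open>Contains all discs of radius \<open>t \<le> y0\<close> about
    \<open>Complex x t\<close> with \<open>a \<le> x \<le> b\<close>.\<close>
  let ?Q = "cbox (Complex (a - y0) 0) (Complex (b + y0) (2 * y0))"
  have "continuous_on ?Q v"
    by (rule continuous_on_subset[OF cont]) (use y0 in \<open>auto simp: in_cbox_complex_iff\<close>)
  then have "bounded (v ` ?Q)" by (intro compact_imp_bounded compact_continuous_image) auto
  then obtain B where B: "B > 0" "\<And>z. z \<in> ?Q \<Longrightarrow> \<bar>v z\<bar> \<le> B" by (auto simp: bounded_pos)
  define C where "C = 2 * exp 2 * B"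
  have C0: "C \<ge> 0" using B by (simp add: C_def)
  have dG: "norm (deriv G (Complex x t)) \<le> C / t" if "a \<le> x" "x \<le> b" "0 < t" "t \<le> y0" for x t
  proof -
    have near: "Re w \<in> {a - y0<..<b + y0} \<and> Im w \<in> {0<..<2 * y0}" if "w \<in> ball (Complex x t) t" for w
    proof -
      have "norm (Complex x t - w) < t" using that by (simp add: dist_norm)
      then show ?thesis
        using abs_Re_le_cmod[of "Complex x t - w"] abs_Im_le_cmod[of "Complex x t - w"] \<open>a \<le> x\<close> \<open>x \<le> b\<close> \<open>t \<le> y0\<close>
        unfolding greaterThanLessThan_iff by simp linarith
    qed
    have "ball (Complex x t) t \<subseteq> ?S" using near y0 by force
    then have "G holomorphic_on ball (Complex x t) t" by (rule holomorphic_on_subset[OF hol])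
    then show ?thesis
      unfolding C_def
    proof (rule deriv_bound_of_Re_bounded[OF _ \<open>0 < t\<close> B(1)])
      fix w assume w: "w \<in> ball (Complex x t) t"
      have "v w = Re (G w)" using near[OF w] y0 by (intro v) auto
      moreover have "w \<in> ?Q" using near[OF w] by (auto simp: in_cbox_complex_iff)
      ultimately show "\<bar>Re (G w)\<bar> \<le> B" using B(2) by metis
    qed
  qed
  have "continuous_on (cbox (Complex a y0) (Complex b y0)) G"
    by (rule continuous_on_subset[OF holomorphic_on_imp_continuous_on[OF hol]]) (use y0 in \<open>auto simp: in_cbox_complex_iff\<close>)
  then have "bounded (G ` cbox (Complex a y0) (Complex b y0))" by (intro compact_imp_bounded compact_continuous_image) auto
  then obtain A where A: "A > 0" "\<And>z. z \<in> cbox (Complex a y0) (Complex b y0) \<Longrightarrow> norm (G z) \<le> A" by (auto simp: bounded_pos)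
  define K where "K = (A + 2 * C) * sqrt y0"
  have K0: "K \<ge> 0" using A C0 y0 by (simp add: K_def)
  have GK: "norm (G (Complex x y)) \<le> K / sqrt y" if "a \<le> x" "x \<le> b" "0 < y" "y \<le> y0" for x y
  proof -
    have "norm (G (Complex x y)) \<le> (norm (G (Complex x y0)) + 2 * C) * sqrt y0 / sqrt y"
    proof (rule vertical_growth_bound[OF _ _ C0 that(3,4)])
      fix t assume t: "0 < t" "t \<le> y0"
      show "(G has_field_derivative deriv G (Complex x t)) (at (Complex x t))"
        using t that b y0 by (intro holomorphic_derivI[OF hol upper_half_strip(1)]) auto
      show "norm (deriv G (Complex x t)) \<le> C / t" using t that by (intro dG) auto
    qed
    also have "\<dots> \<le> K / sqrt y"
      unfolding K_def using A(2)[of "Complex x y0"] that y0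
      by (intro divide_right_mono mult_right_mono add_right_mono) (auto simp: in_cbox_complex_iff)
    finally show ?thesis .
  qed
  show thesis
  proof (rule that[of "2 * K"])
    fix x y1 y2 assume "a \<le> x" "x \<le> b" "0 < y1" "y1 \<le> y2" "y2 \<le> y0"
    then show "norm (F (Complex x y2) - F (Complex x y1)) \<le> 2 * K * (sqrt y2 - sqrt y1)"
      using b y0 K0 by (intro vertical_primitive_bound[of y0 F "\<lambda>t. G (Complex x t)"] F GK) auto
  qed (use K0 in simp)
qed

text \<open>Locally \<open>E\<close> is the uniform limit of the functions obtained from
  \<open>F\<close> by moving the argument up by \<open>h n\<close>, and these are continuous up to
  the real axis.\<close>

lemma primitive_extends_continuously:
  assumes hol: "G holomorphic_on {z. Re z < M \<and> 0 < Im z \<and> Im z < Y}"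
    and cont: "continuous_on {z. Re z < M \<and> 0 \<le> Im z \<and> Im z < Y} v"
    and v: "\<And>z. Re z < M \<Longrightarrow> 0 < Im z \<Longrightarrow> Im z < Y \<Longrightarrow> v z = Re (G z)"
    and F: "\<And>z. Re z < M \<Longrightarrow> 0 < Im z \<Longrightarrow> Im z < Y \<Longrightarrow> (F has_field_derivative G z) (at z)"
    and Y: "Y > 0"
  obtains E where "continuous_on {z. Re z < M \<and> 0 \<le> Im z \<and> Im z < Y} E"
    "\<And>z. Re z < M \<Longrightarrow> 0 < Im z \<Longrightarrow> Im z < Y \<Longrightarrow> E z = F z"
    "\<And>x. x < M \<Longrightarrow> (\<lambda>n. F (Complex x (1 / real (Suc n)))) \<longlonglongrightarrow> E (of_real x)"
proof -
  let ?T = "{z. Re z < M \<and> 0 \<le> Im z \<and> Im z < Y}"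
  define h where "h n = 1 / real (Suc n)" for n
  have h: "h n > 0" "m \<le> n \<Longrightarrow> h n \<le> h m" for m n by (auto simp: h_def field_simps)
  have h0: "h \<longlonglongrightarrow> 0" unfolding h_def [abs_def] by real_asymp
  define E where "E z = (if Im z > 0 then F z else lim (\<lambda>n. F (Complex (Re z) (h n))))" for z
  have main: "continuous_on (cbox (Complex a 0) (Complex b (y0 / 2))) E \<and>
      (\<forall>x. a \<le> x \<longrightarrow> x \<le> b \<longrightarrow> (\<lambda>n. F (Complex x (h n))) \<longlonglongrightarrow> E (of_real x))"
    if "0 < y0" "2 * y0 < Y" "b + y0 < M" for a b y0
  proof -
    note y0 = that
    have b: "b < M" using y0 by simp
    obtain K where K: "K \<ge> 0" "\<And>x y1 y2. a \<le> x \<Longrightarrow> x \<le> b \<Longrightarrow> 0 < y1 \<Longrightarrow> y1 \<le> y2 \<Longrightarrow> y2 \<le> y0 \<Longrightarrow>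
      norm (F (Complex x y2) - F (Complex x y1)) \<le> K * (sqrt y2 - sqrt y1)"
      by (rule primitive_boundary_bound[OF hol cont, of F b y0 a]) (use v F b y0 in blast)+
    let ?Q = "cbox (Complex a 0) (Complex b (y0 / 2))"
    obtain N where N: "\<And>n. n \<ge> N \<Longrightarrow> h n < y0 / 2"
      using order_tendstoD(2)[OF h0, of "y0 / 2"] y0 by (auto simp: eventually_sequentially)
    have Kd: "norm (F (Complex x (y + h m)) - F (Complex x (y + h n))) \<le> K * sqrt (h m)"
      if "a \<le> x" "x \<le> b" "0 \<le> y" "y \<le> y0 / 2" "N \<le> m" "m \<le> n" for x y m n
    proof -
      have "norm (F (Complex x (y + h m)) - F (Complex x (y + h n))) \<le> K * (sqrt (y + h m) - sqrt (y + h n))"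
        using that h[of n] h(2)[of m n] N[of m] by (intro K(2)) auto
      also have "sqrt (y + h m) \<le> sqrt (y + h n) + sqrt (h m)"
      proof -
        have "sqrt (y + h m) \<le> sqrt ((y + h n) + h m)" using h[of n] by simp
        also have "\<dots> \<le> sqrt (y + h n) + sqrt (h m)" using that h(1)[of n] h(1)[of m] by (intro sqrt_add_le_add_sqrt) auto
        finally show ?thesis .
      qed
      then have "K * (sqrt (y + h m) - sqrt (y + h n)) \<le> K * sqrt (h m)" using K(1) by (intro mult_left_mono) auto
      finally show ?thesis .
    qed
    have K0: "(\<lambda>m. K * sqrt (h m)) \<longlonglongrightarrow> K * sqrt 0" by (intro tendsto_intros h0)
    have lim0: "(\<lambda>n. F (Complex x (h n))) \<longlonglongrightarrow> E (of_real x)" if x: "a \<le> x" "x \<le> b" for x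
    proof -
      have "Cauchy (\<lambda>n. F (Complex x (h n)))"
      proof (rule CauchyI')
        fix e :: real assume "e > 0"
        then have "eventually (\<lambda>m. K * sqrt (h m) < e) sequentially" using K0 by (intro order_tendstoD(2)) auto
        then obtain N' where N': "\<And>m. m \<ge> N' \<Longrightarrow> K * sqrt (h m) < e" by (auto simp: eventually_sequentially)
        show "\<exists>M. \<forall>m\<ge>M. \<forall>n>m. dist (F (Complex x (h m))) (F (Complex x (h n))) < e"
        proof (rule exI[of _ "max N N'"], intro allI impI)
          fix m n assume "max N N' \<le> m" "m < n"
          then show "dist (F (Complex x (h m))) (F (Complex x (h n))) < e"
            using Kd[of x 0 m n] N'[of m] x y0 by (simp add: dist_norm)
        qed
      qed
      then have "convergent (\<lambda>n. F (Complex x (h n)))" by (simp add: Cauchy_convergent_iff)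
      then show ?thesis by (simp add: E_def convergent_LIMSEQ_iff)
    qed
    have limE: "(\<lambda>n. F (Complex (Re z) (Im z + h n))) \<longlonglongrightarrow> E z" if z: "z \<in> ?Q" for z
    proof (cases "Im z = 0")
      case True
      then have "E z = E (of_real (Re z))" by (simp add: complex_eq_iff E_def)
      then show ?thesis using lim0[of "Re z"] z True by (simp add: in_cbox_complex_iff)
    next
      case False
      then have Imz: "Im z > 0" using z by (auto simp: in_cbox_complex_iff)
      have "isCont F z" using F[of z] z Imz b y0 by (intro DERIV_isCont) (auto simp: in_cbox_complex_iff)
      moreover have "(\<lambda>n. Complex (Re z) (Im z + h n)) \<longlonglongrightarrow> Complex (Re z) (Im z + 0)"
        by (intro tendsto_intros h0)
      ultimately have "(\<lambda>n. F (Complex (Re z) (Im z + h n))) \<longlonglongrightarrow> F z"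
        by (intro isCont_tendsto_compose[of z F]) auto
      then show ?thesis using Imz by (simp add: E_def)
    qed
    have ul: "norm (F (Complex (Re z) (Im z + h m)) - E z) \<le> K * sqrt (h m)" if z: "z \<in> ?Q" and m: "N \<le> m" for z m
    proof (rule tendsto_upperbound)
      show "(\<lambda>n. norm (F (Complex (Re z) (Im z + h m)) - F (Complex (Re z) (Im z + h n)))) \<longlonglongrightarrow> norm (F (Complex (Re z) (Im z + h m)) - E z)"
        by (intro tendsto_intros limE z)
      show "eventually (\<lambda>n. norm (F (Complex (Re z) (Im z + h m)) - F (Complex (Re z) (Im z + h n))) \<le> K * sqrt (h m)) sequentially"
        by (rule eventually_mono[OF eventually_ge_at_top[of m]])
           (use Kd[of "Re z" "Im z" m] z m in \<open>auto simp: in_cbox_complex_iff\<close>)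
    qed simp
    have "continuous_on ?Q E"
    proof (rule uniform_limit_theorem[where F = sequentially])
      show "eventually (\<lambda>n. continuous_on ?Q (\<lambda>z. F (Complex (Re z) (Im z + h n)))) sequentially"
        using eventually_ge_at_top[of N]
      proof eventually_elim
        case (elim n)
        have c: "continuous_on {z. Re z < M \<and> 0 < Im z \<and> Im z < Y} F"
          using F by (intro continuous_at_imp_continuous_on) (auto intro: DERIV_isCont)
        show ?case
        proof (rule continuous_on_compose2[OF c])
          show "continuous_on ?Q (\<lambda>z. Complex (Re z) (Im z + h n))" by (intro continuous_intros)
          show "(\<lambda>z. Complex (Re z) (Im z + h n)) ` ?Q \<subseteq> {z. Re z < M \<and> 0 < Im z \<and> Im z < Y}"
            using N[OF elim] h(1)[of n] y0 b by (auto simp: in_cbox_complex_iff)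
        qed
      qed
      show "uniform_limit ?Q (\<lambda>n z. F (Complex (Re z) (Im z + h n))) E sequentially"
      proof (rule uniform_limitI)
        fix e :: real assume "e > 0"
        then have "eventually (\<lambda>m. K * sqrt (h m) < e) sequentially" using K0 by (intro order_tendstoD(2)) auto
        then show "\<forall>\<^sub>F n in sequentially. \<forall>z\<in>?Q. dist (F (Complex (Re z) (Im z + h n))) (E z) < e"
          using eventually_ge_at_top[of N]
        proof eventually_elim
          case (elim n)
          then show ?case using ul by (auto simp: dist_norm intro: le_less_trans)
        qed
      qed
    qed auto
    then show ?thesis using lim0 by blast
  qed
  have "continuous (at z within ?T) E" if z: "z \<in> ?T" for z
  proof (cases "Im z > 0")
    case True
    have zS: "z \<in> {z. Re z < M \<and> 0 < Im z \<and> Im z < Y}" using True z by auto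
    have "isCont F z" using F[of z] z True by (intro DERIV_isCont) auto
    moreover have "eventually (\<lambda>w. E w = F w) (nhds z)"
      using eventually_nhds_in_open[OF upper_half_strip(1) zS] by eventually_elim (auto simp: E_def)
    ultimately have "isCont E z" by (simp add: isCont_cong)
    then show ?thesis by (rule continuous_at_imp_continuous_at_within)
  next
    case False
    define y0 where "y0 = min (Y / 3) ((M - Re z) / 3)"
    have y0: "0 < y0" "2 * y0 < Y" "(Re z + y0) + y0 < M" using Y z by (auto simp: y0_def min_def field_simps)
    let ?Q = "cbox (Complex (Re z - y0) 0) (Complex (Re z + y0) (y0 / 2))"
    have zQ: "z \<in> ?Q" using False z y0 by (auto simp: in_cbox_complex_iff)
    have "continuous (at z within ?Q) E"
      using main[OF y0] zQ by (auto simp: continuous_on_eq_continuous_within)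
    moreover have "at z within ?Q = at z within ?T"
    proof (rule at_within_nhd[of z "ball z (y0 / 2)"])
      show "?Q \<inter> ball z (y0 / 2) - {z} = ?T \<inter> ball z (y0 / 2) - {z}"
      proof -
        have "w \<in> ?Q \<longleftrightarrow> w \<in> ?T" if w: "w \<in> ball z (y0 / 2)" for w
        proof -
          have nw: "norm (z - w) < y0 / 2" using w by (simp add: dist_norm)
          have "\<bar>Re z - Re w\<bar> < y0 / 2" using abs_Re_le_cmod[of "z - w"] nw by simp
          moreover have "\<bar>Im z - Im w\<bar> < y0 / 2" using abs_Im_le_cmod[of "z - w"] nw by simp
          ultimately have "Re z - Re w < y0" "Re w - Re z < y0" "Im w < y0 / 2 + Im z" "- y0 < Im w - Im z"
            using y0(1) by linarith+
          then show ?thesis using False z y0 \<open>\<bar>Im z - Im w\<bar> < y0 / 2\<close> by (auto simp: in_cbox_complex_iff)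
        qed
        then show ?thesis by blast
      qed
    qed (use y0 in auto)
    ultimately show ?thesis by simp
  qed
  then have "continuous_on ?T E" by (simp add: continuous_on_eq_continuous_within)
  moreover have "(\<lambda>n. F (Complex x (1 / real (Suc n)))) \<longlonglongrightarrow> E (of_real x)" if x: "x < M" for x
  proof -
    define y0 where "y0 = min (Y / 3) ((M - x) / 3)"
    have y0: "0 < y0" "2 * y0 < Y" "x + y0 < M" using Y x by (auto simp: y0_def min_def field_simps)
    show ?thesis using main[OF y0, of x] unfolding h_def by auto
  qed
  ultimately show thesis by (intro that[of E]) (auto simp: E_def)
qed

text \<open>On a horizontal line the derivative of \<open>Re F\<close> is \<open>v\<close>. Uniform
  continuity of \<open>v\<close> and its vanishing on the axis make the increment between
  \<open>a\<close> and \<open>b\<close> tend to 0 as the line descends.\<close>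

lemma primitive_Re_constant_on_boundary:
  assumes cont: "continuous_on {z. Re z < M \<and> 0 \<le> Im z \<and> Im z < Y} v"
    and v: "\<And>z. Re z < M \<Longrightarrow> 0 < Im z \<Longrightarrow> Im z < Y \<Longrightarrow> v z = Re (G z)"
    and v0: "\<And>x. x < M \<Longrightarrow> v (of_real x) = 0"
    and F: "\<And>z. Re z < M \<Longrightarrow> 0 < Im z \<Longrightarrow> Im z < Y \<Longrightarrow> (F has_field_derivative G z) (at z)"
    and Y: "Y > 0"
    and E: "\<And>x. x < M \<Longrightarrow> (\<lambda>n. F (Complex x (1 / real (Suc n)))) \<longlonglongrightarrow> E (of_real x)"
    and ab: "a < b" "b < M"
  shows "Re (E (of_real a)) = Re (E (of_real b))"
proof (rule ccontr)
  define D where "D = \<bar>Re (E (of_real b)) - Re (E (of_real a))\<bar>"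
  assume "Re (E (of_real a)) \<noteq> Re (E (of_real b))"
  then have D: "D > 0" by (simp add: D_def)
  \<comment> \<open>Half of what would be consistent with an increment \<open>D\<close> over the
    length \<open>b - a\<close>; the limit then yields \<open>D \<le> D / 2\<close>.\<close>
  define e where "e = D / (2 * (b - a))"
  have e: "e > 0" using D ab by (simp add: e_def)
  let ?Q = "cbox (Complex a 0) (Complex b (Y / 2))"
  have "continuous_on ?Q v"
    by (rule continuous_on_subset[OF cont]) (use Y ab in \<open>auto simp: in_cbox_complex_iff\<close>)
  then have "uniformly_continuous_on ?Q v" by (intro compact_uniformly_continuous) auto
  then obtain \<delta> where \<delta>: "\<delta> > 0" "\<And>x x'. x \<in> ?Q \<Longrightarrow> x' \<in> ?Q \<Longrightarrow> dist x' x < \<delta> \<Longrightarrow> dist (v x') (v x) < e"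
    using e unfolding uniformly_continuous_on_def by metis
  have h0: "(\<lambda>n. 1 / real (Suc n)) \<longlonglongrightarrow> 0" by real_asymp
  have ev: "eventually (\<lambda>n. 1 / real (Suc n) < min \<delta> (Y / 2)) sequentially"
    using \<delta> Y by (intro order_tendstoD(2)[OF h0]) auto
  have "D \<le> e * (b - a)"
  proof (rule tendsto_upperbound)
    show "(\<lambda>n. \<bar>Re (F (Complex b (1 / real (Suc n)))) - Re (F (Complex a (1 / real (Suc n))))\<bar>) \<longlonglongrightarrow> D"
      unfolding D_def using ab by (intro tendsto_intros E) auto
    show "eventually (\<lambda>n. \<bar>Re (F (Complex b (1 / real (Suc n)))) - Re (F (Complex a (1 / real (Suc n))))\<bar> \<le> e * (b - a)) sequentially"
      using ev
    proof eventually_elim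
      case (elim n)
      define t where "t = 1 / real (Suc n)"
      have t: "0 < t" "t < \<delta>" "t < Y / 2" using elim by (auto simp: t_def)
      have d: "((\<lambda>x. Re (F (Complex x t))) has_real_derivative v (Complex x t)) (at x)" if "a \<le> x" "x \<le> b" for x
      proof -
        have "((\<lambda>x. Complex x t) has_vector_derivative 1) (at x)"
          unfolding Complex_eq by (auto intro!: derivative_eq_intros)
        from field_vector_diff_chain_at[OF this F[of "Complex x t"]] that ab t
        have "((\<lambda>x. F (Complex x t)) has_vector_derivative G (Complex x t)) (at x)" by (simp add: o_def)
        from bounded_linear.has_vector_derivative[OF bounded_linear_Re this] v[of "Complex x t"] that ab t show ?thesis
          by (simp add: has_real_derivative_iff_has_vector_derivative)
      qed
      obtain \<xi> where \<xi>: "a < \<xi>" "\<xi> < b" "Re (F (Complex b t)) - Re (F (Complex a t)) = (b - a) * v (Complex \<xi> t)"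
        using MVT2[of a b "\<lambda>x. Re (F (Complex x t))" "\<lambda>x. v (Complex x t)"] ab d by metis
      have "dist (v (Complex \<xi> t)) (v (Complex \<xi> 0)) < e"
        using \<xi> t Y by (intro \<delta>(2)) (auto simp: in_cbox_complex_iff dist_norm cmod_def)
      moreover have "v (Complex \<xi> 0) = 0" using v0[of \<xi>] \<xi> ab by (simp add: Complex_eq)
      ultimately have "\<bar>v (Complex \<xi> t)\<bar> \<le> e" by (simp add: dist_norm)
      then show ?case using \<xi>(3) ab unfolding t_def [symmetric] by (simp add: abs_mult mult.commute mult_right_mono)
    qed
  qed simp
  also have "e * (b - a) = D / 2" using ab by (simp add: e_def field_simps)
  finally show False using D by simp
qed

text \<open>Only the real part of \<open>G\<close> is known to be continuous up to the real axis, so the Schwarz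
  reflection principle is applied to a primitive of \<open>G\<close>.\<close>

theorem harmonic_reflection:
  assumes hol: "G holomorphic_on {z. Re z < M \<and> 0 < Im z \<and> Im z < Y}"
    and cont: "continuous_on {z. Re z < M \<and> 0 \<le> Im z \<and> Im z < Y} v"
    and v: "\<And>z. Re z < M \<Longrightarrow> 0 < Im z \<Longrightarrow> Im z < Y \<Longrightarrow> v z = Re (G z)"
    and v0: "\<And>x. x < M \<Longrightarrow> v (of_real x) = 0"
    and Y: "Y > 0"
  obtains H where "H holomorphic_on {z. Re z < M \<and> \<bar>Im z\<bar> < Y}"
    "\<And>z. Re z < M \<Longrightarrow> 0 < Im z \<Longrightarrow> Im z < Y \<Longrightarrow> H z = G z"
    "\<And>z. Re z < M \<Longrightarrow> \<bar>Im z\<bar> < Y \<Longrightarrow> H (cnj z) = - cnj (H z)"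
proof -
  let ?S = "{z. Re z < M \<and> \<bar>Im z\<bar> < Y}"
  let ?U = "{z. Re z < M \<and> 0 < Im z \<and> Im z < Y}"
  have eq: "?S = {z. Re z < M} \<inter> {z. Im z < Y} \<inter> {z. Im z > - Y}" by auto
  have S: "open ?S" unfolding eq by (intro open_Int open_halfspace_Re_lt open_halfspace_Im_lt open_halfspace_Im_gt)
  obtain F where F': "\<And>z. z \<in> ?U \<Longrightarrow> (F has_field_derivative G z) (at z within ?U)"
    using holomorphic_convex_primitive'[OF upper_half_strip(2,1) hol] by blast
  have F: "(F has_field_derivative G z) (at z)" if "Re z < M" "0 < Im z" "Im z < Y" for z
    using F'[of z] that at_within_open[OF _ upper_half_strip(1), of z M Y] by auto
  obtain E where E: "continuous_on {z. Re z < M \<and> 0 \<le> Im z \<and> Im z < Y} E"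
    "\<And>z. Re z < M \<Longrightarrow> 0 < Im z \<Longrightarrow> Im z < Y \<Longrightarrow> E z = F z"
    "\<And>x. x < M \<Longrightarrow> (\<lambda>n. F (Complex x (1 / real (Suc n)))) \<longlonglongrightarrow> E (of_real x)"
    by (rule primitive_extends_continuously[OF hol cont, of F]) (use v F Y in blast)+
  define c where "c = Re (E (of_real (M - 1)))"
  have cR: "Re (E (of_real x)) = c" if "x < M" for x
  proof -
    note P = primitive_Re_constant_on_boundary[OF cont v v0 F Y E(3)]
    show ?thesis
      unfolding c_def using P[of x "M - 1"] P[of "M - 1" x] that by (cases x "M - 1" rule: linorder_cases) auto
  qed
  \<comment> \<open>The factor \<i> turns constant real part on the axis into real values there, as
    Schwarz reflection demands.\<close>
  define f where "f z = \<i> * (E z - of_real c)" for z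
  define \<Phi> where "\<Phi> z = (if 0 \<le> Im z then f z else cnj (f (cnj z)))" for z
  have fR: "f z \<in> \<real>" if z: "z \<in> ?S" "z \<in> \<real>" for z
  proof -
    obtain x where "z = of_real x" using z(2) Reals_cases by blast
    then show ?thesis using z cR[of x] by (simp add: f_def complex_is_Real_iff)
  qed
  have hol\<Phi>: "\<Phi> holomorphic_on ?S"
    unfolding \<Phi>_def [abs_def]
  proof (rule Schwarz_reflection[OF S])
    have "F holomorphic_on ?U" using F upper_half_strip(1)[of M Y] by (auto simp: holomorphic_on_open)
    then have "E holomorphic_on ?U" by (rule holomorphic_transform) (use E(2) in auto)
    then have "f holomorphic_on ?U" unfolding f_def [abs_def] by (intro holomorphic_intros)
    then show "f holomorphic_on ?S \<inter> {z. 0 < Im z}" by (rule holomorphic_on_subset) auto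
    have "continuous_on {z. Re z < M \<and> 0 \<le> Im z \<and> Im z < Y} f" unfolding f_def [abs_def] by (intro continuous_intros E)
    then show "continuous_on (?S \<inter> {z. 0 \<le> Im z}) f" by (rule continuous_on_subset) auto
  qed (use fR in auto)
  have sym: "\<Phi> (cnj z) = cnj (\<Phi> z)" if "z \<in> ?S" for z
  proof (cases "Im z = 0")
    case True
    then have "cnj z = z" "z \<in> \<real>" by (auto simp: complex_eq_iff complex_is_Real_iff)
    then show ?thesis using fR[OF that] by (simp add: \<Phi>_def True Reals_cnj_iff)
  qed (auto simp: \<Phi>_def)
  have d\<Phi>: "(\<Phi> has_field_derivative deriv \<Phi> z) (at z)" if "z \<in> ?S" for z
    using holomorphic_derivI[OF hol\<Phi> S that] .
  have dsym: "deriv \<Phi> (cnj z) = cnj (deriv \<Phi> z)" if z: "z \<in> ?S" for z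
  proof -
    have "((cnj \<circ> \<Phi> \<circ> cnj) has_field_derivative cnj (deriv \<Phi> z)) (at (cnj z))"
      using d\<Phi>[OF z] by (intro has_field_derivative_cnj_cnj) auto
    then have "(\<Phi> has_field_derivative cnj (deriv \<Phi> z)) (at (cnj z))"
    proof (rule has_field_derivative_transform_within_open[OF _ S])
      show "cnj z \<in> ?S" using z by simp
      fix w assume "w \<in> ?S"
      then show "(cnj \<circ> \<Phi> \<circ> cnj) w = \<Phi> w" using sym[of w] by simp
    qed
    then show ?thesis by (rule DERIV_imp_deriv)
  qed
  \<comment> \<open>Differentiation returns from the primitive to \<open>G\<close>; the factor \<i>
    turns the symmetry of \<open>\<Phi>\<close> into the minus sign in
    \<open>H (cnj z) = - cnj (H z)\<close>.\<close>
  define H where "H z = - \<i> * deriv \<Phi> z" for z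
  show thesis
  proof (rule that[of H])
    show "H holomorphic_on ?S" unfolding H_def [abs_def] by (intro holomorphic_intros holomorphic_deriv hol\<Phi> S)
    fix z assume z: "Re z < M" "0 < Im z" "Im z < Y"
    have "((\<lambda>z. \<i> * (F z - of_real c)) has_field_derivative \<i> * G z) (at z)"
      using F[OF z] by (auto intro!: derivative_eq_intros)
    then have "(\<Phi> has_field_derivative \<i> * G z) (at z)"
      by (rule has_field_derivative_transform_within_open[OF _ upper_half_strip(1), of _ _ z M Y])
         (use z E(2) in \<open>auto simp: \<Phi>_def f_def\<close>)
    then show "H z = G z" by (simp add: H_def DERIV_imp_deriv)
  next
    fix z assume z: "Re z < M" "\<bar>Im z\<bar> < Y"
    then show "H (cnj z) = - cnj (H z)" using dsym[of z] by (simp add: H_def)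
  qed
qed

section \<open>Harmonic functions as real parts\<close>
lemma has_real_derivative_coordinates:
  assumes "(f has_derivative (\<lambda>v. a * Re v + b * Im v)) (at (Complex x y))"
  shows "((\<lambda>t. f (Complex t y)) has_real_derivative a) (at x)"
    and "((\<lambda>t. f (Complex x t)) has_real_derivative b) (at y)"
proof -
  have 1: "((\<lambda>t. Complex t y) has_derivative (\<lambda>h. of_real h)) (at x)"
    unfolding Complex_eq by (auto intro!: derivative_eq_intros)
  have 2: "((\<lambda>t. Complex x t) has_derivative (\<lambda>h. \<i> * of_real h)) (at y)"
    unfolding Complex_eq by (auto intro!: derivative_eq_intros)
  show "((\<lambda>t. f (Complex t y)) has_real_derivative a) (at x)"
    using has_derivative_compose[OF 1 assms] by (simp add: has_field_derivative_def mult_commute_abs)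
  show "((\<lambda>t. f (Complex x t)) has_real_derivative b) (at y)"
    using has_derivative_compose[OF 2 assms] by (simp add: has_field_derivative_def mult_commute_abs)
qed

text \<open>Two applications of the mean value theorem to the second difference over a square, the
  first in the x-direction.\<close>

lemma mixed_difference:
  fixes u p py :: "complex \<Rightarrow> real"
  assumes h: "h > 0"
    and box: "\<And>x y. x0 \<le> x \<Longrightarrow> x \<le> x0 + h \<Longrightarrow> y0 \<le> y \<Longrightarrow> y \<le> y0 + h \<Longrightarrow>
        ((\<lambda>t. u (Complex t y)) has_real_derivative p (Complex x y)) (at x) \<and>
        ((\<lambda>t. p (Complex x t)) has_real_derivative py (Complex x y)) (at y)"
  obtains \<xi> \<zeta> where "x0 \<le> \<xi>" "\<xi> \<le> x0 + h" "y0 \<le> \<zeta>" "\<zeta> \<le> y0 + h"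
    "u (Complex (x0 + h) (y0 + h)) - u (Complex x0 (y0 + h)) - u (Complex (x0 + h) y0) + u (Complex x0 y0) = h * h * py (Complex \<xi> \<zeta>)"
proof -
  define f where "f t = u (Complex t (y0 + h)) - u (Complex t y0)" for t
  have "\<exists>\<xi>>x0. \<xi> < x0 + h \<and> f (x0 + h) - f x0 = (x0 + h - x0) * (p (Complex \<xi> (y0 + h)) - p (Complex \<xi> y0))"
    unfolding f_def using h box by (intro MVT2) (auto intro!: derivative_eq_intros)
  then obtain \<xi> where \<xi>: "x0 < \<xi>" "\<xi> < x0 + h" "f (x0 + h) - f x0 = h * (p (Complex \<xi> (y0 + h)) - p (Complex \<xi> y0))" by auto
  have "\<exists>\<zeta>>y0. \<zeta> < y0 + h \<and> p (Complex \<xi> (y0 + h)) - p (Complex \<xi> y0) = (y0 + h - y0) * py (Complex \<xi> \<zeta>)"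
    using h box \<xi> by (intro MVT2) auto
  then obtain \<zeta> where \<zeta>: "y0 < \<zeta>" "\<zeta> < y0 + h" "p (Complex \<xi> (y0 + h)) - p (Complex \<xi> y0) = h * py (Complex \<xi> \<zeta>)" by auto
  show thesis
    by (rule that[of \<xi> \<zeta>]) (use \<xi> \<zeta> in \<open>auto simp: f_def\<close>)
qed

text \<open>The same second difference, evaluated in both orders, gives nearby values of
  \<open>py\<close> and \<open>qx\<close>; continuity of both at \<open>z\<close> finishes. Symmetry
  has to be derived because the definition of harmonicity does not include it.\<close>

lemma symmetric_mixed_derivatives:
  fixes u p q py qx px qy :: "complex \<Rightarrow> real"
  assumes D: "open D" "z \<in> D" and cont: "continuous_on D py" "continuous_on D qx"
    and der: "\<And>z. z \<in> D \<Longrightarrow> (u has_derivative (\<lambda>v. p z * Re v + q z * Im v)) (at z)"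
      "\<And>z. z \<in> D \<Longrightarrow> (p has_derivative (\<lambda>v. px z * Re v + py z * Im v)) (at z)"
      "\<And>z. z \<in> D \<Longrightarrow> (q has_derivative (\<lambda>v. qx z * Re v + qy z * Im v)) (at z)"
  shows "py z = qx z"
proof (rule ccontr)
  assume ne: "py z \<noteq> qx z"
  define e where "e = \<bar>py z - qx z\<bar> / 2"
  have e: "e > 0" using ne by (simp add: e_def)
  have "isCont py z" "isCont qx z" using cont D by (auto simp: continuous_on_eq_continuous_at)
  then obtain d1 d2 where d1: "d1 > 0" "\<And>w. dist w z < d1 \<Longrightarrow> dist (py w) (py z) < e"
    and d2: "d2 > 0" "\<And>w. dist w z < d2 \<Longrightarrow> dist (qx w) (qx z) < e"
    using e unfolding continuous_at_eps_delta by metis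
  obtain d3 where d3: "d3 > 0" "ball z d3 \<subseteq> D" using D by (auto simp: open_contains_ball)
  define h where "h = min (min d1 d2) d3 / 3"
  have h: "h > 0" "2 * h < d1" "2 * h < d2" "2 * h < d3" using d1 d2 d3 by (auto simp: h_def min_def)
  define x0 y0 where "x0 = Re z" and "y0 = Im z"
  have near: "dist (Complex x y) z \<le> 2 * h" if "x0 \<le> x" "x \<le> x0 + h" "y0 \<le> y" "y \<le> y0 + h" for x y
    using cmod_le[of "Complex x y - z"] that by (auto simp: dist_norm x0_def y0_def)
  have inD: "Complex x y \<in> D" if "x0 \<le> x" "x \<le> x0 + h" "y0 \<le> y" "y \<le> y0 + h" for x y
    using near[OF that] h d3(2) by (auto simp: dist_commute intro!: subsetD[OF d3(2)])
  obtain \<xi> \<zeta> where 1: "x0 \<le> \<xi>" "\<xi> \<le> x0 + h" "y0 \<le> \<zeta>" "\<zeta> \<le> y0 + h"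
    "u (Complex (x0 + h) (y0 + h)) - u (Complex x0 (y0 + h)) - u (Complex (x0 + h) y0) + u (Complex x0 y0) = h * h * py (Complex \<xi> \<zeta>)"
    by (rule mixed_difference[OF h(1), of x0 y0 u p py])
       (use has_real_derivative_coordinates(1)[OF der(1)[OF inD]] has_real_derivative_coordinates(2)[OF der(2)[OF inD]] in auto)
  obtain \<zeta>' \<xi>' where 2: "y0 \<le> \<zeta>'" "\<zeta>' \<le> y0 + h" "x0 \<le> \<xi>'" "\<xi>' \<le> x0 + h"
    "u (Complex (x0 + h) (y0 + h)) - u (Complex (x0 + h) y0) - u (Complex x0 (y0 + h)) + u (Complex x0 y0) = h * h * qx (Complex \<xi>' \<zeta>')"
    \<comment> \<open>The other order of differentiation is obtained by exchanging the
      coordinates.\<close>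
    by (rule mixed_difference[OF h(1), of y0 x0 "\<lambda>w. u (Complex (Im w) (Re w))" "\<lambda>w. q (Complex (Im w) (Re w))" "\<lambda>w. qx (Complex (Im w) (Re w))"])
       (use has_real_derivative_coordinates(2)[OF der(1)[OF inD]] has_real_derivative_coordinates(1)[OF der(3)[OF inD]] in auto)
  have "h * h * py (Complex \<xi> \<zeta>) = h * h * qx (Complex \<xi>' \<zeta>')" using 1(5) 2(5) by linarith
  then have eq: "py (Complex \<xi> \<zeta>) = qx (Complex \<xi>' \<zeta>')" using h by simp
  have "dist (py (Complex \<xi> \<zeta>)) (py z) < e" using near[OF 1(1-4)] h by (intro d1) auto
  moreover have "dist (qx (Complex \<xi>' \<zeta>')) (qx z) < e" using near[OF 2(3,4,1,2)] h by (intro d2) auto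
  ultimately have "\<bar>py z - qx z\<bar> < 2 * e" unfolding eq dist_real_def by linarith
  then show False by (simp add: e_def)
qed

text \<open>The function with real part \<open>p\<close> and imaginary part \<open>- q\<close>
  satisfies the Cauchy-Riemann equations, by vanishing of the Laplacian and symmetry of the mixed
  derivatives. Its primitive on the simply connected domain has real part \<open>u\<close> up to a
  constant.\<close>

theorem harmonic_is_Re_holomorphic:
  assumes D: "open D" "connected D" "simply_connected D" and u: "harmonic_on u D"
  obtains f where "f holomorphic_on D" "\<And>z. z \<in> D \<Longrightarrow> Re (f z) = u z"
proof (cases "D = {}")
  case True
  then show ?thesis using that[of "\<lambda>_. 0"] by simp
next
  case False
  then obtain z0 where z0: "z0 \<in> D" by blast
  obtain p q px py qx qy :: "complex \<Rightarrow> real" where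
    cont: "continuous_on D py" "continuous_on D qx"
    and der: "\<And>z. z \<in> D \<Longrightarrow> (u has_derivative (\<lambda>v. p z * Re v + q z * Im v)) (at z)"
      "\<And>z. z \<in> D \<Longrightarrow> (p has_derivative (\<lambda>v. px z * Re v + py z * Im v)) (at z)"
      "\<And>z. z \<in> D \<Longrightarrow> (q has_derivative (\<lambda>v. qx z * Re v + qy z * Im v)) (at z)"
    and lap: "\<And>z. z \<in> D \<Longrightarrow> px z + qy z = 0"
    using u unfolding harmonic_on_def by blast
  define g where "g z = of_real (p z) - \<i> * of_real (q z)" for z
  have "(g has_field_derivative (of_real (px z) - \<i> * of_real (qx z))) (at z)" if z: "z \<in> D" for z
  proof -
    have sym: "py z = qx z" by (rule symmetric_mixed_derivatives[OF D(1) z cont der])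
    have "(g has_derivative (\<lambda>v. of_real (px z * Re v + py z * Im v) - \<i> * of_real (qx z * Re v + qy z * Im v))) (at z)"
      unfolding g_def [abs_def] using der(2,3)[OF z] by (intro derivative_intros) auto
    moreover have "of_real (px z * Re v + py z * Im v) - \<i> * of_real (qx z * Re v + qy z * Im v) = (of_real (px z) - \<i> * of_real (qx z)) * v" for v
    proof -
      have "qy z = - px z" using lap[OF z] by simp
      then show ?thesis unfolding sym by (auto simp: complex_eq_iff algebra_simps)
    qed
    ultimately show ?thesis by (simp add: has_field_derivative_def)
  qed
  then have "g holomorphic_on D" using D(1) by (auto simp: holomorphic_on_open)
  then obtain F where F: "\<And>z. z \<in> D \<Longrightarrow> (F has_field_derivative g z) (at z)"
    using simply_connected_eq_global_primitive[OF D(1)] D(3) by blast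
  define c where "c = Re (F z0) - u z0"
  have "(\<lambda>z. Re (F z) - u z) z = c" if z: "z \<in> D" for z
    unfolding c_def
  proof (rule has_derivative_zero_unique_connected[where f = "\<lambda>z. Re (F z) - u z", OF D(1,2) _ z z0])
    fix x assume x: "x \<in> D"
    have "((\<lambda>z. Re (F z)) has_derivative (\<lambda>v. Re (g x * v))) (at x)"
      using F[OF x] unfolding has_field_derivative_def by (rule has_derivative_Re)
    then have "((\<lambda>z. Re (F z) - u z) has_derivative (\<lambda>v. Re (g x * v) - (p x * Re v + q x * Im v))) (at x)"
      by (rule has_derivative_diff) (rule der(1)[OF x])
    then show "((\<lambda>z. Re (F z) - u z) has_derivative (\<lambda>v. 0)) (at x)" by (simp add: g_def)
  qed
  then have "Re (F z - of_real c) = u z" if "z \<in> D" for z using that by (simp add: algebra_simps)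
  moreover have "(\<lambda>z. F z - of_real c) holomorphic_on D"
    using F D(1) by (intro holomorphic_intros) (auto simp: holomorphic_on_open)
  ultimately show thesis using that by blast
qed

section \<open>Coherence of the expansions\<close>
text \<open>Collects the terms of equal exponent into one polynomial. The index set is any finite
  set containing the support, so that two representations can be compared over a common one.\<close>

lemma explog_representation:
  assumes "X \<in> explog V"
  shows "\<exists>pc. finite {\<alpha>. pc \<alpha> \<noteq> 0} \<and> (\<forall>\<alpha> j. coeff (pc \<alpha>) j \<noteq> 0 \<longrightarrow> (\<alpha>, j) \<in> V) \<and>
    (\<forall>A w. finite A \<longrightarrow> {\<alpha>. pc \<alpha> \<noteq> 0} \<subseteq> A \<longrightarrow> X w = (\<Sum>\<alpha>\<in>A. poly (pc \<alpha>) w * exp (of_real \<alpha> * w)))"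
  using assms
proof (induction rule: explog.induct)
    case zero
    show ?case by (rule exI[of _ "\<lambda>_. 0"]) auto
  next
    case (add X \<beta> j c)
    then obtain pc where pc: "finite {\<alpha>. pc \<alpha> \<noteq> 0}" "\<And>\<alpha> j. coeff (pc \<alpha>) j \<noteq> 0 \<Longrightarrow> (\<alpha>, j) \<in> V"
      "\<And>A w. finite A \<Longrightarrow> {\<alpha>. pc \<alpha> \<noteq> 0} \<subseteq> A \<Longrightarrow> X w = (\<Sum>\<alpha>\<in>A. poly (pc \<alpha>) w * exp (of_real \<alpha> * w))"
      by blast
    define pc' where "pc' \<alpha> = pc \<alpha> + (if \<alpha> = \<beta> then monom c j else 0)" for \<alpha>
    show ?case
    proof (intro exI[of _ pc'] conjI allI impI)
      have "{\<alpha>. pc' \<alpha> \<noteq> 0} \<subseteq> insert \<beta> {\<alpha>. pc \<alpha> \<noteq> 0}" by (auto simp: pc'_def)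
      then show "finite {\<alpha>. pc' \<alpha> \<noteq> 0}" using pc(1) finite_subset by blast
      show "(\<alpha>, i) \<in> V" if "coeff (pc' \<alpha>) i \<noteq> 0" for \<alpha> i
        using that pc(2)[of \<alpha> i] add.hyps(2) by (auto simp: pc'_def split: if_splits)
      fix A w assume A: "finite A" "{\<alpha>. pc' \<alpha> \<noteq> 0} \<subseteq> A"
      define B where "B = A \<union> insert \<beta> {\<alpha>. pc \<alpha> \<noteq> 0}"
      have B: "finite B" "{\<alpha>. pc \<alpha> \<noteq> 0} \<subseteq> B" "\<beta> \<in> B" "A \<subseteq> B" using A pc(1) by (auto simp: B_def)
      have "(\<Sum>\<alpha>\<in>A. poly (pc' \<alpha>) w * exp (of_real \<alpha> * w)) = (\<Sum>\<alpha>\<in>B. poly (pc' \<alpha>) w * exp (of_real \<alpha> * w))"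
      proof (rule sum.mono_neutral_left)
        have "pc' i = 0" if "i \<notin> A" for i using A(2) that by blast
        then show "\<forall>i\<in>B - A. poly (pc' i) w * exp (of_real i * w) = 0" by auto
      qed (use B in auto)
      also have "\<dots> = (\<Sum>\<alpha>\<in>B. poly (pc \<alpha>) w * exp (of_real \<alpha> * w)) + (\<Sum>\<alpha>\<in>B. if \<alpha> = \<beta> then c * w ^ j * exp (of_real \<alpha> * w) else 0)"
        unfolding sum.distrib [symmetric] by (intro sum.cong) (auto simp: pc'_def poly_monom algebra_simps)
      also have "\<dots> = X w + c * (w ^ j * exp (of_real \<beta> * w))"
        using pc(3)[OF B(1,2)] B by (simp add: sum.delta)
      finally show "X w + c * (w ^ j * exp (of_real \<beta> * w)) = (\<Sum>\<alpha>\<in>A. poly (pc' \<alpha>) w * exp (of_real \<alpha> * w))" by simp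
    qed
qed

lemma exp_order_poly:
  assumes "\<sigma> < \<alpha>"
  shows "exp_order Y \<sigma> (\<lambda>w. poly p w * exp (of_real \<alpha> * w))"
proof -
  have "exp_order Y \<sigma> (\<lambda>w. \<Sum>i\<le>degree p. coeff p i * ((w + 0) ^ i * exp (of_real \<alpha> * w)))"
    by (intro exp_order_sum exp_order_cmult exp_order_term assms)
  then show ?thesis by (simp add: poly_altdef sum_distrib_right mult.assoc)
qed

text \<open>A nonzero polynomial stays away from 0 near infinity; constants are included, hence only
  some positive bound is claimed.\<close>

lemma poly_bounded_below:
  fixes p :: "complex poly"
  assumes "p \<noteq> 0"
  obtains e r where "e > 0" "\<And>z. norm z \<ge> r \<Longrightarrow> norm (poly p z) \<ge> e"
proof -
  have "\<exists>e>0. \<exists>r. \<forall>z. norm z \<ge> r \<longrightarrow> norm (poly p z) \<ge> e"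
    using assms
  proof (induction p)
    case (pCons a q)
    show ?case
    proof (cases "q = 0")
      case True
      then show ?thesis using pCons.prems by (intro exI[of _ "norm a"]) auto
    next
      case False
      then obtain e r where e: "e > 0" "\<And>z. norm z \<ge> r \<Longrightarrow> norm (poly q z) \<ge> e" using pCons.IH by blast
      have "1 \<le> norm (poly (pCons a q) z)" if z: "norm z \<ge> max r ((norm a + 1) / e)" for z
      proof -
        have "norm a + 1 \<le> norm z * e" using z e(1) by (simp add: field_simps)
        also have "\<dots> \<le> norm (z * poly q z)" unfolding norm_mult using z e(2)[of z] by (intro mult_left_mono) auto
        finally show ?thesis using norm_triangle_ineq2[of "z * poly q z" "- a"] by (simp add: add.commute)
      qed
      then show ?thesis by (intro exI[of _ "1::real"] conjI exI[of _ "max r ((norm a + 1) / e)"]) auto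
    qed
  qed simp
  then show thesis using that by blast
qed

lemma between_finite:
  assumes "finite A" "\<And>\<alpha>. \<alpha> \<in> A \<Longrightarrow> R < \<alpha>"
  obtains \<sigma> :: real where "R < \<sigma>" "\<And>\<alpha>. \<alpha> \<in> A \<Longrightarrow> \<sigma> < \<alpha>" "\<sigma> \<le> R + 1"
proof -
  \<comment> \<open>The element \<open>R + 2\<close> covers the case of empty \<open>A\<close> and
    makes the midpoint at most \<open>R + 1\<close>.\<close>
  define m where "m = Min (insert (R + 2) A)"
  have m: "m \<in> insert (R + 2) A" "\<And>\<alpha>. \<alpha> \<in> A \<Longrightarrow> m \<le> \<alpha>" "m \<le> R + 2"
    using Min_in[of "insert (R + 2) A"] Min_le[of "insert (R + 2) A"] assms(1) unfolding m_def by auto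
  then have "R < m" using assms(2) by auto
  then show thesis using that[of "(R + m) / 2"] m by (force simp: field_simps)
qed

text \<open>Take the least exponent \<beta> below \<open>R\<close> with nonzero polynomial. All
  other terms and the total are of higher order, so this polynomial would decay exponentially along
  the negative real axis.\<close>

lemma explog_unique:
  fixes pc :: "real \<Rightarrow> complex poly"
  assumes A: "finite A" and ord: "exp_order Y R (\<lambda>w. \<Sum>\<alpha>\<in>A. poly (pc \<alpha>) w * exp (of_real \<alpha> * w))"
    and Y: "Y > 0" and a: "\<alpha> \<in> A" "\<alpha> < R"
  shows "pc \<alpha> = 0"
proof (rule ccontr)
  assume "pc \<alpha> \<noteq> 0"
  define B where "B = {\<alpha> \<in> A. \<alpha> < R \<and> pc \<alpha> \<noteq> 0}"
  have B: "finite B" "B \<noteq> {}" using A a \<open>pc \<alpha> \<noteq> 0\<close> by (auto simp: B_def)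
  define \<beta> where "\<beta> = Min B"
  have \<beta>: "\<beta> \<in> B" "\<And>\<gamma>. \<gamma> \<in> B \<Longrightarrow> \<beta> \<le> \<gamma>" using B by (auto simp: \<beta>_def)
  have \<beta>A: "\<beta> \<in> A" "\<beta> < R" "pc \<beta> \<noteq> 0" using \<beta> by (auto simp: B_def)
  define C where "C = {\<gamma> \<in> A - {\<beta>}. pc \<gamma> \<noteq> 0}"
  have C: "finite C" "\<And>\<gamma>. \<gamma> \<in> C \<Longrightarrow> \<beta> < \<gamma>"
    using A \<beta>(2) \<beta>A by (auto simp: C_def B_def) (metis (mono_tags, lifting) \<beta>A(2) less_eq_real_def linorder_not_le order_less_le_trans)
  obtain \<sigma> where \<sigma>: "\<beta> < \<sigma>" "\<And>\<gamma>. \<gamma> \<in> insert R C \<Longrightarrow> \<sigma> < \<gamma>"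
    by (rule between_finite[of "insert R C" \<beta>]) (use C \<beta>A in auto)
  have "(\<Sum>\<alpha>\<in>A. poly (pc \<alpha>) w * exp (of_real \<alpha> * w)) = poly (pc \<beta>) w * exp (of_real \<beta> * w) + (\<Sum>\<alpha>\<in>C. poly (pc \<alpha>) w * exp (of_real \<alpha> * w))" for w
  proof -
    have "(\<Sum>\<alpha>\<in>A - {\<beta>}. poly (pc \<alpha>) w * exp (of_real \<alpha> * w)) = (\<Sum>\<alpha>\<in>C. poly (pc \<alpha>) w * exp (of_real \<alpha> * w))"
      using A by (intro sum.mono_neutral_right) (auto simp: C_def)
    then show ?thesis using sum.remove[OF A \<beta>A(1), of "\<lambda>\<alpha>. poly (pc \<alpha>) w * exp (of_real \<alpha> * w)"] by simp
  qed
  then have "poly (pc \<beta>) w * exp (of_real \<beta> * w) = (\<Sum>\<alpha>\<in>A. poly (pc \<alpha>) w * exp (of_real \<alpha> * w)) - (\<Sum>\<alpha>\<in>C. poly (pc \<alpha>) w * exp (of_real \<alpha> * w))" for w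
    by (simp add: algebra_simps)
  moreover have "exp_order Y \<sigma> (\<lambda>w. (\<Sum>\<alpha>\<in>A. poly (pc \<alpha>) w * exp (of_real \<alpha> * w)) - (\<Sum>\<alpha>\<in>C. poly (pc \<alpha>) w * exp (of_real \<alpha> * w)))"
    using \<sigma> by (intro exp_order_diff exp_order_sum exp_order_poly exp_order_mono[OF ord]) (auto intro: less_imp_le)
  ultimately have o: "exp_order Y \<sigma> (\<lambda>w. poly (pc \<beta>) w * exp (of_real \<beta> * w))" by simp
  obtain K M where K: "\<And>w. Re w \<le> M \<Longrightarrow> \<bar>Im w\<bar> \<le> 0 \<Longrightarrow> norm (poly (pc \<beta>) w * exp (of_real \<beta> * w)) \<le> K * exp (\<sigma> * Re w)"
    using exp_orderD[OF o Y] by metis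
  obtain e r where e: "e > 0" "\<And>z. norm z \<ge> r \<Longrightarrow> norm (poly (pc \<beta>) z) \<ge> e"
    using poly_bounded_below[OF \<beta>A(3)] by metis
  have "e \<le> 0"
  proof (rule exp_tail_limit_bound)
    show "\<sigma> - \<beta> > 0" using \<sigma> by simp
    fix x assume x: "x \<le> min M (- \<bar>r\<bar>)"
    have "e * exp (\<beta> * x) \<le> norm (poly (pc \<beta>) (of_real x)) * exp (\<beta> * x)"
      using e(2)[of "of_real x"] x by (intro mult_right_mono) auto
    also have "\<dots> \<le> K * exp (\<sigma> * x)" using K[of "of_real x"] x by (simp add: norm_mult)
    finally show "e \<le> 0 + K * exp ((\<sigma> - \<beta>) * x)" by (simp add: left_diff_distrib exp_diff field_simps)
  qed
  then show False using e by simp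
qed

definition log_sum :: "gen_series \<Rightarrow> real \<Rightarrow> complex \<Rightarrow> complex" where
  "log_sum g R w = (\<Sum>\<alpha> | 0 \<le> \<alpha> \<and> \<alpha> \<le> R \<and> fst g \<alpha> \<noteq> 0. fst g \<alpha> * poly (snd g \<alpha>) w * exp (of_real \<alpha> * w))"

lemma partial_series_conv: "partial_series g R z = log_sum g R (llog z)"
  by (simp add: partial_series_def log_sum_def lpow_def)

lemma corner_exps_nonneg:
  assumes "(\<alpha>, j) \<in> corner_exps \<theta> d" "\<theta> > 0"
  shows "0 \<le> \<alpha>" "\<alpha> = 0 \<Longrightarrow> d > 0 \<Longrightarrow> j = 0" "\<theta> / pi \<notin> \<rat> \<Longrightarrow> j = 0"
proof -
  have "0 \<le> \<alpha> \<and> (d > 0 \<longrightarrow> 0 < \<alpha>)" if "\<alpha> \<in> lattice_exps \<theta> d"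
    using that assms(2) unfolding lattice_exps_def
    by (auto intro!: add_pos_nonneg add_nonneg_nonneg)
  then show "0 \<le> \<alpha>" "\<alpha> = 0 \<Longrightarrow> d > 0 \<Longrightarrow> j = 0" "\<theta> / pi \<notin> \<rat> \<Longrightarrow> j = 0"
    using assms by (auto simp: corner_exps_def)
qed

text \<open>Coefficients taken from different orders agree wherever both are determined, by
  uniqueness. The remainder has an order strictly above \<open>R\<close>, from which the little-o
  estimate will follow.\<close>

theorem coherent_expansion:
  assumes ex: "\<And>R. \<exists>P \<in> explog (corner_exps \<theta> d). exp_order Y R (\<lambda>w. F w - P w)"
    and \<theta>: "\<theta> > 0" and d: "d > 0" and Y: "Y > 0"
  obtains g where "g \<in> log_series" "\<theta> / pi \<notin> \<rat> \<Longrightarrow> g \<in> power_series_real_exp"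
    "\<And>R. \<exists>\<sigma>>R. exp_order Y \<sigma> (\<lambda>w. F w - log_sum g R w)"
proof -
  have "\<forall>R. \<exists>pc. finite {\<alpha>. pc \<alpha> \<noteq> 0} \<and> (\<forall>\<alpha> j. coeff (pc \<alpha>) j \<noteq> 0 \<longrightarrow> (\<alpha>, j) \<in> corner_exps \<theta> d) \<and>
     (\<forall>A. finite A \<longrightarrow> {\<alpha>. pc \<alpha> \<noteq> 0} \<subseteq> A \<longrightarrow> exp_order Y R (\<lambda>w. F w - (\<Sum>\<alpha>\<in>A. poly (pc \<alpha>) w * exp (of_real \<alpha> * w))))"
  proof
    fix R
    obtain P where P: "P \<in> explog (corner_exps \<theta> d)" "exp_order Y R (\<lambda>w. F w - P w)" using ex by blast
    from explog_representation[OF P(1)] obtain pc where pc: "finite {\<alpha>. pc \<alpha> \<noteq> 0}"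
      and g1: "\<forall>\<alpha> j. coeff (pc \<alpha>) j \<noteq> 0 \<longrightarrow> (\<alpha>, j) \<in> corner_exps \<theta> d"
      and pc3: "\<forall>A w. finite A \<longrightarrow> {\<alpha>. pc \<alpha> \<noteq> 0} \<subseteq> A \<longrightarrow> P w = (\<Sum>\<alpha>\<in>A. poly (pc \<alpha>) w * exp (of_real \<alpha> * w))"
      by (elim exE conjE)
    have g2: "\<forall>A. finite A \<longrightarrow> {\<alpha>. pc \<alpha> \<noteq> 0} \<subseteq> A \<longrightarrow> exp_order Y R (\<lambda>w. F w - (\<Sum>\<alpha>\<in>A. poly (pc \<alpha>) w * exp (of_real \<alpha> * w)))"
    proof (intro allI impI)
      fix A assume "finite A" "{\<alpha>. pc \<alpha> \<noteq> 0} \<subseteq> A"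
      from pc3[rule_format, OF this] P(2) show "exp_order Y R (\<lambda>w. F w - (\<Sum>\<alpha>\<in>A. poly (pc \<alpha>) w * exp (of_real \<alpha> * w)))"
        by simp
    qed
    show "\<exists>pc. finite {\<alpha>. pc \<alpha> \<noteq> 0} \<and> (\<forall>\<alpha> j. coeff (pc \<alpha>) j \<noteq> 0 \<longrightarrow> (\<alpha>, j) \<in> corner_exps \<theta> d) \<and>
     (\<forall>A. finite A \<longrightarrow> {\<alpha>. pc \<alpha> \<noteq> 0} \<subseteq> A \<longrightarrow> exp_order Y R (\<lambda>w. F w - (\<Sum>\<alpha>\<in>A. poly (pc \<alpha>) w * exp (of_real \<alpha> * w))))"
      by (rule exI[of _ pc], rule conjI[OF pc conjI[OF g1 g2]])
  qed
  from choice[OF this] obtain PC where "\<forall>R. finite {\<alpha>. PC R \<alpha> \<noteq> 0} \<and> (\<forall>\<alpha> j. coeff (PC R \<alpha>) j \<noteq> 0 \<longrightarrow> (\<alpha>, j) \<in> corner_exps \<theta> d) \<and>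
     (\<forall>A. finite A \<longrightarrow> {\<alpha>. PC R \<alpha> \<noteq> 0} \<subseteq> A \<longrightarrow> exp_order Y R (\<lambda>w. F w - (\<Sum>\<alpha>\<in>A. poly (PC R \<alpha>) w * exp (of_real \<alpha> * w))))" ..
  then have PC: "finite {\<alpha>. PC R \<alpha> \<noteq> 0}" "coeff (PC R \<alpha>) j \<noteq> 0 \<Longrightarrow> (\<alpha>, j) \<in> corner_exps \<theta> d"
     "finite A \<Longrightarrow> {\<alpha>. PC R \<alpha> \<noteq> 0} \<subseteq> A \<Longrightarrow> exp_order Y R (\<lambda>w. F w - (\<Sum>\<alpha>\<in>A. poly (PC R \<alpha>) w * exp (of_real \<alpha> * w)))" for R \<alpha> j A
    by blast+
  have coh: "PC R1 \<alpha> = PC R2 \<alpha>" if \<alpha>: "\<alpha> < R1" "\<alpha> < R2" for R1 R2 \<alpha>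
  proof -
    define A where "A = insert \<alpha> ({\<alpha>. PC R1 \<alpha> \<noteq> 0} \<union> {\<alpha>. PC R2 \<alpha> \<noteq> 0})"
    have A: "finite A" "{\<alpha>. PC R1 \<alpha> \<noteq> 0} \<subseteq> A" "{\<alpha>. PC R2 \<alpha> \<noteq> 0} \<subseteq> A" "\<alpha> \<in> A" using PC(1) by (auto simp: A_def)
    have "exp_order Y (min R1 R2) (\<lambda>w. (F w - (\<Sum>\<alpha>\<in>A. poly (PC R2 \<alpha>) w * exp (of_real \<alpha> * w))) - (F w - (\<Sum>\<alpha>\<in>A. poly (PC R1 \<alpha>) w * exp (of_real \<alpha> * w))))"
      by (intro exp_order_diff exp_order_mono[OF PC(3)[OF A(1,2)]] exp_order_mono[OF PC(3)[OF A(1,3)]]) auto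
    then have "exp_order Y (min R1 R2) (\<lambda>w. \<Sum>\<alpha>\<in>A. poly (PC R1 \<alpha> - PC R2 \<alpha>) w * exp (of_real \<alpha> * w))"
      by (simp add: sum_subtractf left_diff_distrib)
    from explog_unique[OF A(1) this Y A(4)] \<alpha> show ?thesis by simp
  qed
  define pc where "pc \<alpha> = PC (\<alpha> + 1) \<alpha>" for \<alpha>
  have pc: "pc \<alpha> = PC R \<alpha>" if "\<alpha> < R" for \<alpha> R unfolding pc_def using that by (intro coh) auto
  define a where "a \<alpha> = lead_coeff (pc \<alpha>)" for \<alpha>
  \<comment> \<open>Normalised to be monic. The value 1 is the default at exponents that do not
    occur, since \<open>log_series\<close> asks for monic polynomials at every nonnegative
    exponent.\<close>
  define P where "P \<alpha> = (if pc \<alpha> = 0 then 1 else smult (1 / lead_coeff (pc \<alpha>)) (pc \<alpha>))" for \<alpha>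
  have a0: "a \<alpha> = 0 \<longleftrightarrow> pc \<alpha> = 0" for \<alpha> by (simp add: a_def)
  have aP: "a \<alpha> * poly (P \<alpha>) w = poly (pc \<alpha>) w" for \<alpha> w by (simp add: a_def P_def)
  have pc_nonneg: "0 \<le> \<alpha>" if "pc \<alpha> \<noteq> 0" for \<alpha>
    using PC(2)[of "\<alpha> + 1" \<alpha> "degree (pc \<alpha>)"] that corner_exps_nonneg(1)[OF _ \<theta>] by (simp add: pc_def [symmetric])
  have deg0: "P \<alpha> = 1" if "\<And>j. (\<alpha>, j) \<in> corner_exps \<theta> d \<Longrightarrow> j = 0" for \<alpha>
  proof (cases "pc \<alpha> = 0")
    case False
    then have "degree (pc \<alpha>) = 0"
      using PC(2)[of "\<alpha> + 1" \<alpha> "degree (pc \<alpha>)"] that by (simp add: pc_def [symmetric])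
    then obtain c where "pc \<alpha> = [:c:]" by (elim degree_eq_zeroE)
    then show ?thesis using False by (simp add: P_def one_pCons)
  qed (simp add: P_def)
  have fin: "finite {\<alpha>. \<alpha> \<le> R \<and> pc \<alpha> \<noteq> 0}" for R
    by (rule finite_subset[OF _ PC(1)[of "R + 1"]]) (use pc[of _ "R + 1"] in auto)
  have ls: "(a, P) \<in> log_series"
    unfolding log_series_def
  proof (clarify, intro conjI allI impI)
    show "lead_coeff (P \<alpha>) = 1" for \<alpha> by (simp add: P_def)
    show "P 0 = 1" by (rule deg0) (use corner_exps_nonneg(2)[OF _ \<theta> _ d] in blast)
    show "finite ({\<alpha>. 0 \<le> \<alpha> \<and> a \<alpha> \<noteq> 0} \<inter> {0..R})" for R
      by (rule finite_subset[OF _ fin[of R]]) (auto simp: a0)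
  qed
  moreover have "(a, P) \<in> power_series_real_exp" if "\<theta> / pi \<notin> \<rat>"
    unfolding power_series_real_exp_def using ls deg0 corner_exps_nonneg(3)[OF _ \<theta> that] by auto
  moreover have "\<exists>\<sigma>>R. exp_order Y \<sigma> (\<lambda>w. F w - log_sum (a, P) R w)" for R
  proof -
    \<comment> \<open>The expansion to order \<open>R + 1\<close> is used and its finitely many
      terms above \<open>R\<close> are discarded; the gap below them makes the order of the
      remainder exceed \<open>R\<close>.\<close>
    define A where "A = {\<alpha>. PC (R + 1) \<alpha> \<noteq> 0}"
    have A: "finite A" "{\<alpha>. PC (R + 1) \<alpha> \<noteq> 0} \<subseteq> A" using PC(1) by (auto simp: A_def)
    define B where "B = {\<alpha> \<in> A. \<alpha> > R}"
    obtain \<sigma> where \<sigma>: "R < \<sigma>" "\<And>\<alpha>. \<alpha> \<in> B \<Longrightarrow> \<sigma> < \<alpha>" "\<sigma> \<le> R + 1"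
      by (rule between_finite[of B R]) (use A in \<open>auto simp: B_def\<close>)
    have ls_eq: "log_sum (a, P) R w = (\<Sum>\<alpha>\<in>A - B. poly (PC (R + 1) \<alpha>) w * exp (of_real \<alpha> * w))" for w
    proof -
      have "{\<alpha>. 0 \<le> \<alpha> \<and> \<alpha> \<le> R \<and> a \<alpha> \<noteq> 0} = A - B"
        using pc[of _ "R + 1"] pc_nonneg by (auto simp: A_def B_def a0)
      moreover have "poly (pc \<alpha>) w = poly (PC (R + 1) \<alpha>) w" if "\<alpha> \<in> A - B" for \<alpha>
        using that pc[of \<alpha> "R + 1"] by (auto simp: B_def)
      ultimately show ?thesis unfolding log_sum_def by (auto simp: aP intro!: sum.cong)
    qed
    have "(\<Sum>\<alpha>\<in>A. poly (PC (R + 1) \<alpha>) w * exp (of_real \<alpha> * w)) = log_sum (a, P) R w + (\<Sum>\<alpha>\<in>B. poly (PC (R + 1) \<alpha>) w * exp (of_real \<alpha> * w))" for w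
      unfolding ls_eq using A by (intro sum.subset_diff) (auto simp: B_def)
    then have eq: "F w - log_sum (a, P) R w = (F w - (\<Sum>\<alpha>\<in>A. poly (PC (R + 1) \<alpha>) w * exp (of_real \<alpha> * w))) + (\<Sum>\<alpha>\<in>B. poly (PC (R + 1) \<alpha>) w * exp (of_real \<alpha> * w))" for w
      by simp
    have "exp_order Y \<sigma> (\<lambda>w. F w - log_sum (a, P) R w)"
      unfolding eq by (intro exp_order_add exp_order_mono[OF PC(3)[OF A]] exp_order_sum exp_order_poly \<sigma>)
    then show ?thesis using \<sigma>(1) by blast
  qed
  ultimately show thesis by (rule that)
qed

section \<open>Geometry of the corner in the logarithmic chart\<close>
abbreviation left_infinity :: "complex filter" where
  "left_infinity \<equiv> filtercomap Re at_bot"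

lemma near_trans_filterlim:
  assumes "near_trans c A"
  shows "filterlim A left_infinity left_infinity"
  unfolding filterlim_iff eventually_Re_at_bot
proof (intro allI impI)
  fix P assume "\<exists>M. \<forall>w. Re w \<le> M \<longrightarrow> P w"
  then obtain M where "\<And>w. Re w \<le> M \<Longrightarrow> P w" by blast
  moreover obtain M' where "\<And>s. Re s \<le> M' \<Longrightarrow> Re (A s) \<le> M" using near_trans_Re[OF assms, of M] by metis
  ultimately show "\<exists>M. \<forall>s. Re s \<le> M \<longrightarrow> P (A s)" by blast
qed

lemma near_trans_eventually:
  assumes "near_trans c A" "eventually P left_infinity"
  shows "eventually (\<lambda>s. P (A s)) left_infinity"
  using near_trans_filterlim[OF assms(1)] assms(2) by (auto simp: filterlim_iff)

lemma near_trans_eventually_close: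
  assumes "near_trans c A" "e > 0"
  shows "eventually (\<lambda>s. norm (A s - s - c) \<le> e) left_infinity"
  using near_trans_close[OF assms] unfolding eventually_Re_at_bot by metis

lemma near_trans_translation: "near_trans c (\<lambda>s. s + c)"
  unfolding near_trans_def by (rule exI[of _ 1], rule conjI[OF zero_less_one], rule exI[of _ "\<lambda>_. 0"]) auto

lemma eventually_exp_Re_left_infinity:
  assumes "eventually P (at_right 0)"
  shows "eventually (\<lambda>w. P (exp (Re w))) left_infinity"
proof -
  obtain e where e: "e > 0" "\<And>x. 0 < x \<Longrightarrow> x < e \<Longrightarrow> P x"
    using assms unfolding eventually_at_right_field by auto
  have "P (exp (Re w))" if "Re w \<le> ln (e / 2)" for w
  proof -
    have "exp (Re w) \<le> e / 2" using Re_le_ln_imp[of "e/2" w] that e by simp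
    then show ?thesis using e by auto
  qed
  then show ?thesis unfolding eventually_Re_at_bot by blast
qed

text \<open>Compare \<open>A s\<close> with the arc point of the same modulus. The contraction
  estimate changes the vertical offset \<open>Im s\<close> by at most half its size, so its sign is
  kept.\<close>

lemma near_trans_side:
  assumes A: "near_trans c A" and curve: "\<And>\<sigma>. \<sigma> \<le> M0 \<Longrightarrow> Im (A (of_real \<sigma>)) = a (exp (Re (A (of_real \<sigma>))))"
  shows "eventually (\<lambda>s. (0 < Im s \<longrightarrow> a (exp (Re (A s))) < Im (A s)) \<and> (Im s < 0 \<longrightarrow> Im (A s) < a (exp (Re (A s))))
     \<and> (Im s = 0 \<longrightarrow> Im (A s) = a (exp (Re (A s))))) left_infinity"
proof -
  obtain M1 where M1: "\<And>s s'. Re s \<le> M1 \<Longrightarrow> Re s' \<le> M1 \<Longrightarrow> norm ((A s - s) - (A s' - s')) \<le> norm (s - s') / 2"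
    using near_trans_lipschitz[OF A] by metis
  obtain M2 where M2: "A holomorphic_on {s. Re s < M2}" using near_trans_holomorphic[OF A] by metis
  define m where "m = min (min M0 M1) (M2 - 1)"
  have ev: "eventually (\<lambda>s. Re (A s) \<le> Re (A (of_real m))) left_infinity"
    by (rule near_trans_eventually[OF A]) (auto simp: eventually_Re_at_bot)
  have key: "\<exists>\<sigma>. Im (A (of_real \<sigma>)) = a (exp (Re (A s))) \<and> norm ((A s - s) - (A (of_real \<sigma>) - of_real \<sigma>)) \<le> norm (s - of_real \<sigma>) / 2
      \<and> Re (A (of_real \<sigma>)) = Re (A s)"
    if s: "Re s \<le> m" "Re (A s) \<le> Re (A (of_real m))" for s
  proof -
    obtain M3 where M3: "\<And>t. Re t \<le> M3 \<Longrightarrow> Re (A t) \<le> Re (A s)" using near_trans_Re[OF A, of "Re (A s)"] by metis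
    define \<sigma>1 where "\<sigma>1 = min M3 m"
    \<comment> \<open>The intermediate value theorem for the real part of \<open>A\<close> along the
      real axis.\<close>
    have "\<exists>\<sigma>. \<sigma>1 \<le> \<sigma> \<and> \<sigma> \<le> m \<and> Re (A (of_real \<sigma>)) = Re (A s)"
    proof (rule IVT')
      show "Re (A (of_real \<sigma>1)) \<le> Re (A s)" by (rule M3) (simp add: \<sigma>1_def)
      have "continuous_on {s. Re s < M2} A" using M2 by (rule holomorphic_on_imp_continuous_on)
      then have "continuous_on {\<sigma>1..m} (\<lambda>\<sigma>. A (of_real \<sigma>))"
        by (rule continuous_on_compose2) (auto intro!: continuous_intros simp: m_def)
      then show "continuous_on {\<sigma>1..m} (\<lambda>\<sigma>. Re (A (of_real \<sigma>)))" by (intro continuous_intros)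
    qed (use s in \<open>auto simp: \<sigma>1_def\<close>)
    then obtain \<sigma> where \<sigma>: "\<sigma> \<le> m" "Re (A (of_real \<sigma>)) = Re (A s)" by blast
    have "Im (A (of_real \<sigma>)) = a (exp (Re (A (of_real \<sigma>))))" using \<sigma> by (intro curve) (simp add: m_def)
    moreover have "norm ((A s - s) - (A (of_real \<sigma>) - of_real \<sigma>)) \<le> norm (s - of_real \<sigma>) / 2"
      using \<sigma> s by (intro M1) (auto simp: m_def)
    ultimately show ?thesis using \<sigma> by auto
  qed
  have "eventually (\<lambda>s. Re s \<le> m) left_infinity" by (auto simp: eventually_Re_at_bot)
  with ev show ?thesis
  proof eventually_elim
    case (elim s)
    obtain \<sigma> where \<sigma>: "Im (A (of_real \<sigma>)) = a (exp (Re (A s)))"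
      "norm ((A s - s) - (A (of_real \<sigma>) - of_real \<sigma>)) \<le> norm (s - of_real \<sigma>) / 2" "Re (A (of_real \<sigma>)) = Re (A s)"
      using key elim by blast
    define v where "v = s - of_real \<sigma>"
    \<comment> \<open>\<open>A s\<close> minus the arc point is \<open>v + e\<close> and purely
      imaginary, so \<open>Re e = - Re v\<close>. Inserted into
      \<open>norm e \<le> norm v / 2\<close> this leaves
      \<open>\<bar>Im e\<bar> \<le> \<bar>Im s\<bar> / 2\<close>.\<close>
    define e where "e = (A s - s) - (A (of_real \<sigma>) - of_real \<sigma>)"
    have Ree: "Re e = - Re v" using \<sigma>(3) by (simp add: e_def v_def)
    have Ime: "Im (A s) - a (exp (Re (A s))) = Im s + Im e" using \<sigma>(1) by (simp add: e_def)
    have Imv: "Im v = Im s" by (simp add: v_def)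
    have "norm e \<le> norm v / 2" using \<sigma>(2) by (simp add: e_def v_def)
    then have "(norm e)\<^sup>2 \<le> (norm v / 2)\<^sup>2" by (intro power_mono) auto
    then have le: "4 * ((Re v)\<^sup>2 + (Im e)\<^sup>2) \<le> (Re v)\<^sup>2 + (Im s)\<^sup>2"
      by (simp add: cmod_power2 power_divide Ree Imv)
    have sq: "4 * (Im e)\<^sup>2 \<le> (Im s)\<^sup>2"
    proof -
      have "4 * q \<le> r" if "4 * (p + q) \<le> p + r" "0 \<le> p" for p q r :: real using that by simp
      from this[OF le zero_le_power2] show ?thesis .
    qed
    then have "(2 * Im e)\<^sup>2 \<le> (Im s)\<^sup>2" by (simp add: power_mult_distrib)
    then have "\<bar>2 * Im e\<bar> \<le> \<bar>Im s\<bar>" by (simp add: abs_le_square_iff)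
    then show ?case using Ime by (auto simp: abs_if split: if_splits)
  qed
qed

text \<open>The logarithm of the arc and the polar angle \<open>a\<close> describe the same point,
  and both imaginary parts are within 1 of \<alpha>; as their distance is less than
  \<open>2 * pi\<close>, they coincide.\<close>

lemma arc_logarithm:
  assumes hol: "\<psi> holomorphic_on ball 0 1" and \<psi>0: "\<psi> 0 = 0" and d: "deriv \<psi> 0 \<noteq> 0" "sgn (deriv \<psi> 0) = cis \<alpha>"
    and a: "(a \<longlongrightarrow> \<alpha>) (at_right 0)" and \<rho>: "\<rho> > 0" and \<delta>: "\<delta> \<in> {0<..1::real}"
    and img: "(\<lambda>t. \<psi> (of_real t)) ` {0<..<\<delta>} = {rcis s (a s) | s. 0 < s \<and> s < \<rho>}"
  obtains A c M where "near_trans c A" "Im c = \<alpha>" "\<And>s. Re s \<le> M \<Longrightarrow> exp (A s) = \<psi> (exp s)"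
    "\<And>\<sigma>. \<sigma> \<le> M \<Longrightarrow> Im (A (of_real \<sigma>)) = a (exp (Re (A (of_real \<sigma>))))" "\<And>\<sigma>. \<sigma> \<le> M \<Longrightarrow> exp \<sigma> < \<delta>"
proof -
  \<comment> \<open>The branch of the logarithm of the derivative is fixed by the angle \<alpha>,
    which need not be its principal argument.\<close>
  define c where "c = Complex (ln (norm (deriv \<psi> 0))) \<alpha>"
  have "exp c = of_real (norm (deriv \<psi> 0)) * cis \<alpha>" using d(1) by (simp add: c_def exp_eq_polar)
  also have "\<dots> = deriv \<psi> 0" using d by (simp add: d(2) [symmetric] sgn_eq)
  finally have "deriv \<psi> 0 = exp c" by simp
  then obtain A M1 where A: "near_trans c A" "\<And>s. Re s \<le> M1 \<Longrightarrow> exp (A s) = \<psi> (exp s)"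
    using near_trans_of_holomorphic[OF hol _ \<psi>0] by (metis zero_less_one)
  obtain M2 where M2: "\<And>s. Re s \<le> M2 \<Longrightarrow> norm (A s - s - c) \<le> 1" using near_trans_close[OF A(1), of 1] by auto
  have "eventually (\<lambda>x. \<bar>a x - \<alpha>\<bar> < 1) (at_right 0)"
    using tendstoD[OF a, of 1] by (simp add: dist_real_def)
  from near_trans_eventually[OF A(1) eventually_exp_Re_left_infinity[OF this]]
  obtain M3 where M3: "\<And>s. Re s \<le> M3 \<Longrightarrow> \<bar>a (exp (Re (A s))) - \<alpha>\<bar> < 1" unfolding eventually_Re_at_bot by blast
  define M where "M = min (min M1 M2) (min M3 (ln (\<delta> / 2)))"
  have e\<delta>: "exp \<sigma> < \<delta>" if "\<sigma> \<le> M" for \<sigma>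
  proof -
    have "norm (exp (of_real \<sigma> :: complex)) \<le> \<delta> / 2" using that \<delta> by (intro Re_le_ln_imp) (auto simp: M_def)
    then show ?thesis using \<delta> by simp
  qed
  show thesis
  proof (rule that[of c A M, OF A(1) _ _ _ e\<delta>])
    show "Im c = \<alpha>" by (simp add: c_def)
    fix s assume "Re s \<le> M"
    then show "exp (A s) = \<psi> (exp s)" by (intro A) (simp add: M_def)
  next
    fix \<sigma> assume \<sigma>: "\<sigma> \<le> M"
    have "\<psi> (of_real (exp \<sigma>)) \<in> {rcis s (a s) | s. 0 < s \<and> s < \<rho>}"
      unfolding img [symmetric] by (rule image_eqI[of _ _ "exp \<sigma>"]) (use e\<delta>[OF \<sigma>] in auto)
    then obtain x where x: "0 < x" "x < \<rho>" "\<psi> (of_real (exp \<sigma>)) = rcis x (a x)" by blast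
    have e: "exp (A (of_real \<sigma>)) = rcis x (a x)"
      using A(2)[of "of_real \<sigma>"] \<sigma> x(3) by (simp add: M_def exp_of_real)
    then have "norm (exp (A (of_real \<sigma>))) = x" using x by simp
    then have xA: "x = exp (Re (A (of_real \<sigma>)))" by simp
    have "exp (A (of_real \<sigma>)) = exp (Complex (Re (A (of_real \<sigma>))) (a x))"
      unfolding e by (simp add: rcis_def exp_eq_polar xA)
    moreover have "\<bar>Im (A (of_real \<sigma>)) - Im (Complex (Re (A (of_real \<sigma>))) (a x))\<bar> < 2 * pi"
    proof -
      have "\<bar>Im (A (of_real \<sigma>)) - \<alpha>\<bar> \<le> 1"
        using abs_Im_le_cmod[of "A (of_real \<sigma>) - of_real \<sigma> - c"] M2[of "of_real \<sigma>"] \<sigma> by (simp add: M_def c_def)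
      moreover have "\<bar>a x - \<alpha>\<bar> < 1" using M3[of "of_real \<sigma>"] \<sigma> by (simp add: M_def xA)
      ultimately show ?thesis using pi_gt3 by simp
    qed
    ultimately have "A (of_real \<sigma>) = Complex (Re (A (of_real \<sigma>))) (a x)" by (rule exp_complex_eqI[rotated])
    then have "Im (A (of_real \<sigma>)) = a x" by (metis complex.sel(2))
    then show "Im (A (of_real \<sigma>)) = a (exp (Re (A (of_real \<sigma>))))" by (simp only: xA [symmetric])
  qed
qed

text \<open>Convergence at a single positive \<open>t\<close> gives a disc of convergence in the
  variable \<open>t powr (1 / d)\<close>. The coefficients are real, which yields the symmetry under
  conjugation that reflection uses.\<close>

lemma convergent_puiseux_holomorphic:
  assumes g: "convergent_puiseux \<epsilon> g" and \<epsilon>: "\<epsilon> > 0"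
  obtains d :: nat and k r where "d > 0" "r > 0" "k holomorphic_on ball 0 r" "\<And>x. x \<in> ball 0 r \<Longrightarrow> k (cnj x) = cnj (k x)"
    "\<And>t. 0 < t \<Longrightarrow> t < \<epsilon> \<Longrightarrow> of_real (g t) = k (of_real (t powr (1 / real d)))"
proof -
  obtain c :: "nat \<Rightarrow> real" and d :: nat where d: "d > 0" and sums: "\<And>t. t \<in> {0<..<\<epsilon>} \<Longrightarrow> (\<lambda>n. c n * t powr (real n / real d)) sums g t"
    using g unfolding convergent_puiseux_def by blast
  define k where "k x = (\<Sum>n. of_real (c n) * x ^ n)" for x :: complex
  \<comment> \<open>Taken at \<open>\<epsilon> / 2\<close>, an interior point where the series is
    known to converge.\<close>
  define r where "r = (\<epsilon> / 2) powr (1 / real d)"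
  have r: "r > 0" using \<epsilon> by (simp add: r_def)
  have pw: "(t powr (1 / real d)) ^ n = t powr (real n / real d)" if "t > 0" for t n
    using that by (simp add: powr_realpow [symmetric] powr_powr)
  have sum: "(\<lambda>n. of_real (c n) * of_real (t powr (1 / real d)) ^ n) sums complex_of_real (g t)" if "0 < t" "t < \<epsilon>" for t
    using sums_of_real[OF sums[of t], where 'a = complex] that by (simp add: pw [symmetric])
  have "summable (\<lambda>n. of_real (c n) * complex_of_real r ^ n)"
    using sum[of "\<epsilon>/2"] \<epsilon> by (auto simp: r_def dest: sums_summable)
  then have rad: "summable (\<lambda>n. of_real (c n) * x ^ n)" if "norm x < r" for x :: complex
    by (rule powser_inside) (use that r in simp)
  have "k holomorphic_on ball 0 r"
  proof (rule power_series_holomorphic)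
    fix w :: complex assume "w \<in> ball 0 r"
    then have "summable (\<lambda>n. of_real (c n) * w ^ n)" by (intro rad) simp
    then show "(\<lambda>n. of_real (c n) * (w - 0) ^ n) sums k w" unfolding k_def by (simp add: summable_sums)
  qed
  moreover have "k (cnj x) = cnj (k x)" if "x \<in> ball 0 r" for x
  proof -
    have "summable (\<lambda>n. of_real (c n) * x ^ n)" using that by (intro rad) simp
    then have "(\<lambda>n. cnj (of_real (c n) * x ^ n)) sums cnj (k x)"
      unfolding k_def by (simp only: sums_cnj summable_sums)
    then show ?thesis unfolding k_def by (simp add: sums_unique [symmetric])
  qed
  moreover have "of_real (g t) = k (of_real (t powr (1 / real d)))" if "0 < t" "t < \<epsilon>" for t
    unfolding k_def using sum[OF that] by (simp add: sums_iff)
  ultimately show thesis using that d r by blast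
qed

text \<open>\<open>exp (B s / d)\<close> is a holomorphic function of \<open>exp (s / d)\<close>,
  since \<open>B s\<close> differs from \<open>s\<close> by a holomorphic function of
  \<open>exp s = exp (s / d) ^ d\<close>. Boundary data thus keep their form after a change of
  coordinate.\<close>

lemma holomorphic_of_near_trans:
  fixes d :: nat
  assumes B: "near_trans c B" and k: "k holomorphic_on ball 0 r" "r > 0" and d: "d > 0"
  obtains K r' where "r' > 0" "K holomorphic_on ball 0 r'" "K 0 = k 0"
    "\<And>s. k (exp (B s / of_nat d)) = K (exp (s / of_nat d))"
proof -
  obtain r1 b where b: "r1 > 0" "b holomorphic_on ball 0 r1" "b 0 = 0" "\<And>s. B s = s + c + b (exp s)"
    using near_transE[OF B] by blast
  define \<psi> where "\<psi> q = q * exp ((c + b (q ^ d)) / of_nat d)" for q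
  \<comment> \<open>The bound 1 ensures \<open>norm (q ^ d) \<le> norm q\<close>, so that
    \<open>b\<close> may be evaluated at \<open>q ^ d\<close>.\<close>
  define r2 where "r2 = min 1 r1"
  have r2: "r2 > 0" using b by (simp add: r2_def)
  have pow: "q ^ d \<in> ball 0 r1" if "q \<in> ball 0 r2" for q :: complex
  proof -
    have "norm q ^ d \<le> norm q ^ 1" using that d by (intro power_decreasing) (auto simp: r2_def)
    then show ?thesis using that by (auto simp: norm_power r2_def)
  qed
  have hol: "\<psi> holomorphic_on ball 0 r2"
    unfolding \<psi>_def [abs_def]
    by (intro holomorphic_intros holomorphic_on_compose_gen[of "\<lambda>q. q ^ d" _ b "ball 0 r1", unfolded o_def] b)
       (use pow d in auto)
  have \<psi>0: "\<psi> 0 = 0" by (simp add: \<psi>_def)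
  have "continuous (at 0) \<psi>"
    using holomorphic_on_imp_continuous_on[OF hol] r2 by (simp add: continuous_on_eq_continuous_at)
  then obtain e where e: "e > 0" "\<And>q. dist q 0 < e \<Longrightarrow> dist (\<psi> q) (\<psi> 0) < r"
    using k(2) unfolding continuous_at_eps_delta by metis
  define r' where "r' = min r2 e"
  have "(k \<circ> \<psi>) holomorphic_on ball 0 r'"
    by (rule holomorphic_on_compose_gen[OF holomorphic_on_subset[OF hol] k(1)])
       (use e(2) \<psi>0 in \<open>auto simp: r'_def\<close>)
  moreover have "r' > 0" using r2 e by (simp add: r'_def)
  moreover have "exp (s / of_nat d) ^ d = exp s" for s :: complex
    using d by (simp add: exp_of_nat_mult [symmetric])
  then have "k (exp (B s / of_nat d)) = (k \<circ> \<psi>) (exp (s / of_nat d))" for s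
    by (simp add: \<psi>_def b(4) exp_add [symmetric] add_divide_distrib add.assoc)
  ultimately show thesis using that[of r' "k \<circ> \<psi>"] \<psi>0 by simp
qed

lemma exp_order_near_trans:
  assumes G: "exp_order Y \<rho> G" and A: "near_trans (of_real c) A"
  shows "exp_order Y \<rho> (\<lambda>s. G (A s))"
proof (rule exp_orderI)
  fix y assume "y < Y"
  define e where "e = min 1 ((Y - y) / 2)"
  have e: "e > 0" "e \<le> 1" "y + e < Y" using \<open>y < Y\<close> by (auto simp: e_def min_def field_simps)
  obtain C M where C: "C > 0" "\<And>w. Re w \<le> M \<Longrightarrow> \<bar>Im w\<bar> \<le> y + e \<Longrightarrow> norm (G w) \<le> C * exp (\<rho> * Re w)"
    using exp_orderD[OF G e(3)] by metis
  obtain M1 where M1: "\<And>s. Re s \<le> M1 \<Longrightarrow> norm (A s - s - of_real c) \<le> e" using near_trans_close[OF A e(1)] by metis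
  obtain M2 where M2: "\<And>s. Re s \<le> M2 \<Longrightarrow> Re (A s) \<le> M" using near_trans_Re[OF A, of M] by metis
  show "\<exists>C M. \<forall>w. Re w \<le> M \<longrightarrow> \<bar>Im w\<bar> \<le> y \<longrightarrow> norm (G (A w)) \<le> C * exp (\<rho> * Re w)"
  proof (rule exI[of _ "C * exp (\<bar>\<rho>\<bar> * (\<bar>c\<bar> + 1))"], rule exI[of _ "min M1 M2"], intro allI impI)
    fix s assume s: "Re s \<le> min M1 M2" "\<bar>Im s\<bar> \<le> y"
    have n: "norm (A s - s - of_real c) \<le> e" using M1 s by simp
    have "\<bar>Im (A s) - Im s\<bar> \<le> e" using abs_Im_le_cmod[of "A s - s - of_real c"] n by simp
    then have 1: "norm (G (A s)) \<le> C * exp (\<rho> * Re (A s))" using s M2 by (intro C) auto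
    have "\<bar>Re (A s) - Re s\<bar> \<le> \<bar>c\<bar> + 1" using abs_Re_le_cmod[of "A s - s - of_real c"] n e by simp
    then have "\<bar>\<rho>\<bar> * \<bar>Re (A s) - Re s\<bar> \<le> \<bar>\<rho>\<bar> * (\<bar>c\<bar> + 1)" by (rule mult_left_mono) simp
    moreover have "\<rho> * (Re (A s) - Re s) \<le> \<bar>\<rho>\<bar> * \<bar>Re (A s) - Re s\<bar>" by (metis abs_ge_self abs_mult)
    ultimately have "\<rho> * Re (A s) \<le> \<bar>\<rho>\<bar> * (\<bar>c\<bar> + 1) + \<rho> * Re s" by (simp add: algebra_simps)
    then have "C * exp (\<rho> * Re (A s)) \<le> C * exp (\<bar>\<rho>\<bar> * (\<bar>c\<bar> + 1)) * exp (\<rho> * Re s)"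
      using C(1) by (simp add: exp_add [symmetric])
    with 1 show "norm (G (A s)) \<le> C * exp (\<bar>\<rho>\<bar> * (\<bar>c\<bar> + 1)) * exp (\<rho> * Re s)" by (rule order.trans)
  qed
qed

section \<open>Extension across the two arcs\<close>
lemma near_trans_Im_close:
  "norm (w - s - c) \<le> e \<Longrightarrow> \<bar>Im w - Im s - Im c\<bar> \<le> e"
  using abs_Im_le_cmod[of "w - s - c"] by simp

lemma left_infinity_holomorphic_exp_div:
  fixes d :: nat
  assumes k: "k holomorphic_on ball 0 r" "r > 0" and d: "d > 0"
  obtains M C where "(\<lambda>s. k (exp (s / of_nat d))) holomorphic_on {s. Re s < M}"
    "\<And>s. Re s < M \<Longrightarrow> exp (s / of_nat d) \<in> ball 0 r" "\<And>s. Re s < M \<Longrightarrow> norm (k (exp (s / of_nat d))) \<le> C"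
proof -
  obtain C r' where C: "0 < r'" "r' < r" "0 < C" "\<And>q. norm q \<le> r' \<Longrightarrow> norm (k q) \<le> C"
    using bounded_near_0[OF k] by metis
  define M where "M = real d * ln r'"
  have n: "norm (exp (s / of_nat d)) \<le> r'" if "Re s < M" for s :: complex
    using that d C(1) by (intro Re_le_ln_imp) (auto simp: M_def field_simps Re_divide_of_nat)
  have b: "exp (s / of_nat d) \<in> ball 0 r" if "Re s < M" for s :: complex
    using n[OF that] C(2) by (simp only: mem_ball_0)
  have "(k \<circ> (\<lambda>s. exp (s / of_nat d))) holomorphic_on {s. Re s < M}"
    by (rule holomorphic_on_compose_gen[OF _ k(1)]) (use b d in \<open>auto intro!: holomorphic_intros\<close>)
  then show thesis using that[of M C] b n C(4) by (simp add: o_def)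
qed

text \<open>\<open>A\<close> and \<open>B\<close> are the logarithms of the two boundary arcs, \<open>kp\<close> and \<open>kq\<close> the boundary values along
  them as functions of the \<open>d\<close>-th root of the parameter.\<close>

locale corner_arcs =
  fixes D :: "complex set" and f0 :: "complex \<Rightarrow> complex" and u :: "complex \<Rightarrow> real"
    and a b :: "real \<Rightarrow> real" and \<alpha> \<beta> \<rho> M0 Cu rk :: real
    and A A' B B' kp kq :: "complex \<Rightarrow> complex" and cA cB :: complex and d :: nat
  assumes D: "open D" and f0: "f0 holomorphic_on D" "\<And>z. z \<in> D \<Longrightarrow> Re (f0 z) = u z"
    and u_cont: "continuous_on (closure D) u" and u_bound: "\<And>z. z \<in> closure D \<Longrightarrow> \<bar>u z\<bar> \<le> Cu"
    and A: "near_trans cA A" "Im cA = \<alpha>" and B: "near_trans cB B" "Im cB = \<beta>" and \<alpha>\<beta>: "\<alpha> < \<beta>"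
    and A': "near_trans (- cA) A'" "eventually (\<lambda>s. A (A' s) = s \<and> A' (A s) = s) left_infinity"
    and B': "near_trans (- cB) B'" "eventually (\<lambda>s. B (B' s) = s \<and> B' (B s) = s) left_infinity"
    and a: "(a \<longlongrightarrow> \<alpha>) (at_right 0)" and b: "(b \<longlongrightarrow> \<beta>) (at_right 0)"
    and \<rho>: "\<rho> > 0" and sector: "\<And>x \<phi>. 0 < x \<Longrightarrow> x < \<rho> \<Longrightarrow> a x < \<phi> \<Longrightarrow> \<phi> < b x \<Longrightarrow> rcis x \<phi> \<in> D"
    and curveA: "\<And>\<sigma>. \<sigma> \<le> M0 \<Longrightarrow> Im (A (of_real \<sigma>)) = a (exp (Re (A (of_real \<sigma>))))"
    and curveB: "\<And>\<sigma>. \<sigma> \<le> M0 \<Longrightarrow> Im (B (of_real \<sigma>)) = b (exp (Re (B (of_real \<sigma>))))"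
    and closA: "\<And>\<sigma>. \<sigma> \<le> M0 \<Longrightarrow> exp (A (of_real \<sigma>)) \<in> closure D"
    and closB: "\<And>\<sigma>. \<sigma> \<le> M0 \<Longrightarrow> exp (B (of_real \<sigma>)) \<in> closure D"
    and k: "kp holomorphic_on ball 0 rk" "kq holomorphic_on ball 0 rk" "rk > 0" "kp 0 = kq 0"
    and k_cnj: "\<And>x. x \<in> ball 0 rk \<Longrightarrow> kp (cnj x) = cnj (kp x)" "\<And>x. x \<in> ball 0 rk \<Longrightarrow> kq (cnj x) = cnj (kq x)"
    and d: "d > 0"
    and bvA: "\<And>\<sigma>. \<sigma> \<le> M0 \<Longrightarrow> of_real (u (exp (A (of_real \<sigma>)))) = kp (exp (of_real \<sigma> / of_nat d))"
    and bvB: "\<And>\<sigma>. \<sigma> \<le> M0 \<Longrightarrow> of_real (u (exp (B (of_real \<sigma>)))) = kq (exp (of_real \<sigma> / of_nat d))"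
begin

definition \<theta> where "\<theta> = \<beta> - \<alpha>"
text \<open>The unit for all margins: the collars along the two arcs have width of order
  \<open>\<tau>\<close>, and the maps and arcs deviate from their limits by at most
  \<open>\<tau> / 8\<close>, so collars of opposite arcs stay apart.\<close>

definition \<tau> where "\<tau> = \<theta> / 8"
definition p where "p s = kp (exp (s / of_nat d))" for s :: complex
definition q where "q s = kq (exp (s / of_nat d))" for s :: complex

lemma \<tau>: "\<tau> > 0" "\<theta> = 8 * \<tau>" "\<beta> = \<alpha> + 8 * \<tau>" using \<alpha>\<beta> by (auto simp: \<tau>_def \<theta>_def field_simps)

lemma sector_exp: "exp (Re w) < \<rho> \<Longrightarrow> a (exp (Re w)) < Im w \<Longrightarrow> Im w < b (exp (Re w)) \<Longrightarrow> exp w \<in> D"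
  using sector[of "exp (Re w)" "Im w"] by (simp add: rcis_def exp_eq_polar)

lemma ev_small: "eventually (\<lambda>w. exp (Re w) < \<rho> \<and> \<bar>a (exp (Re w)) - \<alpha>\<bar> < \<tau> / 8 \<and> \<bar>b (exp (Re w)) - \<beta>\<bar> < \<tau> / 8) left_infinity"
proof -
  have "eventually (\<lambda>x. x < \<rho> \<and> \<bar>a x - \<alpha>\<bar> < \<tau> / 8 \<and> \<bar>b x - \<beta>\<bar> < \<tau> / 8) (at_right 0)"
    using tendstoD[OF a, of "\<tau> / 8"] tendstoD[OF b, of "\<tau> / 8"] eventually_at_right_real[OF \<rho>] \<tau>(1)
    by (intro eventually_conj) (auto simp: dist_real_def elim: eventually_mono)
  from eventually_exp_Re_left_infinity[OF this] show ?thesis .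
qed

lemma side_A: "eventually (\<lambda>s. (0 < Im s \<longrightarrow> a (exp (Re (A s))) < Im (A s)) \<and> (Im s < 0 \<longrightarrow> Im (A s) < a (exp (Re (A s))))
     \<and> (Im s = 0 \<longrightarrow> Im (A s) = a (exp (Re (A s))))) left_infinity"
  by (rule near_trans_side[OF A(1)]) (rule curveA)

lemma side_B: "eventually (\<lambda>s. (0 < Im s \<longrightarrow> b (exp (Re (B s))) < Im (B s)) \<and> (Im s < 0 \<longrightarrow> Im (B s) < b (exp (Re (B s))))
     \<and> (Im s = 0 \<longrightarrow> Im (B s) = b (exp (Re (B s))))) left_infinity"
  by (rule near_trans_side[OF B(1)]) (rule curveB)

text \<open>One edge of the sector is respected by \<open>near_trans_side\<close>. The opposite edge
  is far away: both the displacement and the other arc are within \<open>\<tau> / 8\<close> of their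
  limits, less than the room left by the strips.\<close>

lemma arc_neighbourhoods:
  obtains M where "M \<le> M0"
   "\<And>s. Re s < M \<Longrightarrow> 0 < Im s \<Longrightarrow> Im s < \<theta> - \<tau> / 2 \<Longrightarrow> exp (A s) \<in> D"
   "\<And>s. Re s < M \<Longrightarrow> - \<tau> < Im s \<Longrightarrow> Im s < 0 \<Longrightarrow> exp (B s) \<in> D"
   "A holomorphic_on {s. Re s < M}" "B holomorphic_on {s. Re s < M}"
proof -
  have "eventually (\<lambda>s. norm (A s - s - cA) \<le> \<tau> / 8 \<and> norm (B s - s - cB) \<le> \<tau> / 8) left_infinity"
    using \<tau>(1) A B by (intro eventually_conj near_trans_eventually_close) auto
  moreover note side_A side_B
    near_trans_eventually[OF A(1) ev_small] near_trans_eventually[OF B(1) ev_small]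
  ultimately have "eventually (\<lambda>s. (0 < Im s \<longrightarrow> Im s < \<theta> - \<tau> / 2 \<longrightarrow> exp (A s) \<in> D) \<and> (- \<tau> < Im s \<longrightarrow> Im s < 0 \<longrightarrow> exp (B s) \<in> D)) left_infinity"
  proof eventually_elim
    case (elim s)
    have 1: "exp (A s) \<in> D" if "0 < Im s" "Im s < \<theta> - \<tau> / 2"
    proof (rule sector_exp)
      show "Im (A s) < b (exp (Re (A s)))"
        using near_trans_Im_close[of "A s" s cA "\<tau> / 8"] elim that \<tau> A(2) by linarith
    qed (use elim that in auto)
    have 2: "exp (B s) \<in> D" if "- \<tau> < Im s" "Im s < 0"
    proof (rule sector_exp)
      show "a (exp (Re (B s))) < Im (B s)"
        using near_trans_Im_close[of "B s" s cB "\<tau> / 8"] elim that \<tau> B(2) by linarith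
    qed (use elim that in auto)
    show ?case using 1 2 by blast
  qed
  then obtain M1 where M1: "\<And>s. Re s \<le> M1 \<Longrightarrow> (0 < Im s \<longrightarrow> Im s < \<theta> - \<tau> / 2 \<longrightarrow> exp (A s) \<in> D) \<and> (- \<tau> < Im s \<longrightarrow> Im s < 0 \<longrightarrow> exp (B s) \<in> D)"
    unfolding eventually_Re_at_bot by blast
  obtain M2 where M2: "A holomorphic_on {s. Re s < M2}" using near_trans_holomorphic[OF A(1)] by blast
  obtain M3 where M3: "B holomorphic_on {s. Re s < M3}" using near_trans_holomorphic[OF B(1)] by blast
  define M where "M = min (min M0 M1) (min M2 M3)"
  show thesis
  proof (rule that[of M])
    show "A holomorphic_on {s. Re s < M}" by (rule holomorphic_on_subset[OF M2]) (auto simp: M_def)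
    show "B holomorphic_on {s. Re s < M}" by (rule holomorphic_on_subset[OF M3]) (auto simp: M_def)
  qed (use M1 in \<open>auto simp: M_def\<close>)
qed

lemma pq_facts:
  obtains M C where "p holomorphic_on {s. Re s < M}" "q holomorphic_on {s. Re s < M}"
    "\<And>s. Re s < M \<Longrightarrow> norm (p s) \<le> C \<and> norm (q s) \<le> C"
    "\<And>s. Re s < M \<Longrightarrow> p (cnj s) = cnj (p s) \<and> q (cnj s) = cnj (q s)"
proof -
  obtain M1 C1 where 1: "p holomorphic_on {s. Re s < M1}" "\<And>s. Re s < M1 \<Longrightarrow> exp (s / of_nat d) \<in> ball 0 rk" "\<And>s. Re s < M1 \<Longrightarrow> norm (p s) \<le> C1"
    using left_infinity_holomorphic_exp_div[OF k(1,3) d] unfolding p_def [abs_def] by blast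
  obtain M2 C2 where 2: "q holomorphic_on {s. Re s < M2}" "\<And>s. Re s < M2 \<Longrightarrow> exp (s / of_nat d) \<in> ball 0 rk" "\<And>s. Re s < M2 \<Longrightarrow> norm (q s) \<le> C2"
    using left_infinity_holomorphic_exp_div[OF k(2,3) d] unfolding q_def [abs_def] by blast
  have c: "exp (cnj s / of_nat d) = cnj (exp (s / of_nat d))" for s by (simp add: exp_cnj)
  show thesis
  proof (rule that[of "min M1 M2" "max C1 C2"])
    show "p holomorphic_on {s. Re s < min M1 M2}" by (rule holomorphic_on_subset[OF 1(1)]) auto
    show "q holomorphic_on {s. Re s < min M1 M2}" by (rule holomorphic_on_subset[OF 2(1)]) auto
    fix s assume s: "Re s < min M1 M2"
    show "norm (p s) \<le> max C1 C2 \<and> norm (q s) \<le> max C1 C2" using 1(3)[of s] 2(3)[of s] s by auto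
    show "p (cnj s) = cnj (p s) \<and> q (cnj s) = cnj (q s)"
      unfolding p_def q_def c using k_cnj 1(2)[of s] s by auto
  qed
qed

text \<open>\<open>D\<close> lies below the second arc, so the data are conjugated into the upper
  half strip before reflection. The relation between \<open>FB s\<close> and
  \<open>FB (cnj s)\<close> is the reflection law with boundary values \<open>q\<close>.\<close>

lemma extension_across_B:
  obtains FB M C where "FB holomorphic_on {s. Re s < M \<and> \<bar>Im s\<bar> < \<tau>}"
    "\<And>s. Re s < M \<Longrightarrow> - \<tau> < Im s \<Longrightarrow> Im s < 0 \<Longrightarrow> FB s = f0 (exp (B s))"
    "\<And>s. Re s < M \<Longrightarrow> \<bar>Im s\<bar> < \<tau> \<Longrightarrow> FB s + cnj (FB (cnj s)) = 2 * q s"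
    "\<And>s. Re s < M \<Longrightarrow> \<bar>Im s\<bar> < \<tau> \<Longrightarrow> \<bar>Re (FB s)\<bar> \<le> C"
proof -
  obtain M1 where M1: "M1 \<le> M0" "\<And>s. Re s < M1 \<Longrightarrow> - \<tau> < Im s \<Longrightarrow> Im s < 0 \<Longrightarrow> exp (B s) \<in> D"
     "B holomorphic_on {s. Re s < M1}" using arc_neighbourhoods by metis
  obtain M2 C where pq: "q holomorphic_on {s. Re s < M2}" "\<And>s. Re s < M2 \<Longrightarrow> norm (q s) \<le> C"
    "\<And>s. Re s < M2 \<Longrightarrow> q (cnj s) = cnj (q s)" using pq_facts by metis
  define M where "M = min M1 M2"
  let ?U = "{s. Re s < M \<and> 0 < Im s \<and> Im s < \<tau>}"
  let ?T = "{s. Re s < M \<and> 0 \<le> Im s \<and> Im s < \<tau>}"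
  have clos: "exp (B (cnj s)) \<in> closure D" if "s \<in> ?T" for s
  proof (cases "Im s = 0")
    case True
    then have "cnj s = of_real (Re s)" by (simp add: complex_eq_iff)
    then show ?thesis using closB[of "Re s"] that M1(1) by (simp add: M_def)
  next
    case False
    then show ?thesis using M1(2)[of "cnj s"] that closure_subset by (auto simp: M_def)
  qed
  \<comment> \<open>Subtracting \<open>q\<close>, which is real on the axis and holomorphic on both
    sides, makes the boundary values of the real part vanish.\<close>
  define G where "G s = cnj (f0 (exp (B (cnj s)))) - q s" for s
  define v where "v s = u (exp (B (cnj s))) - Re (q s)" for s
  have holB: "(\<lambda>s. f0 (exp (B s))) holomorphic_on {s. Re s < M \<and> - \<tau> < Im s \<and> Im s < 0}"
  proof -
    have "(f0 \<circ> (\<lambda>s. exp (B s))) holomorphic_on {s. Re s < M \<and> - \<tau> < Im s \<and> Im s < 0}"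
      by (rule holomorphic_on_compose_gen[OF _ f0(1)])
         (use M1(2) in \<open>auto intro!: holomorphic_intros holomorphic_on_subset[OF M1(3)] simp: M_def\<close>)
    then show ?thesis by (simp add: o_def)
  qed
  have holG: "G holomorphic_on ?U"
  proof -
    have im: "cnj ` ?U = {s. Re s < M \<and> - \<tau> < Im s \<and> Im s < 0}"
      by (auto simp: image_iff intro!: exI[of _ "cnj _"])
    have "(cnj \<circ> (\<lambda>s. f0 (exp (B s))) \<circ> cnj) holomorphic_on ?U"
    proof (rule holomorphic_on_compose_cnj_cnj)
      show "(\<lambda>s. f0 (exp (B s))) holomorphic_on cnj ` ?U" unfolding im by (rule holB)
      show "open ?U" by (rule upper_half_strip)
    qed
    then show ?thesis
      unfolding G_def [abs_def] o_def by (intro holomorphic_intros holomorphic_on_subset[OF pq(1)]) (auto simp: M_def)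
  qed
  have contv: "continuous_on ?T v"
    unfolding v_def [abs_def]
  proof (intro continuous_intros)
    have cB: "continuous_on {s. Re s < M1} B" using M1(3) by (rule holomorphic_on_imp_continuous_on)
    show "continuous_on ?T (\<lambda>s. u (exp (B (cnj s))))"
      by (rule continuous_on_compose2[OF u_cont])
         (use clos in \<open>auto intro!: continuous_intros continuous_on_compose2[OF cB] simp: M_def\<close>)
    show "continuous_on ?T q"
      by (rule continuous_on_subset[OF holomorphic_on_imp_continuous_on[OF pq(1)]]) (auto simp: M_def)
  qed
  have vG: "v s = Re (G s)" if "Re s < M" "0 < Im s" "Im s < \<tau>" for s
    using f0(2)[of "exp (B (cnj s))"] M1(2)[of "cnj s"] that by (simp add: v_def G_def M_def)
  have v0: "v (of_real x) = 0" if "x < M" for x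
  proof -
    have "of_real (u (exp (B (of_real x)))) = q (of_real x)" using bvB[of x] that M1(1) by (simp add: q_def M_def)
    then have "Re (q (of_real x)) = u (exp (B (of_real x)))" by (metis Re_complex_of_real)
    then show ?thesis by (simp add: v_def)
  qed
  obtain H where H: "H holomorphic_on {z. Re z < M \<and> \<bar>Im z\<bar> < \<tau>}"
    "\<And>z. Re z < M \<Longrightarrow> 0 < Im z \<Longrightarrow> Im z < \<tau> \<Longrightarrow> H z = G z"
    "\<And>z. Re z < M \<Longrightarrow> \<bar>Im z\<bar> < \<tau> \<Longrightarrow> H (cnj z) = - cnj (H z)"
    by (rule harmonic_reflection[OF holG contv vG v0 \<tau>(1)]) blast+
  have vb: "\<bar>v s\<bar> \<le> Cu + C" if "s \<in> ?T" for s
  proof -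
    have "\<bar>Re (q s)\<bar> \<le> C" using pq(2)[of s] abs_Re_le_cmod[of "q s"] that by (simp add: M_def)
    then show ?thesis using u_bound[OF clos[OF that]] by (simp add: v_def)
  qed
  have HRe: "\<bar>Re (H s)\<bar> \<le> Cu + C" if s: "Re s < M" "\<bar>Im s\<bar> < \<tau>" for s
  proof -
    consider "0 < Im s" | "Im s < 0" | "Im s = 0" by linarith
    then show ?thesis
    proof cases
      case 1
      then show ?thesis using H(2)[of s] vG[of s] vb[of s] s by simp
    next
      case 2
      have "H (cnj s) = - cnj (H s)" using H(3) s by simp
      then have "Re (H s) = - Re (H (cnj s))" by simp
      then show ?thesis using H(2)[of "cnj s"] vG[of "cnj s"] vb[of "cnj s"] s 2 by simp
    next
      case 3
      then have "cnj s = s" by (simp add: complex_eq_iff)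
      then have "H s = - cnj (H s)" using H(3)[of s] s by simp
      then have "Re (H s) = - Re (H s)" by (metis complex_cnj(1) uminus_complex.sel(1) cnj.sel(1))
      moreover have "0 \<le> Cu + C" using vb[of s] 3 s \<tau> by (simp add: order.trans[OF abs_ge_zero])
      ultimately show ?thesis by simp
    qed
  qed
  define FB where "FB s = q s - H s" for s
  show thesis
  proof (rule that[of FB M "C + (Cu + C)"])
    show "FB holomorphic_on {s. Re s < M \<and> \<bar>Im s\<bar> < \<tau>}"
      unfolding FB_def [abs_def] by (intro holomorphic_intros H holomorphic_on_subset[OF pq(1)]) (auto simp: M_def)
    fix s assume s: "Re s < M"
    show "FB s = f0 (exp (B s))" if "- \<tau> < Im s" "Im s < 0"
    proof -
      have "H s = - cnj (H (cnj s))" using H(3)[of "cnj s"] s that by simp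
      also have "H (cnj s) = cnj (f0 (exp (B s))) - q (cnj s)" using H(2)[of "cnj s"] s that by (simp add: G_def)
      finally show ?thesis using pq(3)[of s] s by (simp add: FB_def M_def)
    qed
    assume s': "\<bar>Im s\<bar> < \<tau>"
    show "FB s + cnj (FB (cnj s)) = 2 * q s"
      using H(3)[of s] pq(3)[of s] s s' by (simp add: FB_def M_def)
    have "\<bar>Re (q s)\<bar> \<le> C" using pq(2)[of s] abs_Re_le_cmod[of "q s"] s by (simp add: M_def)
    then show "\<bar>Re (FB s)\<bar> \<le> C + (Cu + C)" using HRe[of s] s s' by (simp add: FB_def)
  qed
qed

text \<open>In the coordinate of the first arc, the function already extended across the second arc
  lives on the strip \<open>0 < Im s < \<theta> + \<tau> / 2\<close>. Reflection in the real axis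
  doubles it, which is why the strip of \<open>H\<close> has twice the opening angle.\<close>

lemma extension_across_A:
  obtains FB H M C where "H holomorphic_on {s. Re s < M \<and> \<bar>Im s\<bar> < \<theta> + \<tau> / 2}"
    "\<And>s. Re s < M \<Longrightarrow> \<bar>Im s\<bar> < \<theta> + \<tau> / 2 \<Longrightarrow> H (cnj s) = - cnj (H s)"
    "\<And>s. Re s < M \<Longrightarrow> 0 < Im s \<Longrightarrow> Im s < \<theta> - \<tau> / 2 \<Longrightarrow> H s = f0 (exp (A s)) - p s"
    "\<And>s. Re s < M \<Longrightarrow> \<theta> - 3 * \<tau> / 4 < Im s \<Longrightarrow> Im s < \<theta> + \<tau> / 2 \<Longrightarrow> H s = FB (B' (A s)) - p s"
    "\<And>s. Re s < M \<Longrightarrow> - \<tau> < Im s \<Longrightarrow> Im s < 0 \<Longrightarrow> FB s = f0 (exp (B s))"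
    "\<And>s. Re s < M \<Longrightarrow> \<bar>Im s\<bar> < \<tau> \<Longrightarrow> FB s + cnj (FB (cnj s)) = 2 * q s"
    "\<And>s. Re s < M \<Longrightarrow> \<bar>Im s\<bar> < \<theta> + \<tau> / 2 \<Longrightarrow> \<bar>Re (H s)\<bar> \<le> C"
proof -
  obtain FB M1 C1 where FB: "FB holomorphic_on {s. Re s < M1 \<and> \<bar>Im s\<bar> < \<tau>}"
    "\<And>s. Re s < M1 \<Longrightarrow> - \<tau> < Im s \<Longrightarrow> Im s < 0 \<Longrightarrow> FB s = f0 (exp (B s))"
    "\<And>s. Re s < M1 \<Longrightarrow> \<bar>Im s\<bar> < \<tau> \<Longrightarrow> FB s + cnj (FB (cnj s)) = 2 * q s"
    "\<And>s. Re s < M1 \<Longrightarrow> \<bar>Im s\<bar> < \<tau> \<Longrightarrow> \<bar>Re (FB s)\<bar> \<le> C1"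
    using extension_across_B by blast
  obtain M2 where M2: "M2 \<le> M0" "\<And>s. Re s < M2 \<Longrightarrow> 0 < Im s \<Longrightarrow> Im s < \<theta> - \<tau> / 2 \<Longrightarrow> exp (A s) \<in> D"
     "A holomorphic_on {s. Re s < M2}" using arc_neighbourhoods by metis
  obtain M3 C3 where pq: "p holomorphic_on {s. Re s < M3}" "\<And>s. Re s < M3 \<Longrightarrow> norm (p s) \<le> C3" using pq_facts by metis
  \<comment> \<open>The change from the coordinate of the first arc to that of the second; it lowers
    imaginary parts by about \<theta>.\<close>
  define N where "N s = B' (A s)" for s
  have N: "near_trans (- cB + cA) N" unfolding N_def [abs_def] by (rule near_trans_compose[OF B'(1) A(1)])
  obtain M4 where M4: "N holomorphic_on {s. Re s < M4}" using near_trans_holomorphic[OF N] by blast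
  have "eventually (\<lambda>s. norm (N s - s - (- cB + cA)) \<le> \<tau> / 8 \<and> B (N s) = A s \<and> Re (N s) < M1) left_infinity"
  proof (intro eventually_conj near_trans_eventually_close[OF N])
    show "eventually (\<lambda>s. B (N s) = A s) left_infinity"
      using near_trans_eventually[OF A(1) B'(2)] by (simp add: N_def eventually_conj_iff)
    show "eventually (\<lambda>s. Re (N s) < M1) left_infinity"
      by (rule near_trans_eventually[OF N]) (auto simp: eventually_Re_at_bot intro!: exI[of _ "M1 - 1"])
  qed (use \<tau> in auto)
  then obtain M5 where M5: "\<And>s. Re s \<le> M5 \<Longrightarrow> norm (N s - s - (- cB + cA)) \<le> \<tau> / 8 \<and> B (N s) = A s \<and> Re (N s) < M1"
    unfolding eventually_Re_at_bot by blast
  define M where "M = min (min M1 M2) (min M3 (min M4 M5))"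
  have N_Im: "\<bar>Im (N s) - Im s + \<theta>\<bar> \<le> \<tau> / 8" if "Re s < M" for s
    using near_trans_Im_close[of "N s" s "- cB + cA" "\<tau> / 8"] M5[of s] that A(2) B(2) by (simp add: M_def \<theta>_def algebra_simps)
  let ?Y = "\<theta> + \<tau> / 2"
  \<comment> \<open>\<open>U1\<close> and \<open>U2\<close> overlap in a strip of height
    \<open>\<tau> / 4\<close>. On \<open>U2\<close> the point \<open>N s\<close> has imaginary part
    of size at most \<open>7 * \<tau> / 8\<close>, inside the domain of \<open>FB\<close>.\<close>
  define U1 where "U1 = {s. Re s < M \<and> 0 < Im s \<and> Im s < \<theta> - \<tau> / 2}"
  define U2 where "U2 = {s. Re s < M \<and> \<theta> - 3 * \<tau> / 4 < Im s \<and> Im s < ?Y}"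
  define F1 where "F1 s = (if s \<in> U1 then f0 (exp (A s)) else FB (N s))" for s
  have openU: "open U1" "open U2"
  proof -
    show "open U1" unfolding U1_def by (rule upper_half_strip)
    have "U2 = {s. Re s < M} \<inter> {s. \<theta> - 3 * \<tau> / 4 < Im s} \<inter> {s. Im s < ?Y}" by (auto simp: U2_def)
    then show "open U2" by (auto intro: open_halfspace_Re_lt open_halfspace_Im_lt open_halfspace_Im_gt)
  qed
  have NU2: "Re (N s) < M1 \<and> \<bar>Im (N s)\<bar> < \<tau>" if "s \<in> U2" for s
  proof -
    have "\<bar>Im (N s) - Im s + \<theta>\<bar> \<le> \<tau> / 8" using that by (intro N_Im) (simp add: U2_def)
    moreover have "Re (N s) < M1" "\<theta> - 3 * \<tau> / 4 < Im s" "Im s < \<theta> + \<tau> / 2" using that M5[of s] by (auto simp: U2_def M_def)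
    ultimately show ?thesis using \<tau> by (intro conjI) linarith+
  qed
  \<comment> \<open>On the overlap \<open>N s\<close> lies strictly below the real axis, where
    \<open>FB\<close> is still \<open>f0\<close> in the coordinate of the second arc.\<close>
  have agree: "f0 (exp (A s)) = FB (N s)" if s: "s \<in> U2" "Im s < \<theta> - \<tau> / 2" for s
  proof -
    have "\<bar>Im (N s) - Im s + \<theta>\<bar> \<le> \<tau> / 8" using s by (intro N_Im) (simp add: U2_def)
    then have "Im (N s) < 0" using s(2) \<tau> by linarith
    then have "FB (N s) = f0 (exp (B (N s)))" using NU2[OF s(1)] by (intro FB(2)) (auto simp: abs_less_iff)
    then show ?thesis using M5[of s] s by (simp add: U2_def M_def)
  qed
  have F1U2: "F1 s = FB (N s)" if "s \<in> U2" for s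
    using agree[OF that] by (auto simp: F1_def U1_def)
  have holF1: "F1 holomorphic_on U1 \<union> U2"
    unfolding F1_def [abs_def]
  proof (rule holomorphic_on_If_Un[OF _ _ openU])
    have "(f0 \<circ> (\<lambda>s. exp (A s))) holomorphic_on U1"
      by (rule holomorphic_on_compose_gen[OF _ f0(1)])
         (use M2(2) in \<open>auto intro!: holomorphic_intros holomorphic_on_subset[OF M2(3)] simp: M_def U1_def\<close>)
    then show "(\<lambda>s. f0 (exp (A s))) holomorphic_on U1" by (simp add: o_def)
    have "(FB \<circ> N) holomorphic_on U2"
      by (rule holomorphic_on_compose_gen[OF holomorphic_on_subset[OF M4] FB(1)])
         (use NU2 in \<open>auto simp: U2_def M_def\<close>)
    then show "(\<lambda>s. FB (N s)) holomorphic_on U2" by (simp add: o_def)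
    show "f0 (exp (A z)) = FB (N z)" if "z \<in> U1" "z \<in> U2" for z using agree[OF that(2)] that(1) by (simp add: U1_def)
  qed
  let ?U = "{s. Re s < M \<and> 0 < Im s \<and> Im s < ?Y}"
  let ?T = "{s. Re s < M \<and> 0 \<le> Im s \<and> Im s < ?Y}"
  have U: "?U = U1 \<union> U2" using \<tau> by (auto simp: U1_def U2_def)
  define G where "G s = F1 s - p s" for s
  have holG: "G holomorphic_on ?U"
    unfolding G_def [abs_def] using holF1 unfolding U [symmetric]
    by (intro holomorphic_intros holomorphic_on_subset[OF pq(1)]) (auto simp: M_def)
  \<comment> \<open>Set to 0 on the axis because \<open>G\<close> is not defined there;
    \<open>v1\<close> identifies it with the continuous boundary values of \<open>u\<close> minus
    those of \<open>p\<close>.\<close>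
  define v where "v s = (if 0 < Im s then Re (G s) else 0)" for s
  let ?T1 = "{s. Re s < M \<and> 0 \<le> Im s \<and> Im s < \<theta> - \<tau> / 2}"
  have clos: "exp (A s) \<in> closure D" if "s \<in> ?T1" for s
  proof (cases "Im s = 0")
    case True
    then have "s = of_real (Re s)" by (simp add: complex_eq_iff)
    then show ?thesis using closA[of "Re s"] that M2(1) by (simp add: M_def)
  next
    case False
    then show ?thesis using M2(2)[of s] that closure_subset by (auto simp: M_def)
  qed
  have v1: "v s = u (exp (A s)) - Re (p s)" if s: "s \<in> ?T1" for s
  proof (cases "Im s = 0")
    case True
    then have "s = of_real (Re s)" by (simp add: complex_eq_iff)
    then have "of_real (u (exp (A s))) = p s" using bvA[of "Re s"] s M2(1) by (simp add: p_def M_def)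
    then have "Re (p s) = u (exp (A s))" by (metis Re_complex_of_real)
    then show ?thesis using True by (simp add: v_def)
  next
    case False
    then have "s \<in> U1" using s by (auto simp: U1_def)
    then show ?thesis using f0(2)[of "exp (A s)"] M2(2)[of s] s False by (simp add: v_def G_def F1_def M_def U1_def)
  qed
  have contv: "continuous_on ?T v"
  proof -
    have T: "?T = ?T1 \<union> ?U" using \<tau> by auto
    show ?thesis unfolding T
    proof (rule continuous_on_Un_local_open)
      have "openin (top_of_set (?T1 \<union> ?U)) ((?T1 \<union> ?U) \<inter> {s. Im s < \<theta> - \<tau> / 2})"
        by (intro openin_open_Int open_halfspace_Im_lt)
      moreover have "(?T1 \<union> ?U) \<inter> {s. Im s < \<theta> - \<tau> / 2} = ?T1" by auto
      ultimately show "openin (top_of_set (?T1 \<union> ?U)) ?T1" by simp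
      have "openin (top_of_set (?T1 \<union> ?U)) ((?T1 \<union> ?U) \<inter> ?U)"
        by (intro openin_open_Int upper_half_strip)
      moreover have "(?T1 \<union> ?U) \<inter> ?U = ?U" by auto
      ultimately show "openin (top_of_set (?T1 \<union> ?U)) ?U" by simp
      have cA: "continuous_on {s. Re s < M2} A" using M2(3) by (rule holomorphic_on_imp_continuous_on)
      have "continuous_on ?T1 (\<lambda>s. u (exp (A s)))"
        by (rule continuous_on_compose2[OF u_cont])
           (use clos in \<open>auto intro!: continuous_intros continuous_on_compose2[OF cA] simp: M_def\<close>)
      moreover have "continuous_on ?T1 p"
        by (rule continuous_on_subset[OF holomorphic_on_imp_continuous_on[OF pq(1)]]) (auto simp: M_def)
      ultimately have "continuous_on ?T1 (\<lambda>s. u (exp (A s)) - Re (p s))" by (intro continuous_intros)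
      then show "continuous_on ?T1 v" by (rule continuous_on_eq) (use v1 in auto)
      have "continuous_on ?U (\<lambda>s. Re (G s))" by (intro continuous_intros holomorphic_on_imp_continuous_on holG)
      then show "continuous_on ?U v" by (rule continuous_on_eq) (auto simp: v_def)
    qed
  qed
  have Y: "?Y > 0" using \<tau> by simp
  obtain H where H: "H holomorphic_on {z. Re z < M \<and> \<bar>Im z\<bar> < ?Y}"
    "\<And>z. Re z < M \<Longrightarrow> 0 < Im z \<Longrightarrow> Im z < ?Y \<Longrightarrow> H z = G z"
    "\<And>z. Re z < M \<Longrightarrow> \<bar>Im z\<bar> < ?Y \<Longrightarrow> H (cnj z) = - cnj (H z)"
    by (rule harmonic_reflection[OF holG contv _ _ Y]) (auto simp: v_def)
  \<comment> \<open>Nonnegativity takes care of the real axis, where \<open>Re H\<close>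
    vanishes.\<close>
  define C where "C = max 0 (max Cu C1 + C3)"
  have Gb: "\<bar>Re (G s)\<bar> \<le> C" if s: "s \<in> ?U" for s
  proof -
    have "\<bar>Re (F1 s)\<bar> \<le> max Cu C1"
    proof (cases "s \<in> U1")
      case True
      then have "exp (A s) \<in> D" using M2(2)[of s] by (simp add: U1_def M_def)
      then show ?thesis using True f0(2) u_bound[of "exp (A s)"] closure_subset[of D] by (auto simp: F1_def)
    next
      case False
      then have "s \<in> U2" using s U by blast
      then show ?thesis using F1U2[of s] FB(4)[of "N s"] NU2[of s] by auto
    qed
    moreover have "\<bar>Re (p s)\<bar> \<le> C3" using pq(2)[of s] abs_Re_le_cmod[of "p s"] s by (simp add: M_def)
    ultimately show ?thesis by (simp add: G_def C_def)
  qed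
  show thesis
  proof (rule that[of H M FB C])
    show "H holomorphic_on {s. Re s < M \<and> \<bar>Im s\<bar> < \<theta> + \<tau> / 2}" by (rule H)
    fix s assume s: "Re s < M"
    show "FB s = f0 (exp (B s))" if "- \<tau> < Im s" "Im s < 0" using FB(2)[of s] s that by (simp add: M_def)
    show "FB s + cnj (FB (cnj s)) = 2 * q s" if "\<bar>Im s\<bar> < \<tau>" using FB(3)[of s] s that by (simp add: M_def)
    show "H s = f0 (exp (A s)) - p s" if "0 < Im s" "Im s < \<theta> - \<tau> / 2"
      using H(2)[of s] s that \<tau> by (simp add: G_def F1_def U1_def)
    show "H s = FB (B' (A s)) - p s" if "\<theta> - 3 * \<tau> / 4 < Im s" "Im s < \<theta> + \<tau> / 2"
      using H(2)[of s] F1U2[of s] s that \<tau> by (simp add: G_def U2_def N_def)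
    assume s': "\<bar>Im s\<bar> < \<theta> + \<tau> / 2"
    show sym: "H (cnj s) = - cnj (H s)" by (rule H(3)[OF s s'])
    consider "0 < Im s" | "Im s < 0" | "Im s = 0" by linarith
    then show "\<bar>Re (H s)\<bar> \<le> C"
    proof cases
      case 1
      then show ?thesis using H(2)[of s] Gb[of s] s s' by simp
    next
      case 2
      have "Re (H s) = - Re (H (cnj s))" using sym by simp
      then show ?thesis using H(2)[of "cnj s"] Gb[of "cnj s"] s s' 2 by simp
    next
      case 3
      then have "cnj s = s" by (simp add: complex_eq_iff)
      then have "Re (H s) = - Re (H s)" using arg_cong[OF sym, of Re] by simp
      then show ?thesis by (simp add: C_def)
    qed
  qed
qed

end

text \<open>A bounded real part bounds the derivative on smaller strips, so \<open>H\<close> grows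
  at most linearly. The derivative estimate is weakened to order \<open>- \<epsilon>\<close> before
  integrating, since order 0 is excluded there.\<close>

lemma exp_order_of_Re_bounded:
  assumes hol: "H holomorphic_on {w. Re w < M \<and> \<bar>Im w\<bar> < Y}" and Y: "Y > 0"
    and C: "\<And>w. Re w < M \<Longrightarrow> \<bar>Im w\<bar> < Y \<Longrightarrow> \<bar>Re (H w)\<bar> \<le> C" and \<epsilon>: "\<epsilon> > 0"
  shows "exp_order Y (- \<epsilon>) H"
proof -
  have "exp_order Y 0 (deriv H)"
  proof (rule exp_orderI)
    fix y assume y: "y < Y"
    define r where "r = (Y - y) / 2"
    have r: "r > 0" "y + r < Y" using y by (auto simp: r_def field_simps)
    have "norm (deriv H w) \<le> 2 * exp 2 * (\<bar>C\<bar> + 1) / r * exp (0 * Re w)" if w: "Re w \<le> M - r - 1" "\<bar>Im w\<bar> \<le> y" for w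
    proof -
      have near: "Re z < M \<and> \<bar>Im z\<bar> < Y" if "z \<in> ball w r" for z
      proof -
        have n: "norm (w - z) < r" using that by (simp add: dist_norm)
        have "\<bar>Re w - Re z\<bar> < r" "\<bar>Im w - Im z\<bar> < r" using abs_Re_le_cmod[of "w - z"] abs_Im_le_cmod[of "w - z"] n by auto
        then show ?thesis using w r by (intro conjI) linarith+
      qed
      have "norm (deriv H w) \<le> 2 * exp 2 * (\<bar>C\<bar> + 1) / r"
      proof (rule deriv_bound_of_Re_bounded)
        show "H holomorphic_on ball w r" by (rule holomorphic_on_subset[OF hol]) (use near in auto)
        show "\<bar>Re (H z)\<bar> \<le> \<bar>C\<bar> + 1" if "z \<in> ball w r" for z using C[of z] near[OF that] by auto
      qed (use r in auto)
      then show ?thesis by simp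
    qed
    then show "\<exists>C M. \<forall>w. Re w \<le> M \<longrightarrow> \<bar>Im w\<bar> \<le> y \<longrightarrow> norm (deriv H w) \<le> C * exp (0 * Re w)" by blast
  qed
  then have "exp_order Y (- \<epsilon>) (deriv H)" by (rule exp_order_mono) (use \<epsilon> in simp)
  then obtain a where a: "exp_order Y (- \<epsilon>) (\<lambda>w. H w - a)"
    using exp_order_antiderivative[OF hol Y, of "- \<epsilon>"] \<epsilon> by auto
  have "exp_order Y 0 (\<lambda>_. a)" by (auto simp: exp_order_def)
  then have "exp_order Y (- \<epsilon>) (\<lambda>_. a)" by (rule exp_order_mono) (use \<epsilon> in simp)
  from exp_order_add[OF a this] show ?thesis by simp
qed

section \<open>Stability of expansions under change of coordinate\<close>

lemma corner_exps_closed: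
  assumes "(\<alpha>, j) \<in> corner_exps \<theta> d" "i \<le> j" "d > 0"
  shows "(\<alpha>, i) \<in> corner_exps \<theta> d" "1 \<le> k \<Longrightarrow> (\<alpha> + real k, i) \<in> corner_exps \<theta> d"
proof -
  show "(\<alpha>, i) \<in> corner_exps \<theta> d" using assms by (auto simp: corner_exps_def)
  show "(\<alpha> + real k, i) \<in> corner_exps \<theta> d" if "1 \<le> k"
    using assms lattice_exps_shift[of \<alpha> \<theta> d k] lattice_exps_critical_shift[OF that assms(3), of _ \<theta>]
    by (auto simp: corner_exps_def)
qed

text \<open>The limiting translation is real, so strips are preserved; the exponents produced by the
  perturbation remain in \<open>corner_exps\<close>.\<close>

lemma expansion_near_trans:
  assumes P: "P \<in> explog (corner_exps \<theta> d)" and ord: "exp_order Y R (\<lambda>w. F w - P w)"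
    and A: "near_trans (of_real c) A" and d: "d > 0"
  shows "\<exists>Q \<in> explog (corner_exps \<theta> d). exp_order Y R (\<lambda>w. F (A w) - Q w)"
proof -
  let ?W = "{(\<alpha> + real k, i) | \<alpha> k i. 1 \<le> k \<and> (\<exists>j\<ge>i. (\<alpha>, j) \<in> corner_exps \<theta> d)}"
  obtain Z where Z: "Z \<in> explog ?W" "\<And>Y. exp_order Y R (\<lambda>s. P (A s) - P (s + of_real c) - Z s)"
    using explog_near_trans[OF A P, of R] by blast
  have W: "?W \<subseteq> corner_exps \<theta> d" using corner_exps_closed(2)[OF _ _ d] by blast
  have 1: "(\<lambda>s. P (s + of_real c)) \<in> explog (corner_exps \<theta> d)"
    by (rule explog_shift[OF P]) (rule corner_exps_closed(1)[OF _ _ d])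
  have "exp_order Y R (\<lambda>s. (F (A s) - P (A s)) + (P (A s) - P (s + of_real c) - Z s))"
    by (intro exp_order_add Z exp_order_near_trans[OF ord A])
  then have "exp_order Y R (\<lambda>s. F (A s) - (P (s + of_real c) + Z s))" by (simp add: algebra_simps)
  moreover have "(\<lambda>s. P (s + of_real c) + Z s) \<in> explog (corner_exps \<theta> d)"
    by (intro explog_add 1 explog_mono[OF Z(1) W])
  ultimately show ?thesis by (intro bexI[of _ "\<lambda>s. P (s + of_real c) + Z s"])
qed

context corner_arcs
begin

lemma p_expansion: "\<exists>P \<in> explog (corner_exps \<theta> d). exp_order Y R (\<lambda>w. p w - P w)"
proof -
  define N where "N = nat \<lceil>R * d\<rceil>"
  have N: "R \<le> real N / d"
  proof -
    have "R * d \<le> real N" unfolding N_def by linarith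
    then show ?thesis using d by (simp add: field_simps)
  qed
  obtain c where c: "exp_order Y (real N / real d)
           (\<lambda>s. kp (exp (s / of_real (real d))) - (\<Sum>n<N. c n * exp (of_real (real n / real d) * s)))"
    using exp_order_taylor[OF k(1,3), of "real d" N] d by auto
  define L where "L s = (\<Sum>n<N. c n * (s ^ 0 * exp (of_real (real n / real d) * s)))" for s :: complex
  have "L \<in> explog (corner_exps \<theta> d)"
    unfolding L_def [abs_def]
  proof (rule explog_sum, rule explog_term)
    fix n
    show "(real n / real d, 0) \<in> corner_exps \<theta> d"
    proof (cases "n = 0")
      case True
      then show ?thesis by (auto simp: corner_exps_def intro!: exI[of _ "0::nat"])
    next
      case False
      then have "real n / real d \<in> lattice_exps \<theta> d"
        unfolding lattice_exps_def by (intro CollectI exI[of _ n] exI[of _ "0::nat"]) auto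
      then show ?thesis by (simp add: corner_exps_def)
    qed
  qed
  moreover have "exp_order Y R (\<lambda>s. p s - L s)"
    using exp_order_mono[OF c N] by (simp add: L_def p_def)
  ultimately show ?thesis by blast
qed

text \<open>In the coordinate of the first arc the second one is the curve \<open>B1\<close>, and
  its mirror image is \<open>B2\<close>. The reflection law across the second arc, combined with the
  antisymmetry of \<open>H\<close> from the first, is the functional equation. Undoing the
  coordinate \<open>A\<close> at the end returns to \<open>w = log z\<close>.\<close>

lemma local_extension:
  obtains \<Phi> M \<mu> where "\<mu> > 0" "\<Phi> holomorphic_on {w. Re w < M \<and> \<alpha> - \<mu> < Im w \<and> Im w < \<beta> + \<mu>}"
    "\<And>w. Re w < M \<Longrightarrow> a (exp (Re w)) < Im w \<Longrightarrow> Im w < b (exp (Re w)) \<Longrightarrow>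
       \<Phi> w = f0 (exp w) \<and> \<alpha> - \<mu> / 2 < Im w \<and> Im w < \<beta> + \<mu> / 2"
    "\<And>R. \<exists>P \<in> explog (corner_exps \<theta> d). exp_order (\<theta> + \<mu>) R (\<lambda>w. \<Phi> (w + \<i> * of_real \<alpha>) - P w)"
proof -
  obtain FB H M1 C where H: "H holomorphic_on {s. Re s < M1 \<and> \<bar>Im s\<bar> < \<theta> + \<tau> / 2}"
    "\<And>s. Re s < M1 \<Longrightarrow> \<bar>Im s\<bar> < \<theta> + \<tau> / 2 \<Longrightarrow> H (cnj s) = - cnj (H s)"
    "\<And>s. Re s < M1 \<Longrightarrow> 0 < Im s \<Longrightarrow> Im s < \<theta> - \<tau> / 2 \<Longrightarrow> H s = f0 (exp (A s)) - p s"
    "\<And>s. Re s < M1 \<Longrightarrow> \<theta> - 3 * \<tau> / 4 < Im s \<Longrightarrow> Im s < \<theta> + \<tau> / 2 \<Longrightarrow> H s = FB (B' (A s)) - p s"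
    "\<And>s. Re s < M1 \<Longrightarrow> - \<tau> < Im s \<Longrightarrow> Im s < 0 \<Longrightarrow> FB s = f0 (exp (B s))"
    "\<And>s. Re s < M1 \<Longrightarrow> \<bar>Im s\<bar> < \<tau> \<Longrightarrow> FB s + cnj (FB (cnj s)) = 2 * q s"
    "\<And>s. Re s < M1 \<Longrightarrow> \<bar>Im s\<bar> < \<theta> + \<tau> / 2 \<Longrightarrow> \<bar>Re (H s)\<bar> \<le> C"
    by (rule extension_across_A, rule that, assumption, blast+)
  obtain M2 where pq: "p holomorphic_on {s. Re s < M2}" "\<And>s. Re s < M2 \<Longrightarrow> p (cnj s) = cnj (p s)"
    using pq_facts by metis
  define B1 where "B1 s = A' (B s)" for s
  define B2 where "B2 s = cnj (B1 (cnj s))" for s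
  define c0 where "c0 = Re (cB - cA)"
  have cc: "- cA + cB = of_real c0 + \<i> * of_real \<theta>"
    using A(2) B(2) by (simp add: complex_eq_iff c0_def \<theta>_def)
  have B1: "near_trans (of_real c0 + \<i> * of_real \<theta>) B1"
    using near_trans_compose[OF A'(1) B(1)] unfolding B1_def [abs_def] cc .
  have B2: "near_trans (of_real c0 - \<i> * of_real \<theta>) B2"
    using near_trans_cnj[OF B1] unfolding B2_def [abs_def] by simp
  obtain K1 r1 where K1: "r1 > 0" "K1 holomorphic_on ball 0 r1" "K1 0 = kp 0" "\<And>s. p (B1 s) = K1 (exp (s / of_nat d))"
    by (rule holomorphic_of_near_trans[OF B1 k(1,3) d], rule that, assumption+, simp add: p_def)
  obtain K2 r2 where K2: "r2 > 0" "K2 holomorphic_on ball 0 r2" "K2 0 = kp 0" "\<And>s. p (B2 s) = K2 (exp (s / of_nat d))"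
    by (rule holomorphic_of_near_trans[OF B2 k(1,3) d], rule that, assumption+, simp add: p_def)
  \<comment> \<open>Adding the reflection law for \<open>FB\<close> at \<open>s\<close> and
    \<open>cnj s\<close> gives \<open>2 * q\<close>; the two other terms undo the subtraction of
    \<open>p\<close> in \<open>H\<close>. At 0 everything cancels because the boundary values of
    both arcs agree at the corner.\<close>
  define K where "K x = 2 * kq x - K1 x - K2 x" for x
  define r where "r = min rk (min r1 r2)"
  have holK: "K holomorphic_on ball 0 r"
    unfolding K_def [abs_def]
    by (intro holomorphic_intros holomorphic_on_subset[OF k(2)] holomorphic_on_subset[OF K1(2)] holomorphic_on_subset[OF K2(2)])
       (auto simp: r_def)
  have "eventually (\<lambda>s. norm (B1 s - s - (of_real c0 + \<i> * of_real \<theta>)) \<le> \<tau> / 8 \<and> Re (B1 s) < min M1 M2 \<and> A (B1 s) = B s \<and> B' (B s) = s) left_infinity"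
  proof (intro eventually_conj near_trans_eventually_close[OF B1])
    show "eventually (\<lambda>s. Re (B1 s) < min M1 M2) left_infinity"
      by (rule near_trans_eventually[OF B1]) (auto simp: eventually_Re_at_bot intro!: exI[of _ "min M1 M2 - 1"])
    show "eventually (\<lambda>s. A (B1 s) = B s) left_infinity"
      using near_trans_eventually[OF B(1) A'(2)] by (simp add: B1_def eventually_conj_iff)
    show "eventually (\<lambda>s. B' (B s) = s) left_infinity" using B'(2) by (simp add: eventually_conj_iff)
  qed (use \<tau> in auto)
  then obtain M3 where M3: "\<And>s. Re s \<le> M3 \<Longrightarrow> norm (B1 s - s - (of_real c0 + \<i> * of_real \<theta>)) \<le> \<tau> / 8 \<and> Re (B1 s) < min M1 M2 \<and> A (B1 s) = B s \<and> B' (B s) = s"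
    unfolding eventually_Re_at_bot by blast
  have HB1: "H (B1 s) = FB s - p (B1 s) \<and> \<bar>Im (B1 s)\<bar> < \<theta> + \<tau> / 2" if s: "Re s \<le> M3" "\<bar>Im s\<bar> < \<tau> / 4" for s
  proof -
    have "\<bar>Im (B1 s) - Im s - \<theta>\<bar> \<le> \<tau> / 8" using near_trans_Im_close[of "B1 s" s] M3[of s] s by fastforce
    then have i: "\<theta> - 3 * \<tau> / 4 < Im (B1 s)" "Im (B1 s) < \<theta> + \<tau> / 2" using s \<tau> by linarith+
    then have "H (B1 s) = FB (B' (A (B1 s))) - p (B1 s)" using M3[of s] s by (intro H(4)) auto
    then show ?thesis using M3[of s] s i \<tau> by auto
  qed
  have deq: "H (B1 s) - H (B2 s) = K (exp (s / of_nat d))" if s: "Re s \<le> min M3 (M1 - 1)" "\<bar>Im s\<bar> < \<tau> / 4" for s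
  proof -
    have s': "Re (cnj s) \<le> M3" "\<bar>Im (cnj s)\<bar> < \<tau> / 4" using s by auto
    have "H (B2 s) = - cnj (H (B1 (cnj s)))"
      unfolding B2_def using M3[OF s'(1)] HB1[OF s'] by (intro H(2)) auto
    also have "\<dots> = - cnj (FB (cnj s)) + cnj (p (B1 (cnj s)))" using HB1[OF s'] by simp
    also have "cnj (p (B1 (cnj s))) = p (B2 s)" unfolding B2_def using pq(2) M3[OF s'(1)] by simp
    finally have "H (B1 s) - H (B2 s) = (FB s + cnj (FB (cnj s))) - p (B1 s) - p (B2 s)" using HB1[of s] s by simp
    also have "FB s + cnj (FB (cnj s)) = 2 * q s" using s \<tau> by (intro H(6)) auto
    finally show ?thesis by (simp add: K_def K1(4) K2(4) q_def)
  qed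
  interpret E: corner_difference_equation H M1 \<theta> "\<tau> / 4" c0 r d B1 B2 K
  proof
    show "H holomorphic_on {w. Re w < M1 \<and> \<bar>Im w\<bar> < \<theta> + \<tau> / 4}" by (rule holomorphic_on_subset[OF H(1)]) (use \<tau> in auto)
    show "K 0 = 0" using K1(3) K2(3) k(4) by (simp add: K_def)
    show "\<exists>M'. \<forall>s. Re s \<le> M' \<longrightarrow> \<bar>Im s\<bar> < \<tau> / 4 \<longrightarrow> H (B1 s) - H (B2 s) = K (exp (s / of_nat d))" using deq by blast
    show "exp_order (\<theta> + \<tau> / 4) (- \<epsilon>) H" if "\<epsilon> > 0" for \<epsilon>
      by (rule exp_order_mono_strip[OF exp_order_of_Re_bounded[OF H(1) _ H(7) that]]) (use \<tau> in auto)
  qed (use \<tau> d B1 B2 holK k(3) K1(1) K2(1) in \<open>auto simp: r_def\<close>)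
  \<comment> \<open>Half of it, \<open>\<tau> / 8\<close>, is the tolerance within which
    \<open>a\<close> and \<open>b\<close> approximate \<alpha> and \<beta>; the other half is room
    for the closure.\<close>
  define \<mu> where "\<mu> = \<tau> / 4"
  define \<Phi> where "\<Phi> w = H (A' w) + p (A' w)" for w
  obtain M4 where M4: "A' holomorphic_on {w. Re w < M4}" using near_trans_holomorphic[OF A'(1)] by blast
  have "eventually (\<lambda>w. Re (B' w) < M1) left_infinity"
    by (rule near_trans_eventually[OF B'(1)]) (auto simp: eventually_Re_at_bot intro!: exI[of _ "M1 - 1"])
  moreover have "eventually (\<lambda>w. Re (A' w) < min M1 M2) left_infinity"
    by (rule near_trans_eventually[OF A'(1)]) (auto simp: eventually_Re_at_bot intro!: exI[of _ "min M1 M2 - 1"])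
  moreover have "eventually (\<lambda>w. norm (A' w - w - (- cA)) \<le> \<tau> / 8) left_infinity" "eventually (\<lambda>w. norm (B' w - w - (- cB)) \<le> \<tau> / 8) left_infinity"
    by (rule near_trans_eventually_close[OF A'(1)], use \<tau> in simp, rule near_trans_eventually_close[OF B'(1)], use \<tau> in simp)
  moreover note A'(2) B'(2) ev_small near_trans_eventually[OF A'(1) side_A] near_trans_eventually[OF B'(1) side_B]
  ultimately have "eventually (\<lambda>w. Re (A' w) < min M1 M2 \<and> norm (A' w - w - (- cA)) \<le> \<tau> / 8 \<and>
    (a (exp (Re w)) < Im w \<longrightarrow> Im w < b (exp (Re w)) \<longrightarrow>
       \<Phi> w = f0 (exp w) \<and> \<alpha> - \<mu> / 2 < Im w \<and> Im w < \<beta> + \<mu> / 2)) left_infinity"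
  proof eventually_elim
    case (elim w)
    have AA: "A (A' w) = w" and BB: "B (B' w) = w" using elim by auto
    have iA: "\<bar>Im (A' w) - Im w + \<alpha>\<bar> \<le> \<tau> / 8" using near_trans_Im_close[of "A' w" w "- cA" "\<tau> / 8"] elim A(2) by simp
    have iB: "\<bar>Im (B' w) - Im w + \<beta>\<bar> \<le> \<tau> / 8" using near_trans_Im_close[of "B' w" w "- cB" "\<tau> / 8"] elim B(2) by simp
    have "\<Phi> w = f0 (exp w) \<and> \<alpha> - \<mu> / 2 < Im w \<and> Im w < \<beta> + \<mu> / 2"
      if w: "a (exp (Re w)) < Im w" "Im w < b (exp (Re w))"
    proof -
      have "\<bar>a (exp (Re w)) - \<alpha>\<bar> < \<tau> / 8" "\<bar>b (exp (Re w)) - \<beta>\<bar> < \<tau> / 8" using elim by blast+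
      then have bnd: "\<alpha> - \<tau> / 8 < Im w" "Im w < \<beta> + \<tau> / 8" using w by linarith+
      \<comment> \<open>Otherwise \<open>A\<close> would send \<open>A' w\<close> onto or below the
        first arc, whereas \<open>w\<close> lies above it.\<close>
      have posA: "0 < Im (A' w)"
      proof (rule ccontr)
        assume "\<not> 0 < Im (A' w)"
        then have "Im (A (A' w)) \<le> a (exp (Re (A (A' w))))" using elim by (cases "Im (A' w) = 0") auto
        then show False using w(1) unfolding AA by simp
      qed
      have negB: "Im (B' w) < 0"
      proof (rule ccontr)
        assume "\<not> Im (B' w) < 0"
        then have "b (exp (Re (B (B' w)))) \<le> Im (B (B' w))" using elim by (cases "Im (B' w) = 0") auto
        then show False using w(2) unfolding BB by simp
      qed
      have "\<Phi> w = f0 (exp w)"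
      proof (cases "Im (A' w) < \<theta> - \<tau> / 2")
        case True
        then show ?thesis using H(3)[of "A' w"] posA elim by (simp add: \<Phi>_def AA)
      next
        case False
        have "H (A' w) = FB (B' (A (A' w))) - p (A' w)"
          using elim False iA bnd \<tau> by (intro H(4)) (simp, linarith, linarith)
        moreover have "FB (B' w) = f0 (exp (B (B' w)))"
          using elim negB False iA iB \<tau> by (intro H(5)) (simp, linarith, simp)
        ultimately show ?thesis by (simp add: \<Phi>_def AA BB)
      qed
      then show ?thesis using bnd by (simp add: \<mu>_def)
    qed
    then show ?case using elim by blast
  qed
  then obtain M5 where M5: "\<And>w. Re w \<le> M5 \<Longrightarrow> Re (A' w) < min M1 M2 \<and> norm (A' w - w - (- cA)) \<le> \<tau> / 8 \<and>
    (a (exp (Re w)) < Im w \<longrightarrow> Im w < b (exp (Re w)) \<longrightarrow> \<Phi> w = f0 (exp w) \<and> \<alpha> - \<mu> / 2 < Im w \<and> Im w < \<beta> + \<mu> / 2)"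
    unfolding eventually_Re_at_bot by blast
  define M where "M = min M4 M5"
  show thesis
  proof (rule that[of \<mu> \<Phi> M])
    show "\<mu> > 0" using \<tau> by (simp add: \<mu>_def)
    let ?S = "{w. Re w < M \<and> \<alpha> - \<mu> < Im w \<and> Im w < \<beta> + \<mu>}"
    have in_strip: "A' w \<in> {s. Re s < M1 \<and> \<bar>Im s\<bar> < \<theta> + \<tau> / 2} \<and> Re (A' w) < M2" if "w \<in> ?S" for w
    proof -
      have m: "Re (A' w) < min M1 M2" "norm (A' w - w - (- cA)) \<le> \<tau> / 8" using M5[of w] that by (auto simp: M_def)
      have "\<bar>Im (A' w) - Im w + \<alpha>\<bar> \<le> \<tau> / 8" using near_trans_Im_close[OF m(2)] A(2) by simp
      then have "\<bar>Im (A' w)\<bar> < \<theta> + \<tau> / 2" using that \<tau> unfolding \<mu>_def mem_Collect_eq by linarith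
      then show ?thesis using m by simp
    qed
    have holA': "A' holomorphic_on ?S" by (rule holomorphic_on_subset[OF M4]) (auto simp: M_def)
    have "(H \<circ> A') holomorphic_on ?S"
      by (rule holomorphic_on_compose_gen[OF holA' H(1)]) (use in_strip in blast)
    moreover have "(p \<circ> A') holomorphic_on ?S"
      by (rule holomorphic_on_compose_gen[OF holA' pq(1)]) (use in_strip in blast)
    ultimately show "\<Phi> holomorphic_on ?S" unfolding \<Phi>_def [abs_def] o_def by (intro holomorphic_intros)
  next
    fix w assume "Re w < M" "a (exp (Re w)) < Im w" "Im w < b (exp (Re w))"
    then show "\<Phi> w = f0 (exp w) \<and> \<alpha> - \<mu> / 2 < Im w \<and> Im w < \<beta> + \<mu> / 2" using M5[of w] by (simp add: M_def)
  next
    fix R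
    obtain P1 where P1: "P1 \<in> explog (corner_exps \<theta> d)" "exp_order (\<theta> + \<mu>) R (\<lambda>w. H w - P1 w)"
      using E.expansion unfolding \<mu>_def by blast
    obtain P2 where P2: "P2 \<in> explog (corner_exps \<theta> d)" "exp_order (\<theta> + \<mu>) R (\<lambda>w. p w - P2 w)"
      using p_expansion by blast
    have P: "(\<lambda>w. P1 w + P2 w) \<in> explog (corner_exps \<theta> d)" by (intro explog_add P1 P2)
    have "exp_order (\<theta> + \<mu>) R (\<lambda>w. (H w - P1 w) + (p w - P2 w))" by (intro exp_order_add P1 P2)
    then have ord: "exp_order (\<theta> + \<mu>) R (\<lambda>w. (H w + p w) - (P1 w + P2 w))" by (simp add: algebra_simps)
    have "near_trans (- cA + \<i> * of_real \<alpha>) (\<lambda>w. A' (w + \<i> * of_real \<alpha>))"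
      by (rule near_trans_compose[OF A'(1) near_trans_translation])
    moreover have "- cA + \<i> * of_real \<alpha> = of_real (- Re cA)" using A(2) by (simp add: complex_eq_iff)
    ultimately have "near_trans (of_real (- Re cA)) (\<lambda>w. A' (w + \<i> * of_real \<alpha>))" by simp
    from expansion_near_trans[OF P ord this d]
    show "\<exists>P \<in> explog (corner_exps \<theta> d). exp_order (\<theta> + \<mu>) R (\<lambda>w. \<Phi> (w + \<i> * of_real \<alpha>) - P w)"
      by (simp add: \<Phi>_def)
  qed
qed

end

section \<open>Transfer to the Riemann surface of the logarithm\<close>
text \<open>The effect on the series of replacing the logarithm by its value plus \<open>c\<close>:
  the power contributes the factor \<open>exp (\<alpha> * c)\<close>, and composing with a monic
  linear polynomial keeps monic polynomials monic. It accounts for the choice of sheet and for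
  centring strips at 0.\<close>

definition shift_series :: "complex \<Rightarrow> gen_series \<Rightarrow> gen_series" where
  "shift_series c g = (\<lambda>\<alpha>. fst g \<alpha> * exp (of_real \<alpha> * c), \<lambda>\<alpha>. pcompose (snd g \<alpha>) [:c, 1:])"

lemma log_sum_shift_series: "log_sum (shift_series c g) R w = log_sum g R (w + c)"
proof -
  have "{\<alpha>. 0 \<le> \<alpha> \<and> \<alpha> \<le> R \<and> fst (shift_series c g) \<alpha> \<noteq> 0} = {\<alpha>. 0 \<le> \<alpha> \<and> \<alpha> \<le> R \<and> fst g \<alpha> \<noteq> 0}"
    by (simp add: shift_series_def)
  then show ?thesis
    unfolding log_sum_def
    by (simp add: shift_series_def poly_pcompose exp_add ring_distribs mult_ac add.commute)
qed

lemma shift_series_log_series: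
  assumes "g \<in> log_series"
  shows "shift_series c g \<in> log_series"
proof -
  obtain a P where g: "g = (a, P)" by (cases g)
  have P: "\<And>\<alpha>. \<alpha> \<ge> 0 \<Longrightarrow> lead_coeff (P \<alpha>) = 1" "P 0 = 1" "\<And>R. R > 0 \<Longrightarrow> finite ({\<alpha>. 0 \<le> \<alpha> \<and> a \<alpha> \<noteq> 0} \<inter> {0..R})"
    using assms by (auto simp: g log_series_def)
  have "lead_coeff (pcompose (P \<alpha>) [:c, 1:]) = 1" if "\<alpha> \<ge> 0" for \<alpha>
    using lead_coeff_comp[of "[:c, 1:]" "P \<alpha>"] P(1)[OF that] by simp
  then show ?thesis using P by (auto simp: log_series_def shift_series_def g pcompose_1)
qed

lemma shift_series_power_series:
  assumes "g \<in> power_series_real_exp"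
  shows "shift_series c g \<in> power_series_real_exp"
proof -
  obtain a P where g: "g = (a, P)" by (cases g)
  have "shift_series c g \<in> log_series"
    using assms by (intro shift_series_log_series) (auto simp: power_series_real_exp_def)
  moreover have "\<And>\<alpha>. \<alpha> \<ge> 0 \<Longrightarrow> P \<alpha> = 1" using assms by (auto simp: g power_series_real_exp_def)
  ultimately show ?thesis by (auto simp: power_series_real_exp_def shift_series_def g pcompose_1)
qed

section \<open>Embeddings of the sector and their sheets\<close>

lemma lproj_eq_exp: "fst z > 0 \<Longrightarrow> lproj z = exp (llog z)"
  by (simp add: lproj_def llog_def exp_eq_polar)

lemma lproj_rcis: "lproj z = rcis (fst z) (snd z)"
  by (simp add: lproj_def rcis_def)

lemma rcis_eq_rcis:
  assumes "rcis s x = rcis s y" "s > 0"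
  obtains k :: int where "x = y + 2 * pi * of_int k"
proof -
  have "cis x = cis y" using assms by (simp add: rcis_def)
  then have "exp (\<i> * of_real x) = exp (\<i> * of_real y)" by (simp add: cis_conv_exp)
  then obtain n :: int where "\<i> * of_real x = \<i> * of_real y + (of_int (2 * n) * pi) * \<i>" unfolding exp_eq by blast
  then have "Im (\<i> * of_real x) = Im (\<i> * of_real y + (of_int (2 * n) * pi) * \<i>)" by (rule arg_cong)
  then have "x = y + of_int (2 * n) * pi" by simp
  then show thesis using that[of n] by simp
qed

text \<open>Each point of the sector has a lift in \<open>D'\<close> since the projection is onto,
  and only one by injectivity. Openness of \<open>D'\<close> makes the sheet number locally
  constant, and connectedness makes it constant.\<close>

lemma embedding_sheet:
  fixes a b :: "real \<Rightarrow> real"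
  assumes D': "open D'" "log_embedding D' (D \<inter> ball 0 r)" and r: "r > 0"
    and \<rho>: "0 < \<rho>1" "\<rho>1 \<le> \<rho>"
    and sector: "D \<inter> ball 0 \<rho> = {rcis s \<phi> | s \<phi>. 0 < s \<and> s < \<rho> \<and> a s < \<phi> \<and> \<phi> < b s}"
    and mid: "\<And>s. 0 < s \<Longrightarrow> s < \<rho>1 \<Longrightarrow> a s < m \<and> m < b s"
  obtains K :: int where "\<And>z. z \<in> D' \<Longrightarrow> fst z < \<rho>1 \<Longrightarrow> a (fst z) < snd z - 2 * pi * of_int K \<and> snd z - 2 * pi * of_int K < b (fst z)"
proof -
  have E: "D' \<subseteq> log_surface" "inj_on lproj D'" "lproj ` D' = D \<inter> ball 0 r"
    using D'(2) by (auto simp: log_embedding_def)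
  define r1 where "r1 = min r \<rho>1"
  have r1: "r1 > 0" "r1 \<le> r" "r1 \<le> \<rho>1" using r \<rho> by (auto simp: r1_def)
  define S where "S = {x. 0 < fst x \<and> fst x < r1 \<and> a (fst x) < snd x \<and> snd x < b (fst x)}"
  define sh where "sh x k = (fst x, snd x + 2 * pi * of_int k)" for x :: "real \<times> real" and k :: int
  have uniq: "k = k'" if "sh x k \<in> D'" "sh x k' \<in> D'" for x k k'
  proof -
    have "cis (snd x + 2 * pi * of_int j) = cis (snd x)" for j :: int
      by (simp add: cis_mult [symmetric] cis_multiple_2pi)
    then have "lproj (sh x k) = lproj (sh x k')" by (simp add: lproj_def sh_def)
    then have "sh x k = sh x k'" using E(2) that by (meson inj_onD)
    then show ?thesis by (simp add: sh_def)
  qed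
  have "\<exists>k. sh x k \<in> D'" if x: "x \<in> S" for x
  proof -
    have s: "0 < fst x" "fst x < r" "fst x < \<rho>" using x r1 \<rho> by (auto simp: S_def)
    have "rcis (fst x) (snd x) \<in> D \<inter> ball 0 \<rho>" unfolding sector using x s by (auto simp: S_def)
    then have "rcis (fst x) (snd x) \<in> D \<inter> ball 0 r" using s by simp
    then obtain z where z: "z \<in> D'" "rcis (fst x) (snd x) = lproj z" unfolding E(3) [symmetric] by blast
    have "fst z > 0" using z(1) E(1) by (auto simp: log_surface_def)
    then have "fst z = fst x" using arg_cong[OF z(2), of norm] s by (simp add: lproj_rcis)
    then obtain k where "snd z = snd x + 2 * pi * of_int k"
      using rcis_eq_rcis[of "fst x" "snd z" "snd x"] z(2) s by (auto simp: lproj_rcis)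
    then have "z = sh x k" using \<open>fst z = fst x\<close> by (simp add: sh_def prod_eq_iff)
    then show ?thesis using z by blast
  qed
  then obtain \<kappa> where \<kappa>: "\<And>x. x \<in> S \<Longrightarrow> sh x (\<kappa> x) \<in> D'" by metis
  have loc: "eventually (\<lambda>y. y \<in> S \<longrightarrow> \<kappa> x = \<kappa> y) (nhds x)" if x: "x \<in> S" for x
  proof -
    have "continuous (at x) (\<lambda>y. sh y (\<kappa> x))" unfolding sh_def by (intro continuous_intros)
    then have "((\<lambda>y. sh y (\<kappa> x)) \<longlongrightarrow> sh x (\<kappa> x)) (nhds x)" 
      unfolding continuous_at by (simp only: tendsto_at_iff_tendsto_nhds[of "\<lambda>y. sh y (\<kappa> x)" x])
    then have "eventually (\<lambda>y. sh y (\<kappa> x) \<in> D') (nhds x)" using \<kappa>[OF x] D'(1) by (simp add: topological_tendstoD)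
    then show ?thesis by eventually_elim (use uniq \<kappa> in blast)
  qed
  have const: "\<kappa> x = \<kappa> y" if "connected T" "T \<subseteq> S" "x \<in> T" "y \<in> T" for T x y
  proof (rule connected_local_const[OF that(1,3,4)])
    show "\<forall>a\<in>T. eventually (\<lambda>b. \<kappa> a = \<kappa> b) (at a within T)"
    proof
      fix c assume "c \<in> T"
      then have "eventually (\<lambda>y. y \<in> S \<longrightarrow> \<kappa> c = \<kappa> y) (nhds c)" using loc that(2) by blast
      then show "eventually (\<lambda>b. \<kappa> c = \<kappa> b) (at c within T)"
        unfolding eventually_at_filter by eventually_elim (use that(2) in blast)
    qed
  qed
  define K where "K = \<kappa> (r1 / 2, m)"
  \<comment> \<open>Any two points of \<open>S\<close> are joined through the ray of angle
    \<open>m\<close>: vertically to the ray, then along it.\<close>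
  have K: "\<kappa> x = K" if x: "x \<in> S" for x
  proof -
    have s: "0 < fst x" "fst x < r1" using x by (auto simp: S_def)
    have "\<kappa> x = \<kappa> (fst x, m)"
    proof (rule const)
      show "connected ({fst x} \<times> {a (fst x)<..<b (fst x)})" by (intro connected_Times) auto
    qed (use x mid[of "fst x"] s r1 in \<open>auto simp: S_def mem_Times_iff\<close>)
    also have "\<dots> = \<kappa> (r1 / 2, m)"
    proof (rule const)
      show "connected ({0<..<r1} \<times> {m})" by (intro connected_Times) auto
    qed (use mid s r1 in \<open>auto simp: S_def\<close>)
    finally show ?thesis by (simp add: K_def)
  qed
  show thesis
  proof (rule that[of K])
    fix z assume z: "z \<in> D'" "fst z < \<rho>1"
    have zp: "fst z > 0" using z(1) E(1) by (auto simp: log_surface_def)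
    have "lproj z \<in> D \<inter> ball 0 r" using z(1) E(3) by blast
    then have zr: "fst z < r" and "lproj z \<in> D" using zp by (auto simp: lproj_rcis)
    then have "lproj z \<in> D \<inter> ball 0 \<rho>" using z \<rho> zp by (auto simp: lproj_rcis)
    then obtain s \<phi> where s: "lproj z = rcis s \<phi>" "0 < s" "s < \<rho>" "a s < \<phi>" "\<phi> < b s" unfolding sector by blast
    have sz: "s = fst z" using arg_cong[OF s(1), of norm] s zp by (simp add: lproj_rcis)
    obtain k where k: "snd z = \<phi> + 2 * pi * of_int k"
      using rcis_eq_rcis[of "fst z" "snd z" \<phi>] s zp by (auto simp: lproj_rcis sz)
    have x: "(s, \<phi>) \<in> S" using s sz z zr by (auto simp: S_def r1_def)
    have "z = sh (s, \<phi>) k" using k sz by (simp add: sh_def prod_eq_iff)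
    then have "k = \<kappa> (s, \<phi>)" using uniq \<kappa>[OF x] z(1) by blast
    then show "a (fst z) < snd z - 2 * pi * of_int K \<and> snd z - 2 * pi * of_int K < b (fst z)"
      using K[OF x] k s sz by simp
  qed
qed

lemma eventually_lmod_to_0:
  assumes "e > 0" "\<And>z. z \<in> S \<Longrightarrow> 0 < lmod z \<Longrightarrow> lmod z < e \<Longrightarrow> P z"
  shows "eventually P (lmod_to_0 S)"
  unfolding lmod_to_0_def eventually_inf_principal eventually_filtercomap
  using assms by (intro exI[of _ "\<lambda>x. 0 < x \<and> x < e"]) (auto intro: eventually_at_rightI)

text \<open>The embedded domain is, near \<open>0\<close>, one translate of the sector, on which the germ \<open>\<Phi>\<close>
  of the local extension is available.\<close>

lemma expansion_on_embedding:
  fixes a b :: "real \<Rightarrow> real" and D :: "complex set"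
  assumes f0: "f0 holomorphic_on D" "\<And>z. z \<in> D \<Longrightarrow> Re (f0 z) = u z"
    and \<rho>: "0 < \<rho>"
    and sector: "D \<inter> ball 0 \<rho> = {rcis s \<phi> | s \<phi>. 0 < s \<and> s < \<rho> \<and> a s < \<phi> \<and> \<phi> < b s}"
    and \<rho>1: "0 < \<rho>1" "\<rho>1 \<le> \<rho>" "\<rho>1 \<le> exp M" and mid: "\<And>s. 0 < s \<Longrightarrow> s < \<rho>1 \<Longrightarrow> a s < m \<and> m < b s"
    and \<mu>: "\<mu> > 0" and \<Phi>: "\<Phi> holomorphic_on {w. Re w < M \<and> \<alpha> - \<mu> < Im w \<and> Im w < \<beta> + \<mu>}"
    and \<Phi>_eq: "\<And>w. Re w < M \<Longrightarrow> a (exp (Re w)) < Im w \<Longrightarrow> Im w < b (exp (Re w)) \<Longrightarrow>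
       \<Phi> w = f0 (exp w) \<and> \<alpha> - \<mu> / 2 < Im w \<and> Im w < \<beta> + \<mu> / 2"
    and g: "g \<in> log_series" "\<theta> / pi \<notin> \<rat> \<Longrightarrow> g \<in> power_series_real_exp"
    and exp: "\<And>R. \<exists>\<sigma>>R. exp_order (\<beta> - \<alpha> + \<mu>) \<sigma> (\<lambda>w. \<Phi> (w + \<i> * of_real \<alpha>) - log_sum g R w)"
    and \<alpha>\<beta>: "\<alpha> < \<beta>"
    and D': "open D'" "log_embedding D' (D \<inter> ball 0 r)" and r: "r > 0"
  shows "\<exists>f. \<exists>g \<in> log_series.
              lholomorphic_on f D' \<and>
              continuous_on {z \<in> lclosure D'. lmod z < \<rho>1} f \<and>
              (\<forall>z\<in>D'. Re (f z) = u (lproj z)) \<and>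
              (\<forall>R>0. (\<lambda>z. f z - partial_series g R z)
                        \<in> o[lmod_to_0 (lclosure D')](\<lambda>z. of_real (lmod z powr R))) \<and>
              (\<theta> / pi \<notin> \<rat> \<longrightarrow> g \<in> power_series_real_exp)"
proof -
  obtain K :: int where K: "\<And>z. z \<in> D' \<Longrightarrow> fst z < \<rho>1 \<Longrightarrow> a (fst z) < snd z - 2 * pi * of_int K \<and> snd z - 2 * pi * of_int K < b (fst z)"
    by (rule embedding_sheet[OF D' r \<rho>1(1,2) sector mid]) auto
  have E: "D' \<subseteq> log_surface" "lproj ` D' = D \<inter> ball 0 r"
    using D'(2) by (auto simp: log_embedding_def)
  define \<gamma> where "\<gamma> = 2 * pi * of_int K"
  define L where "L z = llog z - \<i> * of_real \<gamma>" for z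
  \<comment> \<open>Both branches agree on \<open>D'\<close>, but only the one with
    \<open>\<Phi>\<close> has values on the boundary near 0, with separate values on the two sides
    of a slit.\<close>
  define f where "f z = (if fst z < \<rho>1 then \<Phi> (L z) else f0 (lproj z))" for z
  \<comment> \<open>Undoes the sheet shift \<gamma> and the centring at \<alpha>.\<close>
  define g' where "g' = shift_series (- (\<i> * of_real (\<gamma> + \<alpha>))) g"
  have fD: "f z = f0 (lproj z) \<and> (fst z < \<rho>1 \<longrightarrow> \<alpha> - \<mu> / 2 < snd z - \<gamma> \<and> snd z - \<gamma> < \<beta> + \<mu> / 2)" if z: "z \<in> D'" for z
  proof (cases "fst z < \<rho>1")
    case True
    have zp: "fst z > 0" using z E by (auto simp: log_surface_def)
    have L: "Re (L z) = ln (fst z)" "Im (L z) = snd z - \<gamma>" by (auto simp: L_def llog_def)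
    have "ln (fst z) < ln (exp M)" using True \<rho>1 zp by (subst ln_less_cancel_iff) auto
    then have "\<Phi> (L z) = f0 (exp (L z)) \<and> \<alpha> - \<mu> / 2 < Im (L z) \<and> Im (L z) < \<beta> + \<mu> / 2"
      using K[OF z True] zp by (intro \<Phi>_eq) (auto simp: L \<gamma>_def)
    moreover have "exp (L z) = lproj z"
    proof -
      have "exp (L z) = exp (llog z - of_int (2 * K) * of_real pi * \<i>)" by (simp add: L_def \<gamma>_def mult_ac)
      also have "\<dots> = exp (llog z)" unfolding exp_eq by (intro exI[of _ "- K"]) simp
      finally show ?thesis using lproj_eq_exp[OF zp] by simp
    qed
    ultimately show ?thesis using True by (simp add: f_def L)
  qed (simp add: f_def)
  have holf: "lholomorphic_on f D'"
    unfolding lholomorphic_on_def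
  proof (rule holomorphic_transform)
    show "(f0 \<circ> exp) holomorphic_on llog ` D'"
    proof (rule holomorphic_on_compose_gen[OF _ f0(1)])
      have "exp (llog z) \<in> D" if z: "z \<in> D'" for z
      proof -
        have "fst z > 0" using z E by (auto simp: log_surface_def)
        moreover have "lproj z \<in> D" using z E(2) by blast
        ultimately show ?thesis using lproj_eq_exp[of z] by simp
      qed
      then show "exp ` llog ` D' \<subseteq> D" by blast
    qed (intro holomorphic_intros)
    fix w assume "w \<in> llog ` D'"
    then obtain z where z: "z \<in> D'" "w = llog z" by blast
    have zp: "fst z > 0" using z E by (auto simp: log_surface_def)
    then have "lexp w = z" by (simp add: z lexp_def llog_def prod_eq_iff)
    then show "(f0 \<circ> exp) w = (f \<circ> lexp) w" using fD[OF z(1)] lproj_eq_exp[OF zp] z(2) by simp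
  qed
  \<comment> \<open>The strict bounds with margin \<open>\<mu> / 2\<close> on \<open>D'\<close>
    become weak ones on its closure, still inside the strip of width \<mu> where
    \<open>\<Phi>\<close> is holomorphic.\<close>
  have clos: "0 < fst z \<and> \<alpha> - \<mu> / 2 \<le> snd z - \<gamma> \<and> snd z - \<gamma> \<le> \<beta> + \<mu> / 2" if z: "z \<in> lclosure D'" "fst z < \<rho>1" for z
  proof -
    let ?U = "{..<\<rho>1} \<times> (UNIV :: real set)"
    let ?C = "(UNIV :: real set) \<times> {\<alpha> - \<mu> / 2 + \<gamma>..\<beta> + \<mu> / 2 + \<gamma>}"
    have "z \<in> ?U \<inter> closure D'" using z by (auto simp: lclosure_def mem_Times_iff)
    also have "\<dots> \<subseteq> closure (?U \<inter> D')" by (rule open_Int_closure_subset) (intro open_Times, auto)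
    also have "\<dots> \<subseteq> ?C"
    proof (rule closure_minimal)
      show "?U \<inter> D' \<subseteq> ?C"
      proof
        fix x assume "x \<in> ?U \<inter> D'"
        then have "x \<in> D'" "fst x < \<rho>1" by (auto simp: mem_Times_iff)
        then show "x \<in> ?C" using fD[of x] by (auto simp: mem_Times_iff)
      qed
      show "closed ?C" by (intro closed_Times) auto
    qed
    finally show ?thesis using z by (auto simp: mem_Times_iff lclosure_def log_surface_def)
  qed
  have contf: "continuous_on {z \<in> lclosure D'. lmod z < \<rho>1} f"
  proof -
    let ?T = "{z \<in> lclosure D'. lmod z < \<rho>1}"
    let ?S = "{w. Re w < M \<and> \<alpha> - \<mu> < Im w \<and> Im w < \<beta> + \<mu>}"
    have LS: "L z \<in> ?S" if z: "z \<in> ?T" for z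
    proof -
      have c: "0 < fst z" "\<alpha> - \<mu> / 2 \<le> snd z - \<gamma>" "snd z - \<gamma> \<le> \<beta> + \<mu> / 2" using clos[of z] z by (auto simp: lmod_def)
      have "ln (fst z) < ln (exp M)" using z \<rho>1 c(1) by (subst ln_less_cancel_iff) (auto simp: lmod_def)
      then show ?thesis using c \<mu> by (simp add: L_def llog_def)
    qed
    have cL: "continuous_on ?T L"
      unfolding L_def llog_def using clos by (intro continuous_intros) (force simp: lmod_def)+
    have "continuous_on ?T (\<lambda>z. \<Phi> (L z))"
      by (rule continuous_on_compose2[OF holomorphic_on_imp_continuous_on[OF \<Phi>] cL]) (use LS in blast)
    then show ?thesis by (rule continuous_on_eq) (auto simp: f_def lmod_def)
  qed
  have asym: "(\<lambda>z. f z - partial_series g' R z) \<in> o[lmod_to_0 (lclosure D')](\<lambda>z. of_real (lmod z powr R))" for R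
  proof (rule landau_o.smallI)
    fix c :: real assume c: "c > 0"
    obtain \<sigma> where \<sigma>: "\<sigma> > R" "exp_order (\<beta> - \<alpha> + \<mu>) \<sigma> (\<lambda>w. \<Phi> (w + \<i> * of_real \<alpha>) - log_sum g R w)" using exp by blast
    have "\<beta> - \<alpha> + \<mu> / 2 < \<beta> - \<alpha> + \<mu>" using \<mu> by simp
    then obtain C M1 where C: "C > 0" "\<And>w. Re w \<le> M1 \<Longrightarrow> \<bar>Im w\<bar> \<le> \<beta> - \<alpha> + \<mu> / 2 \<Longrightarrow>
        norm (\<Phi> (w + \<i> * of_real \<alpha>) - log_sum g R w) \<le> C * exp (\<sigma> * Re w)"
      using exp_orderD[OF \<sigma>(2)] by metis
    \<comment> \<open>The last entry makes \<open>C * t powr (\<sigma> - R) \<le> c\<close>, which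
      turns order \<sigma> into little-o of order \<open>R\<close>.\<close>
    define e where "e = min (min \<rho>1 (exp M1)) ((c / C) powr (1 / (\<sigma> - R)))"
    have e: "e > 0" using \<rho>1 c C by (simp add: e_def)
    show "eventually (\<lambda>z. norm (f z - partial_series g' R z) \<le> c * norm (complex_of_real (lmod z powr R))) (lmod_to_0 (lclosure D'))"
    proof (rule eventually_lmod_to_0[OF e])
      fix z assume z: "z \<in> lclosure D'" "0 < lmod z" "lmod z < e"
      define t where "t = fst z"
      have t: "0 < t" "t < \<rho>1" "t < exp M1" "t < (c / C) powr (1 / (\<sigma> - R))" using z by (auto simp: t_def lmod_def e_def)
      have cl: "\<alpha> - \<mu> / 2 \<le> snd z - \<gamma>" "snd z - \<gamma> \<le> \<beta> + \<mu> / 2" using clos[of z] z(1) t by (auto simp: t_def)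
      define w where "w = L z - \<i> * of_real \<alpha>"
      have w: "Re w = ln t" "Im w = snd z - \<gamma> - \<alpha>" by (auto simp: w_def L_def llog_def t_def)
      have "ln t < ln (exp M1)" using t by (subst ln_less_cancel_iff) auto
      then have "norm (\<Phi> (w + \<i> * of_real \<alpha>) - log_sum g R w) \<le> C * exp (\<sigma> * Re w)"
        using cl \<alpha>\<beta> \<mu> by (intro C(2)) (auto simp: w)
      moreover have "\<Phi> (w + \<i> * of_real \<alpha>) = f z" using t by (simp add: w_def f_def t_def)
      moreover have "log_sum g R w = partial_series g' R z"
      proof -
        have "w = llog z + (- (\<i> * of_real (\<gamma> + \<alpha>)))" by (simp add: w_def L_def algebra_simps)
        then show ?thesis unfolding partial_series_conv g'_def log_sum_shift_series by simp
      qed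
      moreover have "exp (\<sigma> * Re w) = t powr \<sigma>" using t by (simp add: w powr_def)
      ultimately have 1: "norm (f z - partial_series g' R z) \<le> C * t powr \<sigma>" by simp
      have "t powr (\<sigma> - R) \<le> ((c / C) powr (1 / (\<sigma> - R))) powr (\<sigma> - R)"
        using t \<sigma> by (intro powr_mono2) auto
      also have "\<dots> = c / C" using \<sigma> c C by (simp add: powr_powr)
      finally have "C * t powr (\<sigma> - R) \<le> c" using C by (simp add: field_simps)
      then have "C * t powr (\<sigma> - R) * t powr R \<le> c * t powr R" by (rule mult_right_mono) simp
      then have "C * t powr \<sigma> \<le> c * t powr R" using t by (simp add: powr_diff)
      then show "norm (f z - partial_series g' R z) \<le> c * norm (complex_of_real (lmod z powr R))"
        using 1 by (simp add: lmod_def t_def)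
    qed
  qed
  have "g' \<in> log_series" unfolding g'_def by (rule shift_series_log_series[OF g(1)])
  moreover have "\<theta> / pi \<notin> \<rat> \<longrightarrow> g' \<in> power_series_real_exp" unfolding g'_def using g(2) shift_series_power_series by blast
  moreover have "\<forall>z\<in>D'. Re (f z) = u (lproj z)" 
  proof
    fix z assume z: "z \<in> D'"
    then have "lproj z \<in> D" using E(2) by blast
    then show "Re (f z) = u (lproj z)" using fD[OF z] f0(2) by simp
  qed
  ultimately show ?thesis using holf contf asym by blast
qed

section \<open>Dirichlet solutions at an analytic corner\<close>
lemma arc_in_frontier:
  assumes \<psi>: "\<psi> holomorphic_on ball 0 1" "\<psi> 0 = 0" and r0: "r0 > 0"
    and fr: "frontier D \<inter> ball 0 r0 =
        ((\<lambda>t. \<psi> (of_real t)) ` {0..<1} \<union> (\<lambda>t. \<eta> (of_real t)) ` {0..<1}) \<inter> ball 0 r0"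
  obtains e where "0 < e" "e \<le> 1" "\<And>t. 0 \<le> t \<Longrightarrow> t < e \<Longrightarrow> \<psi> (complex_of_real t) \<in> frontier D"
proof -
  have "continuous (at 0) \<psi>"
    using holomorphic_on_imp_continuous_on[OF \<psi>(1)] by (simp add: continuous_on_eq_continuous_at)
  then obtain e where e: "e > 0" "\<And>q. dist q 0 < e \<Longrightarrow> dist (\<psi> q) (\<psi> 0) < r0"
    using r0 unfolding continuous_at_eps_delta by metis
  have "\<psi> (complex_of_real t) \<in> frontier D" if t: "0 \<le> t" "t < min e 1" for t
  proof -
    have "\<psi> (of_real t) \<in> ball 0 r0" using e(2)[of "of_real t"] t \<psi>(2) by (simp add: dist_norm)
    moreover have "\<psi> (of_real t) \<in> (\<lambda>t. \<psi> (of_real t)) ` {0..<1}" using t by auto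
    ultimately show ?thesis using fr by blast
  qed
  then show thesis using that[of "min e 1"] e by auto
qed

text \<open>Both arcs end at 0, so by continuity of \<open>u\<close> both Puiseux series have the
  constant term \<open>u 0\<close>. This is the source of \<open>K 0 = 0\<close> in the difference
  equation.\<close>

lemma boundary_value_at_corner:
  assumes u: "continuous_on (closure D) u" "0 \<in> closure D"
    and \<psi>: "\<psi> holomorphic_on ball 0 1" "\<psi> 0 = 0"
    and e: "0 < e" "\<And>t. 0 \<le> t \<Longrightarrow> t < e \<Longrightarrow> \<psi> (complex_of_real t) \<in> closure D"
    and k: "k holomorphic_on ball 0 r" "r > 0" and d: "d > (0::nat)"
    and eq: "\<And>t. 0 < t \<Longrightarrow> t < e \<Longrightarrow> complex_of_real (u (\<psi> (of_real t))) = k (of_real (t powr (1 / real d)))"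
  shows "k 0 = of_real (u 0)"
proof (rule tendsto_unique[of "at_right (0::real)"])
  have "isCont k 0" using holomorphic_on_imp_continuous_on[OF k(1)] k(2) by (simp add: continuous_on_eq_continuous_at)
  moreover have "((\<lambda>t. complex_of_real (t powr (1 / real d))) \<longlongrightarrow> of_real 0) (at_right 0)"
    using d by (intro tendsto_of_real) real_asymp
  ultimately have "((\<lambda>t. k (complex_of_real (t powr (1 / real d)))) \<longlongrightarrow> k 0) (at_right 0)"
    by (intro isCont_tendsto_compose[of 0 k]) auto
  moreover have ev: "eventually (\<lambda>t. 0 < t \<and> t < e) (at_right (0::real))" 
    using eventually_at_right_real[OF e(1)] by simp
  ultimately show "((\<lambda>t. complex_of_real (u (\<psi> (of_real t)))) \<longlongrightarrow> k 0) (at_right 0)"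
    using eq by (elim Lim_transform_eventually) (auto elim: eventually_mono)
  have "isCont \<psi> 0" using holomorphic_on_imp_continuous_on[OF \<psi>(1)] by (simp add: continuous_on_eq_continuous_at)
  then have "((\<lambda>t. \<psi> (complex_of_real t)) \<longlongrightarrow> \<psi> 0) (at_right 0)"
    using isCont_tendsto_compose[of 0 \<psi> complex_of_real "at_right 0"] tendsto_of_real[OF tendsto_ident_at[of 0 "{0<..}"], where 'a = complex]
    by simp
  moreover have "eventually (\<lambda>t. \<psi> (complex_of_real t) \<in> closure D) (at_right 0)"
    using ev by eventually_elim (use e(2) in auto)
  ultimately have "((\<lambda>t. u (\<psi> (complex_of_real t))) \<longlongrightarrow> u 0) (at_right 0)"
    using continuous_on_tendsto_compose[OF u(1), of "\<lambda>t. \<psi> (complex_of_real t)" 0 "at_right 0"] u(2) \<psi>(2) by simp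
  then show "((\<lambda>t. complex_of_real (u (\<psi> (of_real t)))) \<longlongrightarrow> of_real (u 0)) (at_right 0)"
    by (rule tendsto_of_real)
qed simp

text \<open>The power \<open>x ^ n\<close> allows the Puiseux series on both arcs to be written in the same variable.\<close>

lemma puiseux_ramify:
  assumes k: "k holomorphic_on ball 0 r" "r > 0" "\<forall>x\<in>ball 0 r. k (cnj x) = cnj (k x)"
    and d: "d > 0" "n > (0::nat)" and s: "0 < s" "s \<le> min 1 r"
    and eq: "\<forall>t\<in>{0<..<\<epsilon>}. complex_of_real (g t) = k (of_real (t powr (1 / real d)))"
  shows "(\<lambda>x. k (x ^ n)) holomorphic_on ball 0 s" "\<And>x. x \<in> ball 0 s \<Longrightarrow> k (cnj x ^ n) = cnj (k (x ^ n))"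
    "k (0 ^ n) = k 0" "\<And>\<sigma>. exp \<sigma> < \<epsilon> \<Longrightarrow> complex_of_real (g (exp \<sigma>)) = k (exp (of_real \<sigma> / of_nat (d * n)) ^ n)"
proof -
  have sub: "x ^ n \<in> ball 0 r" if "x \<in> ball 0 s" for x :: complex
  proof -
    have "norm x ^ n \<le> norm x ^ 1" using that d s by (intro power_decreasing) auto
    then show ?thesis using that s by (auto simp: norm_power)
  qed
  have "(k \<circ> (\<lambda>x. x ^ n)) holomorphic_on ball 0 s"
    by (rule holomorphic_on_compose_gen[OF _ k(1)]) (use sub in \<open>auto intro!: holomorphic_intros\<close>)
  then show "(\<lambda>x. k (x ^ n)) holomorphic_on ball 0 s" by (simp add: o_def)
  show "k (cnj x ^ n) = cnj (k (x ^ n))" if "x \<in> ball 0 s" for x using bspec[OF k(3) sub[OF that]] by (simp only: complex_cnj_power)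
  show "k (0 ^ n) = k 0" using d by (simp add: power_0_left)
  fix \<sigma> assume "exp \<sigma> < \<epsilon>"
  then have "complex_of_real (g (exp \<sigma>)) = k (of_real (exp \<sigma> powr (1 / real d)))" using eq by auto
  also have "complex_of_real (exp \<sigma> powr (1 / real d)) = exp (of_real \<sigma> / of_nat d)"
    by (simp add: powr_def exp_of_real [symmetric])
  also have "\<dots> = exp (of_real \<sigma> / of_nat (d * n)) ^ n"
    using d by (simp add: exp_of_nat_mult [symmetric])
  finally show "complex_of_real (g (exp \<sigma>)) = k (exp (of_real \<sigma> / of_nat (d * n)) ^ n)" .
qed

lemma corner_expansion_ccw:
  fixes D :: "complex set" and \<psi> \<eta> :: "complex \<Rightarrow> complex"
    and h u :: "complex \<Rightarrow> real" and \<theta> :: real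
  assumes D: "open D" "connected D" "bounded D" "simply_connected D" and zero: "0 \<in> frontier D"
    and \<psi>: "\<psi> holomorphic_on ball 0 1" "\<psi> 0 = 0" "deriv \<psi> 0 \<noteq> 0"
    and \<eta>: "\<eta> holomorphic_on ball 0 1" "\<eta> 0 = 0" "deriv \<eta> 0 \<noteq> 0"
    and r0: "r0 > 0" and fr: "frontier D \<inter> ball 0 r0 =
        ((\<lambda>t. \<psi> (of_real t)) ` {0..<1} \<union> (\<lambda>t. \<eta> (of_real t)) ` {0..<1}) \<inter> ball 0 r0"
    and angle: "ccw_angle_through D \<psi> \<eta> \<theta>" and \<theta>: "0 < \<theta>"
    and corner: "corner_function h \<psi> \<eta>" and dir: "dirichlet_solution D h u"
  shows "\<exists>\<rho>>0. \<forall>r>0. \<forall>D'. open D' \<and> log_embedding D' (D \<inter> ball 0 r) \<longrightarrow>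
           (\<exists>f. \<exists>g \<in> log_series.
              lholomorphic_on f D' \<and>
              continuous_on {z \<in> lclosure D'. lmod z < \<rho>} f \<and>
              (\<forall>z\<in>D'. Re (f z) = u (lproj z)) \<and>
              (\<forall>R>0. (\<lambda>z. f z - partial_series g R z)
                        \<in> o[lmod_to_0 (lclosure D')](\<lambda>z. of_real (lmod z powr R))) \<and>
              (\<theta> / pi \<notin> \<rat> \<longrightarrow> g \<in> power_series_real_exp))"
proof -
  have u: "continuous_on (closure D) u" "harmonic_on u D" "\<And>z. z \<in> frontier D \<Longrightarrow> u z = h z"
    using dir by (auto simp: dirichlet_solution_def)
  obtain f0 where f0: "f0 holomorphic_on D" "\<And>z. z \<in> D \<Longrightarrow> Re (f0 z) = u z"
    using harmonic_is_Re_holomorphic[OF D(1,2,4) u(2)] by blast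
  have fc: "frontier D \<subseteq> closure D" by (simp add: frontier_def)
  from angle obtain \<alpha> \<beta> a b \<rho> \<delta> \<delta>' where
    sg: "sgn (deriv \<psi> 0) = cis \<alpha>" "sgn (deriv \<eta> 0) = cis \<beta>" "\<theta> = \<beta> - \<alpha>"
    and lim: "(a \<longlongrightarrow> \<alpha>) (at_right 0)" "(b \<longlongrightarrow> \<beta>) (at_right 0)"
    and pos: "0 < \<rho>" "\<delta> \<in> {0<..1}" "\<delta>' \<in> {0<..1}"
    and img: "(\<lambda>t. \<psi> (of_real t)) ` {0<..<\<delta>} = {rcis s (a s) | s. 0 < s \<and> s < \<rho>}"
      "(\<lambda>t. \<eta> (of_real t)) ` {0<..<\<delta>'} = {rcis s (b s) | s. 0 < s \<and> s < \<rho>}"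
    and sector: "D \<inter> ball 0 \<rho> = {rcis s \<phi> | s \<phi>. 0 < s \<and> s < \<rho> \<and> a s < \<phi> \<and> \<phi> < b s}"
    unfolding ccw_angle_through_def by (elim exE conjE)
  obtain A cA MA where A: "near_trans cA A" "Im cA = \<alpha>" "\<And>s. Re s \<le> MA \<Longrightarrow> exp (A s) = \<psi> (exp s)"
    "\<And>\<sigma>. \<sigma> \<le> MA \<Longrightarrow> Im (A (of_real \<sigma>)) = a (exp (Re (A (of_real \<sigma>))))"
    by (rule arc_logarithm[OF \<psi> sg(1) lim(1) pos(1,2) img(1)]) blast
  obtain B cB MB where B: "near_trans cB B" "Im cB = \<beta>" "\<And>s. Re s \<le> MB \<Longrightarrow> exp (B s) = \<eta> (exp s)"
    "\<And>\<sigma>. \<sigma> \<le> MB \<Longrightarrow> Im (B (of_real \<sigma>)) = b (exp (Re (B (of_real \<sigma>))))"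
    by (rule arc_logarithm[OF \<eta> sg(2) lim(2) pos(1,3) img(2)]) blast
  obtain A' MA' where A': "near_trans (- cA) A'" "\<And>s. Re s \<le> MA' \<Longrightarrow> A (A' s) = s" "\<And>s. Re s \<le> MA' \<Longrightarrow> A' (A s) = s"
    using near_trans_inverse[OF A(1)] by blast
  obtain B' MB' where B': "near_trans (- cB) B'" "\<And>s. Re s \<le> MB' \<Longrightarrow> B (B' s) = s" "\<And>s. Re s \<le> MB' \<Longrightarrow> B' (B s) = s"
    using near_trans_inverse[OF B(1)] by blast
  obtain eA where eA: "0 < eA" "eA \<le> 1" "\<And>t. 0 \<le> t \<Longrightarrow> t < eA \<Longrightarrow> \<psi> (complex_of_real t) \<in> frontier D"
    using arc_in_frontier[OF \<psi>(1,2) r0 fr] by blast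
  have fr': "frontier D \<inter> ball 0 r0 =
        ((\<lambda>t. \<eta> (of_real t)) ` {0..<1} \<union> (\<lambda>t. \<psi> (of_real t)) ` {0..<1}) \<inter> ball 0 r0"
    using fr by (simp add: Un_commute)
  obtain eB where eB: "0 < eB" "eB \<le> 1" "\<And>t. 0 \<le> t \<Longrightarrow> t < eB \<Longrightarrow> \<eta> (complex_of_real t) \<in> frontier D"
    using arc_in_frontier[OF \<eta>(1,2) r0 fr'] by blast
  from corner obtain \<epsilon> g0 g1 where \<epsilon>: "0 < \<epsilon>" and g0: "convergent_puiseux \<epsilon> g0" and g1: "convergent_puiseux \<epsilon> g1"
    and hg: "\<And>t. t \<in> {0<..<\<epsilon>} \<Longrightarrow> h (\<psi> (of_real t)) = g0 t \<and> h (\<eta> (of_real t)) = g1 t"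
    unfolding corner_function_def by blast
  obtain d1 :: nat and k1 r1 where k1: "d1 > 0" "r1 > 0" "k1 holomorphic_on ball 0 r1" "\<And>x. x \<in> ball 0 r1 \<Longrightarrow> k1 (cnj x) = cnj (k1 x)"
    "\<And>t. 0 < t \<Longrightarrow> t < \<epsilon> \<Longrightarrow> of_real (g0 t) = k1 (of_real (t powr (1 / real d1)))"
    by (rule convergent_puiseux_holomorphic[OF g0 \<epsilon>], rule that, assumption, assumption, assumption, blast+)
  obtain d2 :: nat and k2 r2 where k2: "d2 > 0" "r2 > 0" "k2 holomorphic_on ball 0 r2" "\<And>x. x \<in> ball 0 r2 \<Longrightarrow> k2 (cnj x) = cnj (k2 x)"
    "\<And>t. 0 < t \<Longrightarrow> t < \<epsilon> \<Longrightarrow> of_real (g1 t) = k2 (of_real (t powr (1 / real d2)))"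
    by (rule convergent_puiseux_holomorphic[OF g1 \<epsilon>], rule that, assumption, assumption, assumption, blast+)
  define e where "e = min \<epsilon> (min eA eB)"
  have e: "0 < e" "e \<le> \<epsilon>" "e \<le> eA" "e \<le> eB" using \<epsilon> eA eB by (auto simp: e_def)
  have u\<psi>: "u (\<psi> (of_real t)) = g0 t" "u (\<eta> (of_real t)) = g1 t" if "0 < t" "t < e" for t
    using that e eA(3)[of t] eB(3)[of t] hg[of t] by (auto simp: u(3))
  have "k1 0 = of_real (u 0)"
  proof (rule boundary_value_at_corner[OF u(1) _ \<psi>(1,2) e(1) _ k1(3,2,1)])
    show "0 \<in> closure D" using zero fc by blast
    show "\<psi> (of_real t) \<in> closure D" if "0 \<le> t" "t < e" for t using eA(3)[of t] that e fc by auto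
    show "of_real (u (\<psi> (of_real t))) = k1 (of_real (t powr (1 / real d1)))" if "0 < t" "t < e" for t
      using u\<psi>(1)[OF that] k1(5)[of t] that e by simp
  qed
  moreover have "k2 0 = of_real (u 0)"
  proof (rule boundary_value_at_corner[OF u(1) _ \<eta>(1,2) e(1) _ k2(3,2,1)])
    show "0 \<in> closure D" using zero fc by blast
    show "\<eta> (of_real t) \<in> closure D" if "0 \<le> t" "t < e" for t using eB(3)[of t] that e fc by auto
    show "of_real (u (\<eta> (of_real t))) = k2 (of_real (t powr (1 / real d2)))" if "0 < t" "t < e" for t
      using u\<psi>(2)[OF that] k2(5)[of t] that e by simp
  qed
  ultimately have k12: "k1 0 = k2 0" by simp
  define rk where "rk = min 1 (min r1 r2)"
  have rk: "0 < rk" "rk \<le> min 1 r1" "rk \<le> min 1 r2" using k1 k2 by (auto simp: rk_def)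
  have "\<forall>x\<in>ball 0 r1. k1 (cnj x) = cnj (k1 x)" "\<forall>t\<in>{0<..<\<epsilon>}. complex_of_real (g0 t) = k1 (of_real (t powr (1 / real d1)))"
    using k1 by auto
  \<comment> \<open>Raising the variable to the denominator of the other series gives both the
    common denominator \<open>d1 * d2\<close>.\<close>
  note kp = puiseux_ramify[OF k1(3,2) this(1) k1(1) k2(1) rk(1,2) this(2)]
  have "\<forall>x\<in>ball 0 r2. k2 (cnj x) = cnj (k2 x)" "\<forall>t\<in>{0<..<\<epsilon>}. complex_of_real (g1 t) = k2 (of_real (t powr (1 / real d2)))"
    using k2 by auto
  note kq = puiseux_ramify[OF k2(3,2) this(1) k2(1) k1(1) rk(1,3) this(2)]
  define M0 where "M0 = min (min MA MB) (ln (e / 2))"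
  have exp_e: "exp \<sigma> < e" if "\<sigma> \<le> M0" for \<sigma>
  proof -
    have "norm (exp (of_real \<sigma> :: complex)) \<le> e / 2" using that e by (intro Re_le_ln_imp) (auto simp: M0_def)
    then show ?thesis using e by simp
  qed
  have eA\<psi>: "exp (A (of_real \<sigma>)) = \<psi> (of_real (exp \<sigma>))" "exp (B (of_real \<sigma>)) = \<eta> (of_real (exp \<sigma>))" if "\<sigma> \<le> M0" for \<sigma>
    using A(3)[of "of_real \<sigma>"] B(3)[of "of_real \<sigma>"] that by (auto simp: M0_def exp_of_real)
  have "compact (closure D)" using D(3) by (simp add: compact_closure)
  then have "bounded (u ` closure D)" using u(1) by (intro compact_imp_bounded compact_continuous_image)
  then obtain Cu where Cu: "\<And>z. z \<in> closure D \<Longrightarrow> \<bar>u z\<bar> \<le> Cu" by (auto simp: bounded_iff)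
  interpret C: corner_arcs D f0 u a b \<alpha> \<beta> \<rho> M0 Cu rk A A' B B' "\<lambda>x. k1 (x ^ d2)" "\<lambda>x. k2 (x ^ d1)" cA cB "d1 * d2"
  proof
    show "eventually (\<lambda>s. A (A' s) = s \<and> A' (A s) = s) left_infinity" using A' unfolding eventually_Re_at_bot by blast
    show "eventually (\<lambda>s. B (B' s) = s \<and> B' (B s) = s) left_infinity" using B' unfolding eventually_Re_at_bot by blast
    show "rcis x \<phi> \<in> D" if "0 < x" "x < \<rho>" "a x < \<phi>" "\<phi> < b x" for x \<phi> using sector that by blast
    fix \<sigma> assume \<sigma>: "\<sigma> \<le> M0"
    show "Im (A (of_real \<sigma>)) = a (exp (Re (A (of_real \<sigma>))))" using \<sigma> by (intro A) (simp add: M0_def)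
    show "Im (B (of_real \<sigma>)) = b (exp (Re (B (of_real \<sigma>))))" using \<sigma> by (intro B) (simp add: M0_def)
    have ee: "0 \<le> exp \<sigma>" "0 < exp \<sigma>" "exp \<sigma> < eA" "exp \<sigma> < eB" "exp \<sigma> < \<epsilon>" using exp_e[OF \<sigma>] e by auto
    show "exp (A (of_real \<sigma>)) \<in> closure D" unfolding eA\<psi>[OF \<sigma>] using eA(3)[OF ee(1,3)] fc by blast
    show "exp (B (of_real \<sigma>)) \<in> closure D" unfolding eA\<psi>[OF \<sigma>] using eB(3)[OF ee(1,4)] fc by blast
    show "of_real (u (exp (A (of_real \<sigma>)))) = k1 (exp (of_real \<sigma> / of_nat (d1 * d2)) ^ d2)"
      unfolding eA\<psi>[OF \<sigma>] u\<psi>(1)[OF ee(2) exp_e[OF \<sigma>]] by (rule kp(4)[OF ee(5)])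
    show "of_real (u (exp (B (of_real \<sigma>)))) = k2 (exp (of_real \<sigma> / of_nat (d1 * d2)) ^ d1)"
      unfolding eA\<psi>[OF \<sigma>] u\<psi>(2)[OF ee(2) exp_e[OF \<sigma>]] using kq(4)[OF ee(5)] by (simp add: mult.commute)
  next
    show "k1 (0 ^ d2) = k2 (0 ^ d1)" using k12 kp(3) kq(3) by simp
    show "\<alpha> < \<beta>" using sg(3) \<theta> by simp
    show "0 < d1 * d2" using k1(1) k2(1) by simp
  qed (fact D(1) f0 u(1) Cu A(1,2) B(1,2) A'(1) B'(1) lim pos(1) kp(1,2) kq(1,2) rk(1))+
  have C\<theta>: "C.\<theta> = \<theta>" by (simp add: C.\<theta>_def sg)
  obtain \<Phi> M \<mu> where \<mu>: "\<mu> > 0" and \<Phi>: "\<Phi> holomorphic_on {w. Re w < M \<and> \<alpha> - \<mu> < Im w \<and> Im w < \<beta> + \<mu>}"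
    and \<Phi>_eq: "\<And>w. Re w < M \<Longrightarrow> a (exp (Re w)) < Im w \<Longrightarrow> Im w < b (exp (Re w)) \<Longrightarrow>
       \<Phi> w = f0 (exp w) \<and> \<alpha> - \<mu> / 2 < Im w \<and> Im w < \<beta> + \<mu> / 2"
    and ex: "\<And>R. \<exists>P \<in> explog (corner_exps \<theta> (d1 * d2)). exp_order (\<theta> + \<mu>) R (\<lambda>w. \<Phi> (w + \<i> * of_real \<alpha>) - P w)"
    by (rule C.local_extension) (unfold C\<theta>, rule that, assumption, assumption, blast+)
  obtain g where g: "g \<in> log_series" "\<theta> / pi \<notin> \<rat> \<Longrightarrow> g \<in> power_series_real_exp"
    "\<And>R. \<exists>\<sigma>>R. exp_order (\<theta> + \<mu>) \<sigma> (\<lambda>w. \<Phi> (w + \<i> * of_real \<alpha>) - log_sum g R w)"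
    by (rule coherent_expansion[OF ex \<theta>]) (use k1(1) k2(1) \<theta> \<mu> in auto)
  \<comment> \<open>A ray strictly inside the limiting sector; near 0 it lies between the two arcs
    and connects all moduli.\<close>
  define m where "m = (\<alpha> + \<beta>) / 2"
  have m: "\<alpha> < m" "m < \<beta>" using sg(3) \<theta> by (auto simp: m_def)
  have "eventually (\<lambda>s. a s < m \<and> m < b s) (at_right 0)"
    using order_tendstoD(2)[OF lim(1) m(1)] order_tendstoD(1)[OF lim(2) m(2)] by (rule eventually_conj)
  then obtain s0 where s0: "s0 > 0" "\<And>s. 0 < s \<Longrightarrow> s < s0 \<Longrightarrow> a s < m \<and> m < b s"
    unfolding eventually_at_right_field by auto
  define \<rho>1 where "\<rho>1 = min (min \<rho> s0) (exp M)"
  have \<rho>1: "0 < \<rho>1" "\<rho>1 \<le> \<rho>" "\<rho>1 \<le> exp M" "\<rho>1 \<le> s0" using pos s0 by (auto simp: \<rho>1_def)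
  have mid: "a s < m \<and> m < b s" if "0 < s" "s < \<rho>1" for s using s0(2) that \<rho>1 by auto
  have g3: "\<exists>\<sigma>>R. exp_order (\<beta> - \<alpha> + \<mu>) \<sigma> (\<lambda>w. \<Phi> (w + \<i> * of_real \<alpha>) - log_sum g R w)" for R
    using g(3) by (simp only: sg(3))
  have \<alpha>\<beta>: "\<alpha> < \<beta>" using m by simp
  show ?thesis
  proof (rule exI[of _ \<rho>1], rule conjI[OF \<rho>1(1)], intro allI impI, elim conjE)
    fix r :: real and D' assume "r > 0" "open D'" "log_embedding D' (D \<inter> ball 0 r)"
    from expansion_on_embedding[OF f0 pos(1) sector \<rho>1(1,2,3) mid \<mu> \<Phi> \<Phi>_eq g(1,2) g3 \<alpha>\<beta> this(2,3,1)]
    show "\<exists>f. \<exists>g \<in> log_series.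
              lholomorphic_on f D' \<and>
              continuous_on {z \<in> lclosure D'. lmod z < \<rho>1} f \<and>
              (\<forall>z\<in>D'. Re (f z) = u (lproj z)) \<and>
              (\<forall>R>0. (\<lambda>z. f z - partial_series g R z)
                        \<in> o[lmod_to_0 (lclosure D')](\<lambda>z. of_real (lmod z powr R))) \<and>
              (\<theta> / pi \<notin> \<rat> \<longrightarrow> g \<in> power_series_real_exp)"
      by blast
  qed
qed

text \<open>Continuity up to the boundary is claimed near the corner, with a radius fixed before
  \<open>r\<close> and \<open>D'\<close>: farther away the frontier and the boundary values are
  arbitrary, and a harmonic conjugate need not extend continuously. Openness of \<open>D'\<close>
  prevents an embedding from changing sheets from point to point.\<close>

theorem theorem2p9:
  fixes D :: "complex set" and \<psi> \<eta> :: "complex \<Rightarrow> complex"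
    and h u :: "complex \<Rightarrow> real" and \<theta> :: real
  assumes "open D" and "connected D" and "bounded D" and "simply_connected D"
    and "analytic_corner D \<psi> \<eta> \<theta>"
    and "continuous_on (frontier D) h"
    and "corner_function h \<psi> \<eta>"
    and "dirichlet_solution D h u"
  shows "\<exists>\<rho>>0. \<forall>r>0. \<forall>D'. open D' \<and> log_embedding D' (D \<inter> ball 0 r) \<longrightarrow>
           (\<exists>f. \<exists>g \<in> log_series.
              lholomorphic_on f D' \<and>
              continuous_on {z \<in> lclosure D'. lmod z < \<rho>} f \<and>
              (\<forall>z\<in>D'. Re (f z) = u (lproj z)) \<and>
              (\<forall>R>0. (\<lambda>z. f z - partial_series g R z)
                        \<in> o[lmod_to_0 (lclosure D')](\<lambda>z. of_real (lmod z powr R))) \<and>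
              (\<theta> / pi \<notin> \<rat> \<longrightarrow> g \<in> power_series_real_exp))"
proof -
  obtain r0 where zero: "0 \<in> frontier D" and \<psi>: "\<psi> holomorphic_on ball 0 1" "\<psi> 0 = 0" "deriv \<psi> 0 \<noteq> 0"
    and \<eta>: "\<eta> holomorphic_on ball 0 1" "\<eta> 0 = 0" "deriv \<eta> 0 \<noteq> 0"
    and r0: "r0 > 0" and fr: "frontier D \<inter> ball 0 r0 =
        ((\<lambda>t. \<psi> (of_real t)) ` {0..<1} \<union> (\<lambda>t. \<eta> (of_real t)) ` {0..<1}) \<inter> ball 0 r0"
    and angle: "interior_angle D \<psi> \<eta> \<theta>" and \<theta>: "0 < \<theta>"
    using assms(5) unfolding analytic_corner_def by auto
  from angle consider "ccw_angle_through D \<psi> \<eta> \<theta>" | "ccw_angle_through D \<eta> \<psi> \<theta>"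
    unfolding interior_angle_def by blast
  then show ?thesis
  proof cases
    case 1
    show ?thesis by (rule corner_expansion_ccw[OF assms(1-4) zero \<psi> \<eta> r0 fr 1 \<theta> assms(7,8)])
  next
    \<comment> \<open>The remaining orientation is the same situation with the roles of the arcs
      exchanged, under which all hypotheses are symmetric.\<close>
    case 2
    have fr': "frontier D \<inter> ball 0 r0 =
        ((\<lambda>t. \<eta> (of_real t)) ` {0..<1} \<union> (\<lambda>t. \<psi> (of_real t)) ` {0..<1}) \<inter> ball 0 r0"
      using fr by (simp add: Un_commute)
    have "corner_function h \<eta> \<psi>"
      using assms(7) unfolding corner_function_def by blast
    from corner_expansion_ccw[OF assms(1-4) zero \<eta> \<psi> r0 fr' 2 \<theta> this assms(8)] show ?thesis .
  qed
qed

end
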